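(* There is a deterministic algorithm which, given an $h$-layer $S$-$T$ digraph $D=(V,A)$ with unit lengths and $h\ge1$, source and sink vertex sets $S,T\subseteq V$ and an $S$-$T$ flow $\hat f$ with $A=\text{supp}(\hat f)$, computes an $h$-length $S$-$T$ flow $f$ such that $f(a)=\hat f_a$ for every $a\in A$ and $|\text{supp}(f)|\le m$, and which can be implemented in deterministic parallel time $\tilde{O}(h)$ with $m$ processors.
   Context: $D=(V,A)$, $n=|V|$, $m=|A|$. $D$ is an $S$-$T$ DAG if for every $v$, $v$ has no in-arcs iff $v\in S$ and no out-arcs iff $v\in T$; it is an $h$-layer $S$-$T$ DAG if moreover $V$ can be partitioned as $S=V_1\sqcup V_2\sqcup\dots\sqcup V_{h+1}=T$ so that every arc goes from some $V_i$ to some $V_j$ with $j>i$. A (non-length-constrained) flow $\hat f$ assigns nonnegative values $\hat f_a$ to arcs (at most capacities); $\text{supp}(\hat f)=\{a:\hat f_a>0\}$; it is an $S$-$T$ flow if for every $v\notin S\cup T$ the total flow into $v$ equals the total flow out of $v$. With unit lengths, an $h$-length $S$-$T$ flow assigns $f_P\ge0$ to directed $S$ to $T$ paths with at most $h$ arcs, $f(a)=\sum_{P\ni a}f_P$, and $\text{supp}(f)=\{P:f_P>0\}$ (a set of paths). Parallel model: EREW PRAM. $\tilde{O}$ hides $\text{poly}(\log n)$ factors. *)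

theory Defs
  imports Complex_Main "HOL-Library.Disjoint_Sets" "Graph_Theory.Pair_Digraph"
begin

section \<open>Layered digraphs and flows\<close>

definition S_T_DAG :: "'v pair_pre_digraph \<Rightarrow> 'v set \<Rightarrow> 'v set \<Rightarrow> bool" where
  "S_T_DAG D S T \<longleftrightarrow>
     pair_fin_digraph D \<and> acyclic (parcs D) \<and> S \<subseteq> pverts D \<and> T \<subseteq> pverts D \<and>
     (\<forall>v \<in> pverts D. (in_arcs D v = {} \<longleftrightarrow> v \<in> S) \<and> (out_arcs D v = {} \<longleftrightarrow> v \<in> T))"

definition layer_S_T_DAG :: "nat \<Rightarrow> 'v pair_pre_digraph \<Rightarrow> 'v set \<Rightarrow> 'v set \<Rightarrow> bool" where
  "layer_S_T_DAG h D S T \<longleftrightarrow>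
     S_T_DAG D S T \<and>
     (\<exists>L :: nat \<Rightarrow> 'v set.
        disjoint_family_on L {1..h+1} \<and> (\<Union>i\<in>{1..h+1}. L i) = pverts D \<and>
        L 1 = S \<and> L (h+1) = T \<and>
        (\<forall>(u, v) \<in> parcs D. \<exists>i\<in>{1..h+1}. \<exists>j\<in>{1..h+1}. i < j \<and> u \<in> L i \<and> v \<in> L j))"

definition S_T_flow ::
  "'v pair_pre_digraph \<Rightarrow> ('v \<times> 'v \<Rightarrow> real) \<Rightarrow> 'v set \<Rightarrow> 'v set \<Rightarrow> ('v \<times> 'v \<Rightarrow> real) \<Rightarrow> bool" where
  "S_T_flow D U S T g \<longleftrightarrow>
     (\<forall>a \<in> parcs D. 0 \<le> g a \<and> g a \<le> U a) \<and>
     (\<forall>v \<in> pverts D - (S \<union> T). (\<Sum>a\<in>in_arcs D v. g a) = (\<Sum>a\<in>out_arcs D v. g a))"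

definition flow_supp :: "'v pair_pre_digraph \<Rightarrow> ('v \<times> 'v \<Rightarrow> real) \<Rightarrow> ('v \<times> 'v) set" where
  "flow_supp D g = {a \<in> parcs D. g a > 0}"

text \<open>
  Paths are lists of arcs, as in the digraph library. A nonempty list determines its endpoints;
  in a layered DAG with \<open>h \<ge> 1\<close> the sets \<open>S\<close> and \<open>T\<close> are disjoint, so no path below is empty.
\<close>

definition S_T_paths ::
  "'v pair_pre_digraph \<Rightarrow> 'v set \<Rightarrow> 'v set \<Rightarrow> nat \<Rightarrow> ('v \<times> 'v) list set" where
  "S_T_paths D S T h = {P. length P \<le> h \<and> (\<exists>s\<in>S. \<exists>t\<in>T. pre_digraph.apath D s P t)}"

definition arc_flow ::
  "'v pair_pre_digraph \<Rightarrow> 'v set \<Rightarrow> 'v set \<Rightarrow> nat \<Rightarrow> (('v \<times> 'v) list \<Rightarrow> real) \<Rightarrow> 'v \<times> 'v \<Rightarrow> real" where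
  "arc_flow D S T h f a = (\<Sum>P\<in>{P \<in> S_T_paths D S T h. a \<in> set P}. f P)"

text \<open>A flow is extended by 0 to lists that are not paths of the required kind.\<close>

definition length_flow ::
  "nat \<Rightarrow> 'v pair_pre_digraph \<Rightarrow> ('v \<times> 'v \<Rightarrow> real) \<Rightarrow> 'v set \<Rightarrow> 'v set \<Rightarrow>
   (('v \<times> 'v) list \<Rightarrow> real) \<Rightarrow> bool" where
  "length_flow h D U S T f \<longleftrightarrow>
     (\<forall>P \<in> S_T_paths D S T h. 0 \<le> f P) \<and> (\<forall>P. P \<notin> S_T_paths D S T h \<longrightarrow> f P = 0) \<and>
     (\<forall>a \<in> parcs D. arc_flow D S T h f a \<le> U a)"

definition path_supp :: "(('v \<times> 'v) list \<Rightarrow> real) \<Rightarrow> ('v \<times> 'v) list set" where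
  "path_supp f = {P. f P > 0}"


section \<open>The EREW PRAM\<close>

text \<open>
  All processors run the same program synchronously, each with its own program counter and its
  own registers, on a shared memory. There are two sorts of data: natural numbers (addresses,
  indices, counters), whose size is limited to a word, see \<open>fits_word\<close>, and real numbers (flow
  values), which admit only addition, subtraction, comparison, loads and stores.

  The shared memory of either sort consists of arrays: the cell \<open>(X, i)\<close> is entry \<open>i\<close> of
  array \<open>X\<close>. Array names occur in programs only as constants, so a program uses
  finitely many arrays, and these could be interleaved in one linear memory.

  Registers are addressed by constants, so each processor has a constant number of them.
  Jump targets are absolute.
\<close>

datatype operand = Reg nat | Imm nat

datatype arith = Add | Sub | Mul | Div

datatype instr =
    Arith arith nat operand operand    \<comment> \<open>operation, destination, arguments\<close>
  | Load nat nat operand               \<comment> \<open>destination, array, index\<close>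
  | Store nat operand operand          \<comment> \<open>array, index, value\<close>
  | JumpLess operand operand nat       \<comment> \<open>jump if the first argument is the smaller one\<close>
  | RAdd nat nat nat                   \<comment> \<open>destination, arguments\<close>
  | RSub nat nat nat
  | RLoad nat nat operand              \<comment> \<open>destination, array, index\<close>
  | RStore nat operand nat             \<comment> \<open>array, index, value\<close>
  | RJumpLess nat nat nat
  | Halt

type_synonym prog = "instr list"

record proc =
  pc :: nat
  reg :: "nat \<Rightarrow> nat"
  rreg :: "nat \<Rightarrow> real"

record machine =
  procs :: "nat \<Rightarrow> proc"
  mem :: "nat \<times> nat \<Rightarrow> nat"
  rmem :: "nat \<times> nat \<Rightarrow> real"

fun arith_val :: "arith \<Rightarrow> nat \<Rightarrow> nat \<Rightarrow> nat" where
  "arith_val Add x y = x + y"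
| "arith_val Sub x y = x - y"
| "arith_val Mul x y = x * y"
| "arith_val Div x y = x div y"

fun val :: "proc \<Rightarrow> operand \<Rightarrow> nat" where
  "val p (Reg r) = reg p r"
| "val p (Imm k) = k"

definition fetch :: "prog \<Rightarrow> proc \<Rightarrow> instr" where
  "fetch \<pi> p = (if pc p < length \<pi> then \<pi> ! pc p else Halt)"

fun exec :: "(nat \<times> nat \<Rightarrow> nat) \<Rightarrow> (nat \<times> nat \<Rightarrow> real) \<Rightarrow> instr \<Rightarrow> proc \<Rightarrow> proc" where
  "exec M R (Arith b d x y) p =
     p\<lparr>pc := pc p + 1, reg := (reg p)(d := arith_val b (val p x) (val p y))\<rparr>"
| "exec M R (Load d X i) p = p\<lparr>pc := pc p + 1, reg := (reg p)(d := M (X, val p i))\<rparr>"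
| "exec M R (Store X i x) p = p\<lparr>pc := pc p + 1\<rparr>"
| "exec M R (JumpLess x y l) p = p\<lparr>pc := (if val p x < val p y then l else pc p + 1)\<rparr>"
| "exec M R (RAdd d x y) p = p\<lparr>pc := pc p + 1, rreg := (rreg p)(d := rreg p x + rreg p y)\<rparr>"
| "exec M R (RSub d x y) p = p\<lparr>pc := pc p + 1, rreg := (rreg p)(d := rreg p x - rreg p y)\<rparr>"
| "exec M R (RLoad d X i) p = p\<lparr>pc := pc p + 1, rreg := (rreg p)(d := R (X, val p i))\<rparr>"
| "exec M R (RStore X i x) p = p\<lparr>pc := pc p + 1\<rparr>"
| "exec M R (RJumpLess x y l) p = p\<lparr>pc := (if rreg p x < rreg p y then l else pc p + 1)\<rparr>"
| "exec M R Halt p = p"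

fun stores :: "instr \<Rightarrow> proc \<Rightarrow> nat \<times> nat \<Rightarrow> nat option" where
  "stores (Store X i x) p = [(X, val p i) \<mapsto> val p x]"
| "stores _ p = Map.empty"

fun rstores :: "instr \<Rightarrow> proc \<Rightarrow> nat \<times> nat \<Rightarrow> real option" where
  "rstores (RStore X i x) p = [(X, val p i) \<mapsto> rreg p x]"
| "rstores _ p = Map.empty"

text \<open>
  Memory after the first \<open>N\<close> processors have stored; the descriptor \<open>THE\<close> is only
  relevant for steps satisfying \<open>erew_step\<close>, where the writer is unique.
\<close>

definition update_mem ::
  "nat \<Rightarrow> (nat \<Rightarrow> nat \<times> nat \<Rightarrow> 'w option) \<Rightarrow> (nat \<times> nat \<Rightarrow> 'w) \<Rightarrow> nat \<times> nat \<Rightarrow> 'w" where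
  "update_mem N st M x =
     (if \<exists>i<N. st i x \<noteq> None then the (st (THE i. i < N \<and> st i x \<noteq> None) x) else M x)"

definition step :: "prog \<Rightarrow> nat \<Rightarrow> machine \<Rightarrow> machine" where
  "step \<pi> N c =
     \<lparr>procs = (\<lambda>i. if i < N then exec (mem c) (rmem c) (fetch \<pi> (procs c i)) (procs c i)
                    else procs c i),
      mem = update_mem N (\<lambda>i. stores (fetch \<pi> (procs c i)) (procs c i)) (mem c),
      rmem = update_mem N (\<lambda>i. rstores (fetch \<pi> (procs c i)) (procs c i)) (rmem c)\<rparr>"

text \<open>Exclusive read, exclusive write: no shared cell is accessed by two processors in one step.\<close>

datatype cell = Cell "nat \<times> nat" | RCell "nat \<times> nat"

fun accesses :: "instr \<Rightarrow> proc \<Rightarrow> cell set" where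
  "accesses (Load d X i) p = {Cell (X, val p i)}"
| "accesses (Store X i x) p = {Cell (X, val p i)}"
| "accesses (RLoad d X i) p = {RCell (X, val p i)}"
| "accesses (RStore X i x) p = {RCell (X, val p i)}"
| "accesses _ p = {}"

definition erew_step :: "prog \<Rightarrow> nat \<Rightarrow> machine \<Rightarrow> bool" where
  "erew_step \<pi> N c \<longleftrightarrow>
     (\<forall>i<N. \<forall>j<N. i \<noteq> j \<longrightarrow>
        accesses (fetch \<pi> (procs c i)) (procs c i) \<inter> accesses (fetch \<pi> (procs c j)) (procs c j) = {})"

text \<open>
  All natural numbers in registers and memory are at most \<open>W\<close>, hence so are all indices of
  memory cells that are accessed. For \<open>W\<close> polynomial in the input parameters this amounts to
  words of logarithmic length and a memory of polynomial size.
\<close>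

definition fits_word :: "nat \<Rightarrow> nat \<Rightarrow> machine \<Rightarrow> bool" where
  "fits_word W N c \<longleftrightarrow> (\<forall>i<N. \<forall>r. reg (procs c i) r \<le> W) \<and> (\<forall>x. mem c x \<le> W)"

definition erew_run :: "prog \<Rightarrow> nat \<Rightarrow> nat \<Rightarrow> machine \<Rightarrow> nat \<Rightarrow> machine \<Rightarrow> bool" where
  "erew_run \<pi> N W c t c' \<longleftrightarrow>
     c' = (step \<pi> N ^^ t) c \<and>
     (\<forall>s<t. erew_step \<pi> N ((step \<pi> N ^^ s) c)) \<and>
     (\<forall>s\<le>t. fits_word W N ((step \<pi> N ^^ s) c)) \<and>
     (\<forall>i<N. fetch \<pi> (procs c' i) = Halt)"


section \<open>Input and output of the algorithm\<close>

text \<open>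
  The \<open>n\<close> vertices are numbered by \<open>\<nu>\<close>, and the \<open>m\<close> arcs are listed as
  \<open>\<alpha> 0, \<dots>, \<alpha> (m - 1)\<close>, in arbitrary order.
\<close>

definition numbering ::
  "'v pair_pre_digraph \<Rightarrow> ('v \<Rightarrow> nat) \<Rightarrow> (nat \<Rightarrow> 'v \<times> 'v) \<Rightarrow> bool" where
  "numbering D \<nu> \<alpha> \<longleftrightarrow>
     bij_betw \<nu> (pverts D) {..<card (pverts D)} \<and> bij_betw \<alpha> {..<card (parcs D)} (parcs D)"

text \<open>
  Each processor knows its index, \<open>n\<close>, \<open>m\<close> and \<open>h\<close>. Arrays 0 and 1 contain the tails and heads
  of the arcs, arrays 2 and 3 the characteristic functions of \<open>S\<close> and \<open>T\<close>, and the real array 0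
  the flow values of the arcs. The layers are not part of the input.
\<close>

definition input ::
  "'v pair_pre_digraph \<Rightarrow> ('v \<Rightarrow> nat) \<Rightarrow> (nat \<Rightarrow> 'v \<times> 'v) \<Rightarrow>
   'v set \<Rightarrow> 'v set \<Rightarrow> nat \<Rightarrow> ('v \<times> 'v \<Rightarrow> real) \<Rightarrow> machine" where
  "input D \<nu> \<alpha> S T h g =
     \<lparr>procs = (\<lambda>i. \<lparr>pc = 0,
        reg = (\<lambda>_. 0)(0 := i, 1 := card (pverts D), 2 := card (parcs D), 3 := h),
        rreg = (\<lambda>_. 0)\<rparr>),
      mem = (\<lambda>(X, i).
        if X = 0 \<and> i < card (parcs D) then \<nu> (fst (\<alpha> i))
        else if X = 1 \<and> i < card (parcs D) then \<nu> (snd (\<alpha> i))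
        else if X = 2 \<and> i \<in> \<nu> ` S then 1
        else if X = 3 \<and> i \<in> \<nu> ` T then 1
        else 0),
      rmem = (\<lambda>(X, i). if X = 0 \<and> i < card (parcs D) then g (\<alpha> i) else 0)\<rparr>"

text \<open>
  A flow on paths with at most \<open>h\<close> arcs is output as a list of the paths in its support, without
  repetitions, together with their flow values. Cell 0 of array 4 contains the number of paths,
  entry \<open>j\<close> of array 5 the length of path \<open>j\<close>, entries \<open>j * h, j * h + 1, \<dots>\<close> of array 6 the
  numbers of its arcs, from first to last, and entry \<open>j\<close> of the real array 1 its flow value.
\<close>

definition output_path :: "(nat \<Rightarrow> 'v \<times> 'v) \<Rightarrow> nat \<Rightarrow> machine \<Rightarrow> nat \<Rightarrow> ('v \<times> 'v) list" where
  "output_path \<alpha> h c j = map (\<lambda>k. \<alpha> (mem c (6, j * h + k))) [0..<mem c (5, j)]"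

definition outputs ::
  "(nat \<Rightarrow> 'v \<times> 'v) \<Rightarrow> nat \<Rightarrow> machine \<Rightarrow> (('v \<times> 'v) list \<Rightarrow> real) \<Rightarrow> bool" where
  "outputs \<alpha> h c f \<longleftrightarrow>
     bij_betw (output_path \<alpha> h c) {..<mem c (4, 0)} (path_supp f) \<and>
     (\<forall>j < mem c (4, 0). f (output_path \<alpha> h c j) = rmem c (1, j))"

end

theory Submission
  imports Defs "HOL-Library.Product_Lexorder"
begin

text \<open>
  Order the arcs leaving a vertex and the arcs entering it by their numbers. An arc \<open>a\<close> then occupies
  an interval of length \<open>f a\<close> among the outflow of its tail, and one among the inflow of its head; mapping
  the former to the latter by a translation, the points of the flow travel from the sources to the
  sinks. Trace the right end of the interval of every arc back to the sources, and let \<open>P\<close> be the set of at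
  most \<open>m\<close> points reached. Between two consecutive points of \<open>P\<close> nothing is separated
  on the way forward, so the path of every point of \<open>P\<close>, weighted with the distance to the
  previous point, gives the decomposition. No layering is computed: tracing takes at most
  \<open>h\<close> rounds because there is one.

  In each round all points have to find their arcs without concurrent reads: points and arcs
  are sorted together by vertex and position with a bitonic network, and the data of an arc is
  copied by a segmented scan to the points of its interval.
\<close>

text \<open>The interval of an arc begins at 0 or at the end of another arc with the same tail, so
  cuts at the right ends alone separate all arcs, and one cut per arc gives the bound m. Pulling the
  cuts back to the sources makes them common to all later vertices: moves along an arc are
  translations, and conservation makes inflow and outflow of an inner vertex the same interval, so a
  position there can be read either way. Real numbers admit only addition, subtraction and
  comparison; translating positions needs no more. Exclusive access is met by giving every virtual
  processor a set of cells of its own in each pass: data moves only along a permutation found by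
  sorting, or by a fixed shift out of a copy. The 2 m records of points and arcs are the reason for
  two virtual processors on each of the m real ones. A round costs O(log^2 m) because of the sort,
  and as arcs are pairs of vertices, log m is at most 2 log n.\<close>

declare split_paired_All [simp del] split_paired_Ex [simp del]

section \<open>Guarded straight-line code\<close>

text \<open>Every instruction carries its own guard, so decisions that depend on the data need no
  branches of different length and all processors stay at the same place of the program.\<close>

datatype guard = GLess operand operand | GRLess nat nat

type_synonym ginstr = "guard \<times> instr"

type_synonym lstate = "(nat \<Rightarrow> nat) \<times> (nat \<Rightarrow> real) \<times> (nat \<times> nat \<Rightarrow> nat) \<times> (nat \<times> nat \<Rightarrow> real)"

fun opv :: "(nat \<Rightarrow> nat) \<Rightarrow> operand \<Rightarrow> nat" where
  "opv r (Reg k) = r k"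
| "opv r (Imm k) = k"

fun holds :: "guard \<Rightarrow> (nat \<Rightarrow> nat) \<Rightarrow> (nat \<Rightarrow> real) \<Rightarrow> bool" where
  "holds (GLess x y) r q = (opv r x < opv r y)"
| "holds (GRLess x y) r q = (q x < q y)"

fun act :: "instr \<Rightarrow> lstate \<Rightarrow> lstate" where
  "act (Arith b d x y) (r, q, M, X) = (r(d := arith_val b (opv r x) (opv r y)), q, M, X)"
| "act (Load d A i) (r, q, M, X) = (r(d := M (A, opv r i)), q, M, X)"
| "act (Store A i x) (r, q, M, X) = (r, q, M((A, opv r i) := opv r x), X)"
| "act (RAdd d x y) (r, q, M, X) = (r, q(d := q x + q y), M, X)"
| "act (RSub d x y) (r, q, M, X) = (r, q(d := q x - q y), M, X)"
| "act (RLoad d A i) (r, q, M, X) = (r, q(d := X (A, opv r i)), M, X)"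
| "act (RStore A i x) (r, q, M, X) = (r, q, M, X((A, opv r i) := q x))"
| "act _ s = s"

fun acc :: "instr \<Rightarrow> (nat \<Rightarrow> nat) \<Rightarrow> cell set" where
  "acc (Load d A i) r = {Cell (A, opv r i)}"
| "acc (Store A i x) r = {Cell (A, opv r i)}"
| "acc (RLoad d A i) r = {RCell (A, opv r i)}"
| "acc (RStore A i x) r = {RCell (A, opv r i)}"
| "acc _ r = {}"

fun simple :: "instr \<Rightarrow> bool" where
  "simple (JumpLess x y l) = False"
| "simple (RJumpLess x y l) = False"
| "simple Halt = False"
| "simple _ = True"

text \<open>Only additions and multiplications can exceed the word size; immediate operands are
  the other source of large numbers.\<close>

fun opnd_ok :: "nat \<Rightarrow> operand \<Rightarrow> bool" where
  "opnd_ok W (Imm k) = (k \<le> W)"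
| "opnd_ok W (Reg k) = True"

fun word_ok :: "nat \<Rightarrow> instr \<Rightarrow> (nat \<Rightarrow> nat) \<Rightarrow> bool" where
  "word_ok W (Arith Add d x y) r = (opv r x + opv r y \<le> W)"
| "word_ok W (Arith Mul d x y) r = (opv r x * opv r y \<le> W)"
| "word_ok W (Arith b d x y) r = opnd_ok W x"
| "word_ok W (Store A i x) r = opnd_ok W x"
| "word_ok W _ r = True"

text \<open>Registers 0 to 10 are reserved: 0 for the index of the processor, 1 to 9 for the common
  values, 10 for the number of the virtual processor.\<close>

fun dest_ok :: "instr \<Rightarrow> bool" where
  "dest_ok (Arith b d x y) = (d > 10)"
| "dest_ok (Load d A i) = (d > 10)"
| "dest_ok _ = True"

fun lstep :: "ginstr \<Rightarrow> lstate \<Rightarrow> lstate" where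
  "lstep (g, ins) (r, q, M, X) = (if holds g r q then act ins (r, q, M, X) else (r, q, M, X))"

fun lfoot :: "ginstr \<Rightarrow> lstate \<Rightarrow> cell set" where
  "lfoot (g, ins) (r, q, M, X) = (if holds g r q then acc ins r else {})"

fun lsafe :: "nat \<Rightarrow> ginstr \<Rightarrow> lstate \<Rightarrow> bool" where
  "lsafe W (g, ins) (r, q, M, X) = (holds g r q \<longrightarrow> word_ok W ins r)"

fun lrun :: "ginstr list \<Rightarrow> lstate \<Rightarrow> lstate" where
  "lrun [] s = s"
| "lrun (a # b) s = lrun b (lstep a s)"

fun foot :: "ginstr list \<Rightarrow> lstate \<Rightarrow> cell set" where
  "foot [] s = {}"
| "foot (a # b) s = lfoot a s \<union> foot b (lstep a s)"

fun safe :: "nat \<Rightarrow> ginstr list \<Rightarrow> lstate \<Rightarrow> bool" where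
  "safe W [] s = True"
| "safe W (a # b) s = (lsafe W a s \<and> safe W b (lstep a s))"

fun lmem :: "lstate \<Rightarrow> nat \<times> nat \<Rightarrow> nat" where "lmem (r, q, M, X) = M"
fun lrmem :: "lstate \<Rightarrow> nat \<times> nat \<Rightarrow> real" where "lrmem (r, q, M, X) = X"
fun lreg :: "lstate \<Rightarrow> nat \<Rightarrow> nat" where "lreg (r, q, M, X) = r"
fun lrreg :: "lstate \<Rightarrow> nat \<Rightarrow> real" where "lrreg (r, q, M, X) = q"

text \<open>The memory in an \<open>lstate\<close> is a private copy that ignores what other
  processors write. It need only match the true memory on the cells \<open>F\<close> that the
  processor itself uses.\<close>

definition agree :: "cell set \<Rightarrow> lstate \<Rightarrow> (nat \<times> nat \<Rightarrow> nat) \<Rightarrow> (nat \<times> nat \<Rightarrow> real) \<Rightarrow> bool" where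
  "agree F s M X \<longleftrightarrow> (\<forall>x. Cell x \<in> F \<longrightarrow> lmem s x = M x) \<and> (\<forall>x. RCell x \<in> F \<longrightarrow> lrmem s x = X x)"

lemma lstep_outside:
  "Cell x \<notin> lfoot a s \<Longrightarrow> lmem (lstep a s) x = lmem s x"
  "RCell x \<notin> lfoot a s \<Longrightarrow> lrmem (lstep a s) x = lrmem s x"
proof -
  obtain g ins r q M X where [simp]: "a = (g, ins)" "s = (r, q, M, X)"
    by (cases a, cases s) auto
  show "Cell x \<notin> lfoot a s \<Longrightarrow> lmem (lstep a s) x = lmem s x"
    by (cases ins) (auto split: if_splits)
  show "RCell x \<notin> lfoot a s \<Longrightarrow> lrmem (lstep a s) x = lrmem s x"
    by (cases ins) (auto split: if_splits)
qed

lemma lrun_outside: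
  "(Cell x \<notin> foot b s \<longrightarrow> lmem (lrun b s) x = lmem s x) \<and>
   (RCell x \<notin> foot b s \<longrightarrow> lrmem (lrun b s) x = lrmem s x)"
  by (induction b arbitrary: s) (auto simp: lstep_outside)

section \<open>Runs of the machine\<close>

definition code_at :: "prog \<Rightarrow> nat \<Rightarrow> instr list \<Rightarrow> bool" where
  "code_at \<pi> l is \<longleftrightarrow> (\<forall>k<length is. l + k < length \<pi> \<and> \<pi> ! (l + k) = is ! k)"

lemma code_at_append:
  "code_at \<pi> l (is @ js) \<longleftrightarrow> code_at \<pi> l is \<and> code_at \<pi> (l + length is) js"
proof
  assume a: "code_at \<pi> l (is @ js)"
  have "l + length is + k < length \<pi> \<and> \<pi> ! (l + length is + k) = js ! k" if "k < length js" for k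
    using a[unfolded code_at_def, rule_format, of "length is + k"] that by (simp add: add.assoc)
  then show "code_at \<pi> l is \<and> code_at \<pi> (l + length is) js"
    using a by (force simp: code_at_def nth_append)
next
  assume a: "code_at \<pi> l is \<and> code_at \<pi> (l + length is) js"
  have "l + k < length \<pi> \<and> \<pi> ! (l + k) = (is @ js) ! k" if k: "k < length is + length js" for k
  proof (cases "k < length is")
    case False
    then have "k - length is < length js" using k by simp
    then have "l + length is + (k - length is) < length \<pi> \<and>
        \<pi> ! (l + length is + (k - length is)) = js ! (k - length is)"
      using a unfolding code_at_def by blast
    then show ?thesis using False by (simp add: nth_append)
  qed (use a in \<open>auto simp: code_at_def nth_append\<close>)
  then show "code_at \<pi> l (is @ js)" by (simp add: code_at_def)
qed

lemma code_at_fetch: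
  assumes "code_at \<pi> l is" "pc p = l + k" "k < length is"
  shows "fetch \<pi> p = is ! k"
  using assms by (auto simp: code_at_def fetch_def)

text \<open>This is \<open>erew_run\<close> without the demand that the processors have halted, so
  that runs can be concatenated.\<close>

definition reach :: "prog \<Rightarrow> nat \<Rightarrow> nat \<Rightarrow> machine \<Rightarrow> nat \<Rightarrow> machine \<Rightarrow> bool" where
  "reach \<pi> N W c t c' \<longleftrightarrow>
     c' = (step \<pi> N ^^ t) c \<and>
     (\<forall>s<t. erew_step \<pi> N ((step \<pi> N ^^ s) c)) \<and>
     (\<forall>s\<le>t. fits_word W N ((step \<pi> N ^^ s) c))"

lemma reach_refl: "fits_word W N c \<Longrightarrow> reach \<pi> N W c 0 c"
  by (simp add: reach_def)

lemma reach_trans: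
  assumes "reach \<pi> N W c t c'" "reach \<pi> N W c' t' c''"
  shows "reach \<pi> N W c (t + t') c''"
proof -
  have split: "(step \<pi> N ^^ s) c = (step \<pi> N ^^ (s - t)) c'" if "s \<ge> t" for s
  proof -
    have "(step \<pi> N ^^ ((s - t) + t)) c = (step \<pi> N ^^ (s - t)) c'"
      using assms(1) by (simp only: funpow_add o_apply reach_def)
    then show ?thesis using that by simp
  qed
  have "erew_step \<pi> N ((step \<pi> N ^^ s) c)" if "s < t + t'" for s
    using that split[of s] assms by (cases "s < t") (auto simp: reach_def)
  moreover have "fits_word W N ((step \<pi> N ^^ s) c)" if "s \<le> t + t'" for s
    using that split[of s] assms by (cases "s \<le> t") (auto simp: reach_def)
  moreover have "c'' = (step \<pi> N ^^ (t + t')) c"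
    using split[of "t + t'"] assms(2) by (simp add: reach_def)
  ultimately show ?thesis by (simp add: reach_def)
qed

lemma reach_step:
  assumes "erew_step \<pi> N c" "fits_word W N c" "fits_word W N (step \<pi> N c)"
  shows "reach \<pi> N W c 1 (step \<pi> N c)"
  using assms by (auto simp: reach_def le_Suc_eq)

lemma update_mem_writer:
  assumes "i < N" "st i x = Some w" "\<forall>j<N. j \<noteq> i \<longrightarrow> st j x = None"
  shows "update_mem N st M x = w"
proof -
  have "(THE j. j < N \<and> st j x \<noteq> None) = i"
    using assms by (intro the_equality) auto
  then show ?thesis using assms by (auto simp: update_mem_def)
qed

lemma update_mem_none:
  assumes "\<forall>j<N. st j x = None"
  shows "update_mem N st M x = M x"
  using assms by (auto simp: update_mem_def)

fun jumps :: "instr \<Rightarrow> bool" where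
  "jumps (JumpLess x y l) = True"
| "jumps (RJumpLess x y l) = True"
| "jumps _ = False"

lemma jumps_quiet:
  "jumps ins \<Longrightarrow> accesses ins p = {}"
  "jumps ins \<Longrightarrow> stores ins p = Map.empty"
  "jumps ins \<Longrightarrow> rstores ins p = Map.empty"
  "jumps ins \<Longrightarrow> reg (exec M R ins p) = reg p"
  "jumps ins \<Longrightarrow> rreg (exec M R ins p) = rreg p"
  by (cases ins; simp)+

text \<open>Jumps touch no cell, so the step is exclusive whatever the targets are, and only program
  counters change.\<close>

lemma jump_step:
  assumes "\<forall>i<N. jumps (fetch \<pi> (procs c i))" "fits_word W N c"
  shows "reach \<pi> N W c 1 (step \<pi> N c)"
    and "mem (step \<pi> N c) = mem c" and "rmem (step \<pi> N c) = rmem c"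
    and "\<forall>i<N. reg (procs (step \<pi> N c) i) = reg (procs c i)"
    and "\<forall>i<N. rreg (procs (step \<pi> N c) i) = rreg (procs c i)"
    and "\<forall>i<N. procs (step \<pi> N c) i = exec (mem c) (rmem c) (fetch \<pi> (procs c i)) (procs c i)"
proof -
  show m: "mem (step \<pi> N c) = mem c" and "rmem (step \<pi> N c) = rmem c"
    using assms(1) by (auto simp: step_def jumps_quiet update_mem_none fun_eq_iff)
  show r: "\<forall>i<N. reg (procs (step \<pi> N c) i) = reg (procs c i)"
    and "\<forall>i<N. rreg (procs (step \<pi> N c) i) = rreg (procs c i)"
    using assms(1) by (auto simp: step_def jumps_quiet)
  show "\<forall>i<N. procs (step \<pi> N c) i = exec (mem c) (rmem c) (fetch \<pi> (procs c i)) (procs c i)"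
    by (simp add: step_def)
  show "reach \<pi> N W c 1 (step \<pi> N c)"
    using assms m r by (intro reach_step) (auto simp: erew_step_def fits_word_def jumps_quiet)
qed

section \<open>Guarded instructions take three steps\<close>

definition goto :: "nat \<Rightarrow> instr" where
  "goto l = JumpLess (Imm 0) (Imm 1) l"

fun gjump :: "guard \<Rightarrow> nat \<Rightarrow> instr" where
  "gjump (GLess x y) l = JumpLess x y l"
| "gjump (GRLess x y) l = RJumpLess x y l"

text \<open>Both branches take the same number of steps, which keeps the processors synchronous.\<close>

fun gcode :: "nat \<Rightarrow> ginstr \<Rightarrow> instr list" where
  "gcode l (g, ins) = [gjump g (l + 3), JumpLess (Imm 0) (Imm 0) 0, goto (l + 5), ins, goto (l + 5)]"

fun bcode :: "nat \<Rightarrow> ginstr list \<Rightarrow> instr list" where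
  "bcode l [] = []"
| "bcode l (a # b) = gcode l a @ bcode (l + 5) b"

lemma length_gcode: "length (gcode l a) = 5"
  by (cases a) simp

lemma length_bcode: "length (bcode l b) = 5 * length b"
  by (induction b arbitrary: l) (simp_all add: length_gcode)

definition view :: "machine \<Rightarrow> nat \<Rightarrow> lstate" where
  "view c i = (reg (procs c i), rreg (procs c i), mem c, rmem c)"

lemma val_opv: "val p x = opv (reg p) x"
  by (cases x) auto

lemma jumps_gjump: "jumps (gjump g l)"
  by (cases g) auto

lemma pc_gjump: "pc (exec M R (gjump g l) p) = (if holds g (reg p) (rreg p) then l else pc p + 1)"
  by (cases g) (auto simp: val_opv)

lemma accesses_acc: "accesses ins p = acc ins (reg p)"
  by (cases ins) (auto simp: val_opv)

lemma simple_exec: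
  assumes "simple ins"
  shows "pc (exec M R ins p) = pc p + 1"
    and "reg (exec M R ins p) = lreg (act ins (reg p, rreg p, M, R))"
    and "rreg (exec M R ins p) = lrreg (act ins (reg p, rreg p, M, R))"
    and "lmem (act ins (reg p, rreg p, M, R)) = (\<lambda>x. case stores ins p x of None \<Rightarrow> M x | Some w \<Rightarrow> w)"
    and "lrmem (act ins (reg p, rreg p, M, R)) = (\<lambda>x. case rstores ins p x of None \<Rightarrow> R x | Some w \<Rightarrow> w)"
  using assms by (cases ins; auto simp: val_opv fun_eq_iff)+

lemma stores_acc:
  "Cell x \<notin> acc ins (reg p) \<Longrightarrow> stores ins p x = None"
  "RCell x \<notin> acc ins (reg p) \<Longrightarrow> rstores ins p x = None"
  by (cases ins; auto simp: val_opv)+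

lemma opnd_ok_le: "opnd_ok W x \<Longrightarrow> \<forall>k. r k \<le> W \<Longrightarrow> opv r x \<le> W"
  by (cases x) auto

text \<open>Truncated subtraction and division never exceed their first argument, which is why
  \<open>word_ok\<close> looks only at that argument in these cases.\<close>

lemma act_word:
  assumes "word_ok W ins r" "\<forall>k. r k \<le> W" "\<forall>x. M x \<le> W"
  shows "\<forall>k. lreg (act ins (r, q, M, X)) k \<le> W" and "\<forall>x. lmem (act ins (r, q, M, X)) x \<le> W"
proof -
  have "arith_val b (opv r x) (opv r y) \<le> W" if "ins = Arith b d x y" for b d x y
    using assms(1) opnd_ok_le[OF _ assms(2), of x] that
    by (cases b) (auto intro: order_trans[OF diff_le_self] order_trans[OF div_le_dividend])
  then show "\<forall>k. lreg (act ins (r, q, M, X)) k \<le> W"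
    using assms(2,3) by (cases ins) auto
  show "\<forall>x. lmem (act ins (r, q, M, X)) x \<le> W"
    using assms opnd_ok_le[OF _ assms(2)] by (cases ins) auto
qed

text \<open>Three machine steps: the guard jump, the instruction or an idle step, and the jump to
  the end. Only the middle one accesses memory; disjoint footprints make it exclusive and give every
  cell at most one writer. The effect on each footprint together with the frame conditions
  determines the whole memory.\<close>

lemma ginstr_step:
  fixes c :: machine
  assumes code: "code_at \<pi> l (gcode l (g, ins))" and simp: "simple ins"
    and pcs: "\<forall>i<N. pc (procs c i) = l" and fits: "fits_word W N c"
    and disj: "\<forall>i<N. \<forall>j<N. i \<noteq> j \<longrightarrow> lfoot (g, ins) (view c i) \<inter> lfoot (g, ins) (view c j) = {}"
    and ok: "\<forall>i<N. lsafe W (g, ins) (view c i)"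
  shows "\<exists>c'. reach \<pi> N W c 3 c' \<and>
    (\<forall>i<N. pc (procs c' i) = l + 5 \<and>
       reg (procs c' i) = lreg (lstep (g, ins) (view c i)) \<and>
       rreg (procs c' i) = lrreg (lstep (g, ins) (view c i)) \<and>
       agree (lfoot (g, ins) (view c i)) (lstep (g, ins) (view c i)) (mem c') (rmem c')) \<and>
    (\<forall>x. (\<forall>i<N. Cell x \<notin> lfoot (g, ins) (view c i)) \<longrightarrow> mem c' x = mem c x) \<and>
    (\<forall>x. (\<forall>i<N. RCell x \<notin> lfoot (g, ins) (view c i)) \<longrightarrow> rmem c' x = rmem c x)"
proof -
  let ?h = "\<lambda>i. holds g (reg (procs c i)) (rreg (procs c i))"
  let ?s = "step \<pi> N"
  define c1 where "c1 = ?s c"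
  define c2 where "c2 = ?s c1"
  define c3 where "c3 = ?s c2"
  have f0: "fetch \<pi> (procs c i) = gjump g (l + 3)" if "i < N" for i
    using code_at_fetch[OF code, of "procs c i" 0] pcs that by simp
  have j0: "\<forall>i<N. jumps (fetch \<pi> (procs c i))"
    by (simp add: f0 jumps_gjump)
  note s0 = jump_step[OF j0 fits, folded c1_def]
  have fits1: "fits_word W N c1"
    using s0(1) by (auto simp: reach_def c1_def)
  have pc1: "pc (procs c1 i) = (if ?h i then l + 3 else l + 1)" if "i < N" for i
    using s0(6) that pcs by (simp add: f0 pc_gjump)
  \<comment> \<open>Offset 3 is the guarded instruction; offset 1 is the idle jump, which compares 0
    with 0 and falls through.\<close>
  have f1: "fetch \<pi> (procs c1 i) = (if ?h i then ins else JumpLess (Imm 0) (Imm 0) 0)" if "i < N" for i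
    using code_at_fetch[OF code, of "procs c1 i" 3] code_at_fetch[OF code, of "procs c1 i" 1] pc1[OF that]
    by auto
  have st: "stores (fetch \<pi> (procs c1 i)) (procs c1 i) x = None"
    if "i < N" "Cell x \<notin> lfoot (g, ins) (view c i)" for i x
    using that s0(4) stores_acc(1)[of x ins "procs c1 i"] by (auto simp: f1 view_def split: if_splits)
  have rst: "rstores (fetch \<pi> (procs c1 i)) (procs c1 i) x = None"
    if "i < N" "RCell x \<notin> lfoot (g, ins) (view c i)" for i x
    using that s0(4) stores_acc(2)[of x ins "procs c1 i"] by (auto simp: f1 view_def split: if_splits)
  have act: "act ins (reg (procs c1 i), rreg (procs c1 i), mem c1, rmem c1) = act ins (view c i)"
    if "i < N" for i using that s0 by (simp add: view_def)
  have regs2: "reg (procs c2 i) = lreg (lstep (g, ins) (view c i))"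
    "rreg (procs c2 i) = lrreg (lstep (g, ins) (view c i))" if "i < N" for i
    using that act[OF that] simple_exec(2,3)[OF simp, of "mem c1" "rmem c1" "procs c1 i"] s0(4,5)
    by (auto simp: c2_def step_def f1 view_def)
  have pc2: "pc (procs c2 i) = (if ?h i then l + 4 else l + 2)" if "i < N" for i
    using that pc1[OF that] simple_exec(1)[OF simp, of "mem c1" "rmem c1" "procs c1 i"]
    by (auto simp: c2_def step_def f1)
  have other: "Cell x \<notin> lfoot (g, ins) (view c j)"
    if "i < N" "j < N" "j \<noteq> i" "Cell x \<in> lfoot (g, ins) (view c i)" for i j x
    using disj that by blast
  have rother: "RCell x \<notin> lfoot (g, ins) (view c j)"
    if "i < N" "j < N" "j \<noteq> i" "RCell x \<in> lfoot (g, ins) (view c i)" for i j x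
    using disj that by blast
  have mem2: "mem c2 x = lmem (lstep (g, ins) (view c i)) x"
    if i: "i < N" and x: "Cell x \<in> lfoot (g, ins) (view c i)" for i x
  proof -
    have h: "?h i" using x by (auto simp: view_def split: if_splits)
    have none: "\<forall>j<N. j \<noteq> i \<longrightarrow> stores (fetch \<pi> (procs c1 j)) (procs c1 j) x = None"
      using other[OF i _ _ x] st by blast
    have eq: "lmem (act ins (view c i)) x = (case stores ins (procs c1 i) x of None \<Rightarrow> mem c x | Some w \<Rightarrow> w)"
      using simple_exec(4)[OF simp, of "procs c1 i" "mem c1" "rmem c1"] act[OF i] s0(2) by (simp split: option.split)
    show ?thesis
    proof (cases "stores ins (procs c1 i) x")
      case None
      then have "\<forall>j<N. stores (fetch \<pi> (procs c1 j)) (procs c1 j) x = None"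
        using none f1[OF i] h by auto
      then show ?thesis using eq None h s0(2) by (simp add: c2_def step_def update_mem_none view_def)
    next
      case (Some w)
      then show ?thesis
        using eq h update_mem_writer[where st = "\<lambda>j. stores (fetch \<pi> (procs c1 j)) (procs c1 j)", OF i _ none, of w] f1[OF i] by (simp add: c2_def step_def view_def)
    qed
  qed
  have rmem2: "rmem c2 x = lrmem (lstep (g, ins) (view c i)) x"
    if i: "i < N" and x: "RCell x \<in> lfoot (g, ins) (view c i)" for i x
  proof -
    have h: "?h i" using x by (auto simp: view_def split: if_splits)
    have none: "\<forall>j<N. j \<noteq> i \<longrightarrow> rstores (fetch \<pi> (procs c1 j)) (procs c1 j) x = None"
      using rother[OF i _ _ x] rst by blast
    have eq: "lrmem (act ins (view c i)) x = (case rstores ins (procs c1 i) x of None \<Rightarrow> rmem c x | Some w \<Rightarrow> w)"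
      using simple_exec(5)[OF simp, of "procs c1 i" "mem c1" "rmem c1"] act[OF i] s0(3) by (simp split: option.split)
    show ?thesis
    proof (cases "rstores ins (procs c1 i) x")
      case None
      then have "\<forall>j<N. rstores (fetch \<pi> (procs c1 j)) (procs c1 j) x = None"
        using none f1[OF i] h by auto
      then show ?thesis using eq None h s0(3) by (simp add: c2_def step_def update_mem_none view_def)
    next
      case (Some w)
      then show ?thesis
        using eq h update_mem_writer[where st = "\<lambda>j. rstores (fetch \<pi> (procs c1 j)) (procs c1 j)", OF i _ none, of w] f1[OF i] by (simp add: c2_def step_def view_def)
    qed
  qed
  have mem2': "mem c2 x = mem c x" if "\<forall>i<N. Cell x \<notin> lfoot (g, ins) (view c i)" for x
    using that st s0(2) by (simp add: c2_def step_def update_mem_none)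
  have rmem2': "rmem c2 x = rmem c x" if "\<forall>i<N. RCell x \<notin> lfoot (g, ins) (view c i)" for x
    using that rst s0(3) by (simp add: c2_def step_def update_mem_none)
  have W: "(\<forall>k. lreg (lstep (g, ins) (view c i)) k \<le> W) \<and> (\<forall>x. lmem (lstep (g, ins) (view c i)) x \<le> W)"
    if "i < N" for i
    using that ok fits act_word[of W ins "reg (procs c i)" "mem c" "rreg (procs c i)" "rmem c"]
    by (auto simp: view_def fits_word_def)
  have "mem c2 x \<le> W" for x
    using mem2[of _ x] mem2'[of x] W fits unfolding fits_word_def by metis
  then have fits2: "fits_word W N c2"
    using W by (auto simp: fits_word_def regs2)
  have "accesses (fetch \<pi> (procs c1 i)) (procs c1 i) \<subseteq> lfoot (g, ins) (view c i)" if "i < N" for i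
    using that s0(4) by (auto simp: f1 accesses_acc view_def)
  then have "erew_step \<pi> N c1"
    using disj unfolding erew_step_def by blast
  then have r1: "reach \<pi> N W c1 1 c2"
    using reach_step fits1 fits2 by (simp add: c2_def)
  have f2: "fetch \<pi> (procs c2 i) = goto (l + 5)" if "i < N" for i
    using code_at_fetch[OF code, of "procs c2 i" 4] code_at_fetch[OF code, of "procs c2 i" 2] pc2[OF that]
    by (auto split: if_splits)
  have j2: "\<forall>i<N. jumps (fetch \<pi> (procs c2 i))"
    by (simp add: f2 goto_def)
  note s2 = jump_step[OF j2 fits2, folded c3_def]
  have "reach \<pi> N W c (1 + (1 + 1)) c3"
    using reach_trans[OF s0(1) reach_trans[OF r1 s2(1)]] .
  then have "reach \<pi> N W c 3 c3" by (simp add: numeral_3_eq_3)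
  moreover have "pc (procs c3 i) = l + 5" if "i < N" for i
    using s2(6) that by (simp add: f2 goto_def)
  ultimately show ?thesis
    using s2(2-5) regs2 mem2 rmem2 mem2' rmem2'
    by (intro exI[of _ c3]) (simp add: agree_def)
qed

text \<open>Allows the private copy of a processor to be exchanged for the true memory at a single
  instruction.\<close>

lemma lstep_local:
  assumes "lreg s' = lreg s" "lrreg s' = lrreg s" "agree (lfoot a s) s (lmem s') (lrmem s')"
  shows "lfoot a s' = lfoot a s" and "lreg (lstep a s') = lreg (lstep a s)"
    and "lrreg (lstep a s') = lrreg (lstep a s)" and "lsafe W a s' = lsafe W a s"
    and "agree (lfoot a s) (lstep a s) (lmem (lstep a s')) (lrmem (lstep a s'))"
proof -
  obtain g ins where a: "a = (g, ins)" by (cases a)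
  obtain r q M X where s: "s = (r, q, M, X)" by (cases s)
  obtain M' X' where s': "s' = (r, q, M', X')" using assms(1,2) s by (cases s') auto
  show "lfoot a s' = lfoot a s" "lsafe W a s' = lsafe W a s" by (simp_all add: a s s')
  show "lreg (lstep a s') = lreg (lstep a s)" "lrreg (lstep a s') = lrreg (lstep a s)"
    "agree (lfoot a s) (lstep a s) (lmem (lstep a s')) (lrmem (lstep a s'))"
    using assms(3) by (cases ins; auto simp: a s s' agree_def)+
qed

text \<open>The states \<open>s i\<close> are arbitrary rather than \<open>view c i\<close>: after
  one instruction the true memory contains writes of other processors that the private copy lacks.
  Since the footprints of whole blocks are disjoint, no processor reads such a cell. The same
  generality lets \<open>runs_Pass\<close> start its second half from an outdated copy.\<close>

lemma body_run:
  fixes c :: machine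
  assumes "code_at \<pi> l (bcode l b)" "\<forall>a\<in>set b. simple (snd a)"
    "\<forall>i<N. pc (procs c i) = l" "fits_word W N c"
    "\<forall>i<N. lreg (s i) = reg (procs c i) \<and> lrreg (s i) = rreg (procs c i) \<and>
       agree (foot b (s i)) (s i) (mem c) (rmem c) \<and> safe W b (s i)"
    "\<forall>i<N. \<forall>j<N. i \<noteq> j \<longrightarrow> foot b (s i) \<inter> foot b (s j) = {}"
  shows "\<exists>c'. reach \<pi> N W c (3 * length b) c' \<and>
    (\<forall>i<N. pc (procs c' i) = l + 5 * length b \<and>
       reg (procs c' i) = lreg (lrun b (s i)) \<and>
       rreg (procs c' i) = lrreg (lrun b (s i)) \<and>
       agree (foot b (s i)) (lrun b (s i)) (mem c') (rmem c')) \<and>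
    (\<forall>x. (\<forall>i<N. Cell x \<notin> foot b (s i)) \<longrightarrow> mem c' x = mem c x) \<and>
    (\<forall>x. (\<forall>i<N. RCell x \<notin> foot b (s i)) \<longrightarrow> rmem c' x = rmem c x)"
  using assms
proof (induction b arbitrary: l c s)
  case Nil
  then show ?case by (intro exI[of _ c]) (auto simp: reach_refl agree_def)
next
  case (Cons a b)
  obtain g ins where a: "a = (g, ins)" by (cases a)
  have code: "code_at \<pi> l (gcode l (g, ins))" "code_at \<pi> (l + 5) (bcode (l + 5) b)"
    using Cons.prems(1) length_gcode[of l a] by (auto simp: a code_at_append simp del: gcode.simps)
  have ag: "agree (lfoot a (s i)) (s i) (lmem (view c i)) (lrmem (view c i))"
    and rg: "lreg (view c i) = lreg (s i)" "lrreg (view c i) = lrreg (s i)" if "i < N" for i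
    using Cons.prems(5) that by (auto simp: agree_def view_def)
  have loc: "lfoot a (view c i) = lfoot a (s i)"
      "lreg (lstep a (view c i)) = lreg (lstep a (s i))"
      "lrreg (lstep a (view c i)) = lrreg (lstep a (s i))"
      "lsafe W a (view c i) = lsafe W a (s i)"
      "agree (lfoot a (s i)) (lstep a (s i)) (lmem (lstep a (view c i))) (lrmem (lstep a (view c i)))"
    if "i < N" for i
    using lstep_local[OF rg ag] that by auto
  have disj: "\<forall>i<N. \<forall>j<N. i \<noteq> j \<longrightarrow> lfoot (g, ins) (view c i) \<inter> lfoot (g, ins) (view c j) = {}"
    using Cons.prems(6) loc(1) by (fastforce simp: a)
  have ok: "\<forall>i<N. lsafe W (g, ins) (view c i)"
    using Cons.prems(5) loc(4) by (auto simp: a)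
  have "simple ins" using Cons.prems(2) a by auto
  from ginstr_step[OF code(1) this Cons.prems(3,4) disj ok] obtain c1 where
    r1: "reach \<pi> N W c 3 c1"
    and p1: "\<And>i. i < N \<Longrightarrow> pc (procs c1 i) = l + 5"
      "\<And>i. i < N \<Longrightarrow> reg (procs c1 i) = lreg (lstep a (view c i))"
      "\<And>i. i < N \<Longrightarrow> rreg (procs c1 i) = lrreg (lstep a (view c i))"
      "\<And>i. i < N \<Longrightarrow> agree (lfoot a (view c i)) (lstep a (view c i)) (mem c1) (rmem c1)"
    and m1: "\<And>x. (\<forall>i<N. Cell x \<notin> lfoot a (view c i)) \<Longrightarrow> mem c1 x = mem c x"
      "\<And>x. (\<forall>i<N. RCell x \<notin> lfoot a (view c i)) \<Longrightarrow> rmem c1 x = rmem c x"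
    unfolding a by blast
  have fits1: "fits_word W N c1" using r1 by (auto simp: reach_def)
  define s1 where "s1 i = lstep a (s i)" for i
  \<comment> \<open>The footprint of the whole block matters here: a cell that processor
    \<open>i\<close> uses only later must survive what the others do now.\<close>
  have cell1: "lmem (s1 i) x = mem c1 x" if i: "i < N" and x: "Cell x \<in> foot (a # b) (s i)" for i x
  proof (cases "Cell x \<in> lfoot a (s i)")
    case True
    then show ?thesis using p1(4)[OF i] loc(1,5)[OF i] by (auto simp: agree_def s1_def)
  next
    case False
    have "Cell x \<notin> lfoot a (view c j)" if j: "j < N" for j
    proof (cases "j = i")
      case True
      then show ?thesis using False loc(1)[OF i] True by simp
    next
      case ij: False
      have "foot (a # b) (s i) \<inter> foot (a # b) (s j) = {}" using Cons.prems(6) i j ij by blast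
      moreover have "lfoot a (s j) \<subseteq> foot (a # b) (s j)" by simp
      ultimately show ?thesis using x loc(1)[OF j] by blast
    qed
    then have "mem c1 x = mem c x" using m1(1) by blast
    then show ?thesis
      using x False Cons.prems(5) i by (auto simp: s1_def lstep_outside agree_def)
  qed
  have rcell1: "lrmem (s1 i) x = rmem c1 x" if i: "i < N" and x: "RCell x \<in> foot (a # b) (s i)" for i x
  proof (cases "RCell x \<in> lfoot a (s i)")
    case True
    then show ?thesis using p1(4)[OF i] loc(1,5)[OF i] by (auto simp: agree_def s1_def)
  next
    case False
    have "RCell x \<notin> lfoot a (view c j)" if j: "j < N" for j
    proof (cases "j = i")
      case True
      then show ?thesis using False loc(1)[OF i] True by simp
    next
      case ij: False
      have "foot (a # b) (s i) \<inter> foot (a # b) (s j) = {}" using Cons.prems(6) i j ij by blast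
      moreover have "lfoot a (s j) \<subseteq> foot (a # b) (s j)" by simp
      ultimately show ?thesis using x loc(1)[OF j] by blast
    qed
    then have "rmem c1 x = rmem c x" using m1(2) by blast
    then show ?thesis
      using x False Cons.prems(5) i by (auto simp: s1_def lstep_outside agree_def)
  qed
  have sub: "foot b (s1 i) \<subseteq> foot (a # b) (s i)" for i by (simp add: s1_def)
  have prems: "\<forall>i<N. lreg (s1 i) = reg (procs c1 i) \<and> lrreg (s1 i) = rreg (procs c1 i) \<and>
       agree (foot b (s1 i)) (s1 i) (mem c1) (rmem c1) \<and> safe W b (s1 i)"
    using Cons.prems(5) cell1 rcell1 sub p1(2,3) loc(2,3) by (auto simp: agree_def s1_def)
  have disj1: "\<forall>i<N. \<forall>j<N. i \<noteq> j \<longrightarrow> foot b (s1 i) \<inter> foot b (s1 j) = {}"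
    using Cons.prems(6) sub by blast
  have pc1: "\<forall>i<N. pc (procs c1 i) = l + 5" using p1(1) by simp
  have simp1: "\<forall>a\<in>set b. simple (snd a)" using Cons.prems(2) by simp
  from Cons.IH[OF code(2) simp1 pc1 fits1 prems disj1] obtain c2 where
    r2: "reach \<pi> N W c1 (3 * length b) c2"
    and p2: "\<And>i. i < N \<Longrightarrow> pc (procs c2 i) = l + 5 + 5 * length b"
      "\<And>i. i < N \<Longrightarrow> reg (procs c2 i) = lreg (lrun b (s1 i))"
      "\<And>i. i < N \<Longrightarrow> rreg (procs c2 i) = lrreg (lrun b (s1 i))"
      "\<And>i. i < N \<Longrightarrow> agree (foot b (s1 i)) (lrun b (s1 i)) (mem c2) (rmem c2)"
    and m2: "\<And>x. (\<forall>i<N. Cell x \<notin> foot b (s1 i)) \<Longrightarrow> mem c2 x = mem c1 x"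
      "\<And>x. (\<forall>i<N. RCell x \<notin> foot b (s1 i)) \<Longrightarrow> rmem c2 x = rmem c1 x"
    by blast
  have cell2: "lmem (lrun b (s1 i)) x = mem c2 x" if i: "i < N" and x: "Cell x \<in> foot (a # b) (s i)" for i x
  proof (cases "Cell x \<in> foot b (s1 i)")
    case True
    then show ?thesis using p2(4)[OF i] by (simp add: agree_def)
  next
    case False
    have "Cell x \<notin> foot b (s1 j)" if j: "j < N" for j
    proof (cases "j = i")
      case True
      then show ?thesis using False by simp
    next
      case ij: False
      have "foot (a # b) (s i) \<inter> foot (a # b) (s j) = {}" using Cons.prems(6) i j ij by blast
      then show ?thesis using x sub[of j] by blast
    qed
    then show ?thesis using m2(1) cell1[OF i x] False lrun_outside by auto
  qed
  have rcell2: "lrmem (lrun b (s1 i)) x = rmem c2 x" if i: "i < N" and x: "RCell x \<in> foot (a # b) (s i)" for i x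
  proof (cases "RCell x \<in> foot b (s1 i)")
    case True
    then show ?thesis using p2(4)[OF i] by (simp add: agree_def)
  next
    case False
    have "RCell x \<notin> foot b (s1 j)" if j: "j < N" for j
    proof (cases "j = i")
      case True
      then show ?thesis using False by simp
    next
      case ij: False
      have "foot (a # b) (s i) \<inter> foot (a # b) (s j) = {}" using Cons.prems(6) i j ij by blast
      then show ?thesis using x sub[of j] by blast
    qed
    then show ?thesis using m2(2) rcell1[OF i x] False lrun_outside by auto
  qed
  have "mem c2 x = mem c x" if "\<forall>i<N. Cell x \<notin> foot (a # b) (s i)" for x
    using that m1(1)[of x] m2(1)[of x] sub loc(1) by (auto simp: s1_def)
  moreover have "rmem c2 x = rmem c x" if "\<forall>i<N. RCell x \<notin> foot (a # b) (s i)" for x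
    using that m1(2)[of x] m2(2)[of x] sub loc(1) by (auto simp: s1_def)
  moreover have "reach \<pi> N W c (3 * length (a # b)) c2"
    using reach_trans[OF r1 r2] by (simp add: algebra_simps)
  ultimately show ?case
    using p2(1-3) cell2 rcell2 by (intro exI[of _ c2]) (auto simp: agree_def s1_def)
qed

lemma lstep_keeps:
  assumes "dest_ok (snd a)" "k \<le> 10"
  shows "lreg (lstep a s) k = lreg s k"
proof -
  obtain g ins r q M X where "a = (g, ins)" "s = (r, q, M, X)"
    by (cases a, cases s) auto
  then show ?thesis using assms by (cases ins) auto
qed

lemma lrun_keeps:
  "\<forall>a\<in>set b. dest_ok (snd a) \<Longrightarrow> k \<le> 10 \<Longrightarrow> lreg (lrun b s) k = lreg s k"
  by (induction b arbitrary: s) (auto simp: lstep_keeps)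

section \<open>Synchronous programs\<close>

text \<open>
  Registers 1 to 9 hold the same values on all processors. A pass runs straight-line code for the
  virtual processors \<open>0, \<dots>, 2 N - 1\<close>, two on each processor, where register 10 contains the number
  of the virtual processor. The footprints of distinct virtual processors must be disjoint, so the
  order in which they run is irrelevant and memory access is exclusive.
\<close>

datatype com =
    Pass "ginstr list"
  | Upd arith nat operand operand
  | Seq com com (infixr \<open>;;\<close> 60)
  | While operand operand com

text \<open>Writes the number of the virtual processor into register 10; the offset is 0 for the
  first half and register 2, which holds \<open>N\<close>, for the second.\<close>

definition lane :: "operand \<Rightarrow> ginstr" where
  "lane x = (GLess (Imm 0) (Imm 1), Arith Add 10 (Reg 0) x)"

fun csize :: "com \<Rightarrow> nat" where
  "csize (Pass b) = 10 * length b + 10"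
| "csize (Upd b d x y) = 1"
| "csize (Seq c c') = csize c + csize c'"
| "csize (While x y c) = csize c + 3"

fun compile :: "nat \<Rightarrow> com \<Rightarrow> instr list" where
  "compile l (Pass b) = bcode l (lane (Imm 0) # b) @ bcode (l + 5 * length b + 5) (lane (Reg 2) # b)"
| "compile l (Upd b d x y) = [Arith b d x y]"
| "compile l (Seq c c') = compile l c @ compile (l + csize c) c'"
| "compile l (While x y c) = [JumpLess x y (l + 2), goto (l + csize c + 3)] @ compile (l + 2) c @ [goto l]"

lemma length_compile: "length (compile l c) = csize c"
  by (induction c arbitrary: l) (auto simp: length_bcode simp del: bcode.simps)

type_synonym gstate = "(nat \<Rightarrow> nat) \<times> (nat \<times> nat \<Rightarrow> nat) \<times> (nat \<times> nat \<Rightarrow> real)"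

text \<open>Registers from 10 on and the real registers are unspecified: nothing is carried from one
  pass to the next except through memory.\<close>

fun rep :: "nat \<Rightarrow> nat \<Rightarrow> nat \<Rightarrow> gstate \<Rightarrow> machine \<Rightarrow> bool" where
  "rep N W l (u, M, X) c \<longleftrightarrow>
     (\<forall>i<N. pc (procs c i) = l \<and> reg (procs c i) 0 = i \<and> (\<forall>k\<in>{1..<10}. reg (procs c i) k = u k)) \<and>
     mem c = M \<and> rmem c = X \<and> fits_word W N c"

text \<open>A triple valid for every program that contains the code, at any position.
  \<open>t\<close> is only an upper bound, so rounds of different cost can share one bound.\<close>

definition runs :: "nat \<Rightarrow> nat \<Rightarrow> com \<Rightarrow> gstate \<Rightarrow> nat \<Rightarrow> gstate \<Rightarrow> bool" where
  "runs N W c g t g' \<longleftrightarrow>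
     (\<forall>\<pi> l k. code_at \<pi> l (compile l c) \<and> rep N W l g k \<longrightarrow>
       (\<exists>t'\<le>t. \<exists>k'. reach \<pi> N W k t' k' \<and> rep N W (l + csize c) g' k'))"

lemma runs_mono: "runs N W c g t g' \<Longrightarrow> t \<le> t' \<Longrightarrow> runs N W c g t' g'"
  unfolding runs_def by (meson order_trans)

lemma runs_Seq:
  assumes "runs N W c g t g'" "runs N W c' g' t' g''"
  shows "runs N W (c ;; c') g (t + t') g''"
  unfolding runs_def
proof (intro allI impI)
  fix \<pi> l k assume a: "code_at \<pi> l (compile l (c ;; c')) \<and> rep N W l g k"
  then have code: "code_at \<pi> l (compile l c)" "code_at \<pi> (l + csize c) (compile (l + csize c) c')"
    by (auto simp: code_at_append length_compile)
  from assms(1) code(1) a obtain t1 k1 where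
    1: "t1 \<le> t" "reach \<pi> N W k t1 k1" "rep N W (l + csize c) g' k1"
    unfolding runs_def by blast
  from assms(2) code(2) 1(3) obtain t2 k2 where
    2: "t2 \<le> t'" "reach \<pi> N W k1 t2 k2" "rep N W (l + csize c + csize c') g'' k2"
    unfolding runs_def by blast
  show "\<exists>t''\<le>t + t'. \<exists>k'. reach \<pi> N W k t'' k' \<and> rep N W (l + csize (c ;; c')) g'' k'"
    using reach_trans[OF 1(2) 2(2)] 1(1) 2(1,3)
    by (intro exI[of _ "t1 + t2"]) (auto simp: add.assoc)
qed

fun uniform :: "operand \<Rightarrow> bool" where
  "uniform (Reg k) = (k \<in> {1..<10})"
| "uniform (Imm k) = True"

lemma val_uniform:
  "rep N W l (u, M, X) c \<Longrightarrow> i < N \<Longrightarrow> uniform x \<Longrightarrow> val (procs c i) x = opv u x"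
  by (cases x) auto

lemma goto_run:
  assumes "\<forall>i<N. fetch \<pi> (procs c i) = goto l'" "rep N W l (u, M, X) c"
  shows "\<exists>c'. reach \<pi> N W c 1 c' \<and> rep N W l' (u, M, X) c'"
proof -
  have j: "\<forall>i<N. jumps (fetch \<pi> (procs c i))" using assms(1) by (simp add: goto_def)
  have f: "fits_word W N c" using assms(2) by simp
  note s = jump_step[OF j f]
  have "fits_word W N (step \<pi> N c)" using s(1) by (auto simp: reach_def)
  then have "rep N W l' (u, M, X) (step \<pi> N c)"
    using s(2-6) assms by (auto simp: goto_def)
  then show ?thesis using s(1) by blast
qed

lemma cond_run:
  assumes "\<forall>i<N. fetch \<pi> (procs c i) = JumpLess x y l'" "rep N W l (u, M, X) c" "uniform x" "uniform y"
  shows "\<exists>c'. reach \<pi> N W c 1 c' \<and> rep N W (if opv u x < opv u y then l' else l + 1) (u, M, X) c'"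
proof -
  have j: "\<forall>i<N. jumps (fetch \<pi> (procs c i))" using assms(1) by simp
  have f: "fits_word W N c" using assms(2) by simp
  note s = jump_step[OF j f]
  have "fits_word W N (step \<pi> N c)" using s(1) by (auto simp: reach_def)
  then have "rep N W (if opv u x < opv u y then l' else l + 1) (u, M, X) (step \<pi> N c)"
    using s(2-6) assms val_uniform[OF assms(2)] by auto
  then show ?thesis using s(1) by blast
qed

lemma rep_fetch:
  assumes "code_at \<pi> l is" "rep N W (l + k) (u, M, X) c" "k < length is"
  shows "\<forall>i<N. fetch \<pi> (procs c i) = is ! k"
  using assms code_at_fetch by auto

lemma runs_While_False:
  assumes "uniform x" "uniform y" "\<not> opv u x < opv u y"
  shows "runs N W (While x y c) (u, M, X) 2 (u, M, X)"
  unfolding runs_def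
proof (intro allI impI)
  fix \<pi> l k assume a: "code_at \<pi> l (compile l (While x y c)) \<and> rep N W l (u, M, X) k"
  then have code: "code_at \<pi> l (compile l (While x y c))" by blast
  have f: "\<forall>i<N. fetch \<pi> (procs k i) = JumpLess x y (l + 2)"
    using rep_fetch[OF code, where k = 0] a by auto
  from cond_run[OF f conjunct2[OF a] assms(1,2)] assms(3) obtain k1 where
    1: "reach \<pi> N W k 1 k1" "rep N W (l + 1) (u, M, X) k1" by auto
  have f1: "\<forall>i<N. fetch \<pi> (procs k1 i) = goto (l + csize c + 3)"
    using rep_fetch[OF code 1(2)] by auto
  from goto_run[OF f1 1(2)] obtain k2 where
    2: "reach \<pi> N W k1 1 k2" "rep N W (l + csize c + 3) (u, M, X) k2" by auto
  have "reach \<pi> N W k 2 k2" using reach_trans[OF 1(1) 2(1)] by (simp add: numeral_2_eq_2)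
  then show "\<exists>t'\<le>2. \<exists>k'. reach \<pi> N W k t' k' \<and> rep N W (l + csize (While x y c)) (u, M, X) k'"
    using 2(2) by (auto simp: add.assoc)
qed

lemma runs_While_True:
  assumes "uniform x" "uniform y" "opv u x < opv u y"
    and body: "runs N W c (u, M, X) t g" and rest: "runs N W (While x y c) g t' g'"
  shows "runs N W (While x y c) (u, M, X) (t + t' + 2) g'"
  unfolding runs_def
proof (intro allI impI)
  obtain u1 M1 X1 where g: "g = (u1, M1, X1)" by (cases g)
  fix \<pi> l k assume a: "code_at \<pi> l (compile l (While x y c)) \<and> rep N W l (u, M, X) k"
  then have code: "code_at \<pi> l (compile l (While x y c))" by blast
  then have code': "code_at \<pi> (l + 2) (compile (l + 2) c)"
    by (simp only: compile.simps code_at_append) simp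
  have f: "\<forall>i<N. fetch \<pi> (procs k i) = JumpLess x y (l + 2)"
    using rep_fetch[OF code, where k = 0] a by auto
  from cond_run[OF f conjunct2[OF a] assms(1,2)] assms(3) obtain k1 where
    1: "reach \<pi> N W k 1 k1" "rep N W (l + 2) (u, M, X) k1" by auto
  from body code' 1(2) obtain t2 k2 where
    2: "t2 \<le> t" "reach \<pi> N W k1 t2 k2" "rep N W (l + 2 + csize c) g k2"
    unfolding runs_def by blast
  have r2: "rep N W (l + (2 + csize c)) (u1, M1, X1) k2" using 2(3) g by (simp add: add.assoc)
  have f2: "\<forall>i<N. fetch \<pi> (procs k2 i) = goto l"
    using rep_fetch[OF code r2] by (auto simp: length_compile nth_append)
  from goto_run[OF f2 r2] obtain k3 where
    3: "reach \<pi> N W k2 1 k3" "rep N W l g k3" by (auto simp: g)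
  from rest code 3(2) obtain t4 k4 where
    4: "t4 \<le> t'" "reach \<pi> N W k3 t4 k4" "rep N W (l + csize (While x y c)) g' k4"
    unfolding runs_def by blast
  have "reach \<pi> N W k (1 + (t2 + (1 + t4))) k4"
    using reach_trans[OF 1(1) reach_trans[OF 2(2) reach_trans[OF 3(1) 4(2)]]] .
  then show "\<exists>t''\<le>t + t' + 2. \<exists>k'. reach \<pi> N W k t'' k' \<and> rep N W (l + csize (While x y c)) g' k'"
    using 2(1) 4(1,3) by (intro exI[of _ "1 + (t2 + (1 + t4))"]) auto
qed

fun ureg :: "gstate \<Rightarrow> nat \<Rightarrow> nat" where "ureg (u, M, X) = u"

text \<open>The invariant is indexed by the number of completed rounds. A round costs two additional
  steps, for the test and the jump back; leaving costs two, for the failed test and the exit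
  jump.\<close>

lemma runs_While:
  assumes "uniform x" "uniform y"
    and body: "\<And>k g. k < K \<Longrightarrow> I k g \<Longrightarrow>
      opv (ureg g) x < opv (ureg g) y \<and> (\<exists>g'. runs N W c g t g' \<and> I (Suc k) g')"
    and exit: "\<And>g. I K g \<Longrightarrow> \<not> opv (ureg g) x < opv (ureg g) y"
    and init: "I 0 g"
  shows "\<exists>g'. runs N W (While x y c) g (K * (t + 2) + 2) g' \<and> I K g'"
proof -
  have "k \<le> K \<Longrightarrow> I k g \<Longrightarrow> \<exists>g'. runs N W (While x y c) g ((K - k) * (t + 2) + 2) g' \<and> I K g'" for k g
  proof (induction "K - k" arbitrary: k g)
    case 0
    then have k: "k = K" by simp
    have "runs N W (While x y c) g 2 g"
      using 0 k exit[of g] runs_While_False[OF assms(1,2)] by (cases g) auto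
    moreover have "(K - k) * (t + 2) + 2 = 2" using k by simp
    ultimately show ?case using 0 k by metis
  next
    case (Suc d)
    then have k: "k < K" "d = K - Suc k" "Suc k \<le> K" by auto
    obtain g1 where 1: "opv (ureg g) x < opv (ureg g) y" "runs N W c g t g1" "I (Suc k) g1"
      using body[OF k(1) Suc.prems(2)] by blast
    obtain g' where 2: "runs N W (While x y c) g1 ((K - Suc k) * (t + 2) + 2) g'" "I K g'"
      using Suc.hyps(1)[OF k(2,3) 1(3)] by blast
    have "t + ((K - Suc k) * (t + 2) + 2) + 2 = (K - k) * (t + 2) + 2"
      using k(1) by (cases "K - k") (auto simp: algebra_simps Suc_diff_Suc[symmetric])
    then show ?case
      using runs_While_True[OF assms(1,2)] 1(1,2) 2 by (cases g) (metis ureg.simps)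
  qed
  from this[of 0 g] init show ?thesis by simp
qed

lemma runs_Upd:
  assumes "d \<in> {1..<10}" "uniform x" "uniform y" "arith_val b (opv u x) (opv u y) \<le> W"
  shows "runs N W (Upd b d x y) (u, M, X) 1 (u(d := arith_val b (opv u x) (opv u y)), M, X)"
  unfolding runs_def
proof (intro allI impI)
  fix \<pi> l k assume a: "code_at \<pi> l (compile l (Upd b d x y)) \<and> rep N W l (u, M, X) k"
  then have code: "code_at \<pi> l (compile l (Upd b d x y))" by blast
  have f: "\<forall>i<N. fetch \<pi> (procs k i) = Arith b d x y"
    using rep_fetch[OF code, where k = 0] a by auto
  have v: "val (procs k i) x = opv u x" "val (procs k i) y = opv u y" if "i < N" for i
    using val_uniform[OF conjunct2[OF a] that] assms by auto
  have fit: "fits_word W N k" using a by simp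
  have m: "mem (step \<pi> N k) = mem k" "rmem (step \<pi> N k) = rmem k"
    using f by (auto simp: step_def update_mem_none fun_eq_iff)
  have p: "procs (step \<pi> N k) i = (procs k i)\<lparr>pc := pc (procs k i) + 1,
      reg := (reg (procs k i))(d := arith_val b (opv u x) (opv u y))\<rparr>" if "i < N" for i
    using f v that by (simp add: step_def)
  have fit': "fits_word W N (step \<pi> N k)"
    using fit m p assms(4) by (auto simp: fits_word_def)
  have "reach \<pi> N W k 1 (step \<pi> N k)"
    using fit fit' f by (intro reach_step) (auto simp: erew_step_def)
  moreover have "rep N W (l + csize (Upd b d x y)) (u(d := arith_val b (opv u x) (opv u y)), M, X) (step \<pi> N k)"
    using a fit' m p assms(1) by auto
  ultimately show "\<exists>t'\<le>1. \<exists>k'. reach \<pi> N W k t' k' \<and>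
      rep N W (l + csize (Upd b d x y)) (u(d := arith_val b (opv u x) (opv u y)), M, X) k'"
    by blast
qed

lemma agreeD:
  "agree F s M X \<Longrightarrow> Cell x \<in> F \<Longrightarrow> lmem s x = M x"
  "agree F s M X \<Longrightarrow> RCell x \<in> F \<Longrightarrow> lrmem s x = X x"
  by (auto simp: agree_def)

text \<open>Both halves may be analysed on the memory before the pass, because the first half leaves
  the cells of the second alone. The hypothesis on a virtual processor allows arbitrary scratch
  registers, since the second half finds there what the first one left. The cost is three steps for
  each of twice \<open>length b + 1\<close> guarded instructions.\<close>

lemma runs_Pass:
  assumes N: "u 2 = N" "2 * N \<le> W"
    and code_ok: "\<forall>a\<in>set b. simple (snd a) \<and> dest_ok (snd a)"
    and disj: "\<And>v w. v < 2 * N \<Longrightarrow> w < 2 * N \<Longrightarrow> v \<noteq> w \<Longrightarrow> F v \<inter> F w = {}"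
    and loc: "\<And>v r q. v < 2 * N \<Longrightarrow> \<forall>k\<in>{1..<10}. r k = u k \<Longrightarrow> r 10 = v \<Longrightarrow>
      foot b (r, q, M, X) \<subseteq> F v \<and> safe W b (r, q, M, X) \<and> agree (F v) (lrun b (r, q, M, X)) M' X'"
    and out: "\<And>x. \<forall>v<2*N. Cell x \<notin> F v \<Longrightarrow> M' x = M x" "\<And>x. \<forall>v<2*N. RCell x \<notin> F v \<Longrightarrow> X' x = X x"
  shows "runs N W (Pass b) (u, M, X) (6 * length b + 6) (u, M', X')"
  unfolding runs_def
proof (intro allI impI)
  fix \<pi> l k assume a: "code_at \<pi> l (compile l (Pass b)) \<and> rep N W l (u, M, X) k"
  have code: "code_at \<pi> l (bcode l (lane (Imm 0) # b))"
    "code_at \<pi> (l + 5 * length b + 5) (bcode (l + 5 * length b + 5) (lane (Reg 2) # b))"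
    using a length_bcode[of l "lane (Imm 0) # b"]
    by (auto simp: code_at_append ac_simps simp del: bcode.simps)
  have simps: "\<forall>a\<in>set (lane x # b). simple (snd a)" for x using code_ok by (auto simp: lane_def)
  have M: "mem k = M" "rmem k = X" and fit: "fits_word W N k" and pck: "\<forall>i<N. pc (procs k i) = l"
    using a by auto
  define r1 where "r1 i = (reg (procs k i))(10 := i)" for i
  have st1: "lstep (lane (Imm 0)) (view k i) = (r1 i, rreg (procs k i), M, X)"
    "lfoot (lane (Imm 0)) (view k i) = {}" if "i < N" for i
    using a that by (auto simp: lane_def view_def r1_def M)
  have r1: "\<forall>j\<in>{1..<10}. r1 i j = u j" "r1 i 10 = i" "r1 i 0 = i" if "i < N" for i
    using a that by (auto simp: r1_def)
  have lt: "i < 2 * N" if "i < N" for i using that by simp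
  have loc1: "foot b (r1 i, rreg (procs k i), M, X) \<subseteq> F i"
      "safe W b (r1 i, rreg (procs k i), M, X)"
      "agree (F i) (lrun b (r1 i, rreg (procs k i), M, X)) M' X'"
    if "i < N" for i
    using loc[OF lt[OF that] r1(1)[OF that] r1(2)[OF that]] by auto
  have f1: "foot (lane (Imm 0) # b) (view k i) \<subseteq> F i" if "i < N" for i
    using loc1[OF that] st1[OF that] by simp
  have "\<exists>c'. reach \<pi> N W k (3 * length (lane (Imm 0) # b)) c' \<and>
    (\<forall>i<N. pc (procs c' i) = l + 5 * length (lane (Imm 0) # b) \<and>
       reg (procs c' i) = lreg (lrun (lane (Imm 0) # b) (view k i)) \<and>
       rreg (procs c' i) = lrreg (lrun (lane (Imm 0) # b) (view k i)) \<and>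
       agree (foot (lane (Imm 0) # b) (view k i)) (lrun (lane (Imm 0) # b) (view k i)) (mem c') (rmem c')) \<and>
    (\<forall>x. (\<forall>i<N. Cell x \<notin> foot (lane (Imm 0) # b) (view k i)) \<longrightarrow> mem c' x = mem k x) \<and>
    (\<forall>x. (\<forall>i<N. RCell x \<notin> foot (lane (Imm 0) # b) (view k i)) \<longrightarrow> rmem c' x = rmem k x)"
  proof (rule body_run[OF code(1) simps pck fit])
    have "safe W (lane (Imm 0) # b) (view k i)" if "i < N" for i
      using loc1[OF that] st1[OF that] that N a
      by (auto simp: lane_def view_def)
    then show "\<forall>i<N. lreg (view k i) = reg (procs k i) \<and> lrreg (view k i) = rreg (procs k i) \<and>
        agree (foot (lane (Imm 0) # b) (view k i)) (view k i) (mem k) (rmem k) \<and>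
        safe W (lane (Imm 0) # b) (view k i)"
      by (auto simp: view_def agree_def)
    show "\<forall>i<N. \<forall>j<N. i \<noteq> j \<longrightarrow>
        foot (lane (Imm 0) # b) (view k i) \<inter> foot (lane (Imm 0) # b) (view k j) = {}"
      using f1 disj lt by blast
  qed
  then obtain k1 where
    reach1: "reach \<pi> N W k (3 * length b + 3) k1"
    and pc1: "\<forall>i<N. pc (procs k1 i) = l + 5 * length b + 5"
    and reg1: "\<And>i. i < N \<Longrightarrow> reg (procs k1 i) = lreg (lrun b (r1 i, rreg (procs k i), M, X))"
    and ag1: "\<And>i. i < N \<Longrightarrow> agree (foot b (r1 i, rreg (procs k i), M, X))
        (lrun b (r1 i, rreg (procs k i), M, X)) (mem k1) (rmem k1)"
    and out1: "\<And>x. (\<forall>i<N. Cell x \<notin> foot b (r1 i, rreg (procs k i), M, X)) \<Longrightarrow> mem k1 x = M x"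
      "\<And>x. (\<forall>i<N. RCell x \<notin> foot b (r1 i, rreg (procs k i), M, X)) \<Longrightarrow> rmem k1 x = X x"
    using st1 M by (auto simp: algebra_simps)
  have fit1: "fits_word W N k1" using reach1 by (auto simp: reach_def)
  have keep1: "reg (procs k1 i) j = r1 i j" if "i < N" "j \<le> 10" for i j
    using reg1[OF that(1)] lrun_keeps[of b j] code_ok that by simp
  have mem1: "mem k1 x = M' x" if "i < N" "Cell x \<in> F i" for i x
  proof (cases "Cell x \<in> foot b (r1 i, rreg (procs k i), M, X)")
    case True
    show ?thesis using agreeD(1)[OF ag1[OF that(1)] True] agreeD(1)[OF loc1(3)[OF that(1)] that(2)] by simp
  next
    case False
    have "Cell x \<notin> foot b (r1 j, rreg (procs k j), M, X)" if "j < N" for j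
    proof (cases "j = i")
      case True
      then show ?thesis using False by simp
    next
      case ij: False
      have "F i \<inter> F j = {}" using disj[of i j] lt \<open>i < N\<close> that ij by simp
      then show ?thesis using loc1(1)[OF that] \<open>Cell x \<in> F i\<close> by blast
    qed
    then have "mem k1 x = M x" using out1 by blast
    also have "M x = M' x"
      using False agreeD(1)[OF loc1(3)[OF that(1)] that(2)] lrun_outside[of x b "(r1 i, rreg (procs k i), M, X)"]
      by simp
    finally show ?thesis .
  qed
  have rmem1: "rmem k1 x = X' x" if "i < N" "RCell x \<in> F i" for i x
  proof (cases "RCell x \<in> foot b (r1 i, rreg (procs k i), M, X)")
    case True
    show ?thesis using agreeD(2)[OF ag1[OF that(1)] True] agreeD(2)[OF loc1(3)[OF that(1)] that(2)] by simp
  next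
    case False
    have "RCell x \<notin> foot b (r1 j, rreg (procs k j), M, X)" if "j < N" for j
    proof (cases "j = i")
      case True
      then show ?thesis using False by simp
    next
      case ij: False
      have "F i \<inter> F j = {}" using disj[of i j] lt \<open>i < N\<close> that ij by simp
      then show ?thesis using loc1(1)[OF that] \<open>RCell x \<in> F i\<close> by blast
    qed
    then have "rmem k1 x = X x" using out1 by blast
    also have "X x = X' x"
      using False agreeD(2)[OF loc1(3)[OF that(1)] that(2)] lrun_outside[of x b "(r1 i, rreg (procs k i), M, X)"]
      by simp
    finally show ?thesis .
  qed
  have mem1': "mem k1 x = M x" if "\<forall>i<N. Cell x \<notin> F i" for x
    using that out1(1)[of x] loc1(1) by blast
  have rmem1': "rmem k1 x = X x" if "\<forall>i<N. RCell x \<notin> F i" for x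
    using that out1(2)[of x] loc1(1) by blast
  define r2 where "r2 i = (reg (procs k1 i))(10 := i + N)" for i
  \<comment> \<open>The private copy is the memory before the pass, although the machine has already
    executed the first half.\<close>
  define s2 where "s2 i = (reg (procs k1 i), rreg (procs k1 i), M, X)" for i
  have st2: "lstep (lane (Reg 2)) (s2 i) = (r2 i, rreg (procs k1 i), M, X)"
    "lfoot (lane (Reg 2)) (s2 i) = {}" if "i < N" for i
    using keep1[OF that] r1[OF that] N by (auto simp: lane_def s2_def r2_def)
  have r2: "\<forall>j\<in>{1..<10}. r2 i j = u j" "r2 i 10 = i + N" "r2 i 0 = i" if "i < N" for i
    using keep1[OF that] r1[OF that] by (auto simp: r2_def)
  have lt2: "i + N < 2 * N" if "i < N" for i using that by simp
  have loc2: "foot b (r2 i, rreg (procs k1 i), M, X) \<subseteq> F (i + N)"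
      "safe W b (r2 i, rreg (procs k1 i), M, X)"
      "agree (F (i + N)) (lrun b (r2 i, rreg (procs k1 i), M, X)) M' X'"
    if "i < N" for i
    using loc[OF lt2[OF that] r2(1)[OF that] r2(2)[OF that]] by auto
  have f2: "foot (lane (Reg 2) # b) (s2 i) \<subseteq> F (i + N)" if "i < N" for i
    using loc2[OF that] st2[OF that] by simp
  have sep: "F i \<inter> F (j + N) = {}" if "i < N" "j < N" for i j
    using disj[of i "j + N"] that by simp
  have "\<exists>c'. reach \<pi> N W k1 (3 * length (lane (Reg 2) # b)) c' \<and>
    (\<forall>i<N. pc (procs c' i) = l + 5 * length b + 5 + 5 * length (lane (Reg 2) # b) \<and>
       reg (procs c' i) = lreg (lrun (lane (Reg 2) # b) (s2 i)) \<and>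
       rreg (procs c' i) = lrreg (lrun (lane (Reg 2) # b) (s2 i)) \<and>
       agree (foot (lane (Reg 2) # b) (s2 i)) (lrun (lane (Reg 2) # b) (s2 i)) (mem c') (rmem c')) \<and>
    (\<forall>x. (\<forall>i<N. Cell x \<notin> foot (lane (Reg 2) # b) (s2 i)) \<longrightarrow> mem c' x = mem k1 x) \<and>
    (\<forall>x. (\<forall>i<N. RCell x \<notin> foot (lane (Reg 2) # b) (s2 i)) \<longrightarrow> rmem c' x = rmem k1 x)"
  proof (rule body_run[OF code(2) simps pc1 fit1])
    have "safe W (lane (Reg 2) # b) (s2 i)" if "i < N" for i
      using loc2[OF that] st2[OF that] that N keep1[OF that] r1[OF that]
      by (auto simp: lane_def s2_def)
    moreover have "agree (foot (lane (Reg 2) # b) (s2 i)) (s2 i) (mem k1) (rmem k1)" if "i < N" for i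
      using f2[OF that] mem1' rmem1' sep[OF _ that] by (fastforce simp: agree_def s2_def disjoint_iff)
    ultimately show "\<forall>i<N. lreg (s2 i) = reg (procs k1 i) \<and> lrreg (s2 i) = rreg (procs k1 i) \<and>
        agree (foot (lane (Reg 2) # b) (s2 i)) (s2 i) (mem k1) (rmem k1) \<and>
        safe W (lane (Reg 2) # b) (s2 i)"
      by (auto simp: s2_def)
    have "F (i + N) \<inter> F (j + N) = {}" if "i < N" "j < N" "i \<noteq> j" for i j
      using disj[of "i + N" "j + N"] that by simp
    then show "\<forall>i<N. \<forall>j<N. i \<noteq> j \<longrightarrow>
        foot (lane (Reg 2) # b) (s2 i) \<inter> foot (lane (Reg 2) # b) (s2 j) = {}"
      using f2 by blast
  qed
  then obtain k2 where
    reach2: "reach \<pi> N W k1 (3 * length b + 3) k2"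
    and pc2: "\<forall>i<N. pc (procs k2 i) = l + 10 * length b + 10"
    and reg2: "\<And>i. i < N \<Longrightarrow> reg (procs k2 i) = lreg (lrun b (r2 i, rreg (procs k1 i), M, X))"
    and ag2: "\<And>i. i < N \<Longrightarrow> agree (foot b (r2 i, rreg (procs k1 i), M, X))
        (lrun b (r2 i, rreg (procs k1 i), M, X)) (mem k2) (rmem k2)"
    and out2: "\<And>x. (\<forall>i<N. Cell x \<notin> foot b (r2 i, rreg (procs k1 i), M, X)) \<Longrightarrow> mem k2 x = mem k1 x"
      "\<And>x. (\<forall>i<N. RCell x \<notin> foot b (r2 i, rreg (procs k1 i), M, X)) \<Longrightarrow> rmem k2 x = rmem k1 x"
    using st2 by (auto simp: algebra_simps)
  have mem2: "mem k2 x = M' x" for x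
  proof (cases "\<exists>i<N. Cell x \<in> F (i + N)")
    case True
    then obtain i where i: "i < N" "Cell x \<in> F (i + N)" by blast
    show ?thesis
    proof (cases "Cell x \<in> foot b (r2 i, rreg (procs k1 i), M, X)")
      case True
      show ?thesis using agreeD(1)[OF ag2[OF i(1)] True] agreeD(1)[OF loc2(3)[OF i(1)] i(2)] by simp
    next
      case False
      have "Cell x \<notin> foot b (r2 j, rreg (procs k1 j), M, X)" if "j < N" for j
      proof (cases "j = i")
        case True
        then show ?thesis using False by simp
      next
        case ij: False
        have "F (i + N) \<inter> F (j + N) = {}" using disj[of "i + N" "j + N"] i that ij by simp
        then show ?thesis using loc2(1)[OF that] i(2) by blast
      qed
      then have "mem k2 x = mem k1 x" using out2 by blast
      also have "mem k1 x = M x" using mem1' sep i by blast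
      also have "M x = M' x"
        using False agreeD(1)[OF loc2(3)[OF i(1)] i(2)] lrun_outside[of x b "(r2 i, rreg (procs k1 i), M, X)"]
        by simp
      finally show ?thesis .
    qed
  next
    case False
    then have "mem k2 x = mem k1 x" using out2(1)[of x] loc2(1) by blast
    moreover have "mem k1 x = M' x"
    proof (cases "\<exists>i<N. Cell x \<in> F i")
      case True
      then show ?thesis using mem1 by blast
    next
      case nF: False
      have "Cell x \<notin> F v" if "v < 2 * N" for v
        using False nF that by (cases "v < N") (auto dest!: spec[of _ "v - N"])
      then show ?thesis using out(1) mem1' nF by simp
    qed
    ultimately show ?thesis by simp
  qed
  have rmem2: "rmem k2 x = X' x" for x
  proof (cases "\<exists>i<N. RCell x \<in> F (i + N)")
    case True
    then obtain i where i: "i < N" "RCell x \<in> F (i + N)" by blast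
    show ?thesis
    proof (cases "RCell x \<in> foot b (r2 i, rreg (procs k1 i), M, X)")
      case True
      show ?thesis using agreeD(2)[OF ag2[OF i(1)] True] agreeD(2)[OF loc2(3)[OF i(1)] i(2)] by simp
    next
      case False
      have "RCell x \<notin> foot b (r2 j, rreg (procs k1 j), M, X)" if "j < N" for j
      proof (cases "j = i")
        case True
        then show ?thesis using False by simp
      next
        case ij: False
        have "F (i + N) \<inter> F (j + N) = {}" using disj[of "i + N" "j + N"] i that ij by simp
        then show ?thesis using loc2(1)[OF that] i(2) by blast
      qed
      then have "rmem k2 x = rmem k1 x" using out2 by blast
      also have "rmem k1 x = X x" using rmem1' sep i by blast
      also have "X x = X' x"
        using False agreeD(2)[OF loc2(3)[OF i(1)] i(2)] lrun_outside[of x b "(r2 i, rreg (procs k1 i), M, X)"]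
        by simp
      finally show ?thesis .
    qed
  next
    case False
    then have "rmem k2 x = rmem k1 x" using out2(2)[of x] loc2(1) by blast
    moreover have "rmem k1 x = X' x"
    proof (cases "\<exists>i<N. RCell x \<in> F i")
      case True
      then show ?thesis using rmem1 by blast
    next
      case nF: False
      have "RCell x \<notin> F v" if "v < 2 * N" for v
        using False nF that by (cases "v < N") (auto dest!: spec[of _ "v - N"])
      then show ?thesis using out(2) rmem1' nF by simp
    qed
    ultimately show ?thesis by simp
  qed
  have keep2: "reg (procs k2 i) j = r2 i j" if "i < N" "j \<le> 10" for i j
    using reg2[OF that(1)] lrun_keeps[of b j] code_ok that by simp
  have "fits_word W N k2" using reach2 by (auto simp: reach_def)
  then have "rep N W (l + csize (Pass b)) (u, M', X') k2"
    using pc2 keep2 r2 mem2 rmem2 by (auto simp: fun_eq_iff)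
  moreover have "reach \<pi> N W k (6 * length b + 6) k2"
    using reach_trans[OF reach1 reach2] by (simp add: algebra_simps)
  ultimately show "\<exists>t'\<le>6 * length b + 6. \<exists>k'. reach \<pi> N W k t' k' \<and> rep N W (l + csize (Pass b)) (u, M', X') k'"
    by blast
qed

section \<open>Bitonic sorting\<close>

text \<open>All comparators point upwards. One whose partner lies outside the array is dropped; this
  is sound because the missing entry counts as infinite and would keep its place.\<close>

definition stage :: "nat \<Rightarrow> (nat \<Rightarrow> nat) \<Rightarrow> (nat \<Rightarrow> 'a::linorder) \<Rightarrow> nat \<Rightarrow> 'a" where
  "stage n f a i =
     (if f i < n then if i < f i then min (a i) (a (f i)) else max (a i) (a (f i)) else a i)"

text \<open>Reflection in blocks of length \<open>2 * k\<close>. Beginning a merge with a reflection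
  replaces the usual descending order of every second block, so that all comparators can point
  upwards, as the infinite padding requires.\<close>

definition flip :: "nat \<Rightarrow> nat \<Rightarrow> nat" where
  "flip k i = i div (2 * k) * (2 * k) + (2 * k - 1 - i mod (2 * k))"

definition half :: "nat \<Rightarrow> nat \<Rightarrow> nat" where
  "half j i = (if i mod (2 * j) < j then i + j else i - j)"

definition sorted_blocks :: "nat \<Rightarrow> nat \<Rightarrow> (nat \<Rightarrow> 'a::linorder) \<Rightarrow> bool" where
  "sorted_blocks n k a \<longleftrightarrow> (\<forall>i j. i < j \<and> j < n \<and> i div k = j div k \<longrightarrow> a i \<le> a j)"

text \<open>The 0-1 principle: comparators commute with thresholds. Positions from \<open>n\<close> on
  count as infinite, so that \<open>n\<close> need not be a power of two.\<close>

definition bstage :: "(nat \<Rightarrow> nat) \<Rightarrow> (nat \<Rightarrow> bool) \<Rightarrow> nat \<Rightarrow> bool" where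
  "bstage f b i = (if i < f i then b i \<and> b (f i) else b i \<or> b (f i))"

definition threshold :: "nat \<Rightarrow> 'a::linorder \<Rightarrow> (nat \<Rightarrow> 'a) \<Rightarrow> nat \<Rightarrow> bool" where
  "threshold n x a i = (i < n \<longrightarrow> x \<le> a i)"

definition bsorted :: "nat \<Rightarrow> (nat \<Rightarrow> bool) \<Rightarrow> bool" where
  "bsorted k b \<longleftrightarrow> (\<forall>i j. i < j \<and> i div k = j div k \<longrightarrow> b i \<longrightarrow> b j)"

text \<open>A partner outside the array has the larger index and the value True, so the conjunction
  with it changes nothing, in accordance with the dropped comparator.\<close>

lemma threshold_stage: "threshold n x (stage n f a) = bstage f (threshold n x a)"
  by (auto simp: fun_eq_iff threshold_def stage_def bstage_def min_le_iff_disj le_max_iff_disj)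

lemma sorted_blocks_threshold:
  "sorted_blocks n k a \<longleftrightarrow> (\<forall>x. bsorted k (threshold n x a))"
proof
  assume "sorted_blocks n k a"
  then show "\<forall>x. bsorted k (threshold n x a)"
    unfolding sorted_blocks_def bsorted_def threshold_def by (meson order_trans less_trans)
next
  assume a: "\<forall>x. bsorted k (threshold n x a)"
  \<comment> \<open>The threshold at \<open>a i\<close> itself would expose a smaller later
    entry.\<close>
  have "a i \<le> a j" if "i < j" "j < n" "i div k = j div k" for i j
    using a[rule_format, of "a i"] that unfolding bsorted_def threshold_def by auto
  then show "sorted_blocks n k a" by (auto simp: sorted_blocks_def)
qed

text \<open>The ones or the zeros form an interval; constant sequences are included through
  \<open>q \<le> p\<close>.\<close>

definition bitonic :: "nat \<Rightarrow> (nat \<Rightarrow> bool) \<Rightarrow> bool" where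
  "bitonic n b \<longleftrightarrow> (\<exists>p q. (\<forall>i<n. b i \<longleftrightarrow> p \<le> i \<and> i < q) \<or> (\<forall>i<n. b i \<longleftrightarrow> \<not> (p \<le> i \<and> i < q)))"

section \<open>Half-cleaners on bitonic 0-1 sequences\<close>

lemma bitonic_cong: "(\<And>i. i < n \<Longrightarrow> b i = b' i) \<Longrightarrow> bitonic n b = bitonic n b'"
  by (simp add: bitonic_def)

lemma bitonic_Not: "bitonic n (\<lambda>i. \<not> b i) = bitonic n b"
  unfolding bitonic_def by auto

lemma bitonic_interval: "(\<And>i. i < n \<Longrightarrow> b i \<longleftrightarrow> p \<le> i \<and> i < q) \<Longrightarrow> bitonic n b"
  by (auto simp: bitonic_def)

lemma bitonic_cointerval: "(\<And>i. i < n \<Longrightarrow> b i \<longleftrightarrow> \<not> (p \<le> i \<and> i < q)) \<Longrightarrow> bitonic n b"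
  unfolding bitonic_def by blast

text \<open>Lay the two halves over each other. If the interval is longer than \<open>c\<close>,
  every place is covered at least once, so the disjunction is constant; otherwise none is covered
  twice, and the conjunction is constant. The disjunction is the complement of an interval when a
  short interval crosses the middle.\<close>

lemma half_clean_interval:
  assumes b: "\<And>i. i < 2 * c \<Longrightarrow> b i \<longleftrightarrow> p \<le> i \<and> i < q"
  shows "bitonic c (\<lambda>i. b i \<and> b (i + c)) \<and> bitonic c (\<lambda>i. b i \<or> b (i + c)) \<and>
    ((\<forall>i<c. \<not> (b i \<and> b (i + c))) \<or> (\<forall>i<c. b i \<or> b (i + c)))"
proof -
  define q' where "q' = min q (2 * c)"
  have b': "b i \<longleftrightarrow> p \<le> i \<and> i < q'" if "i < 2 * c" for i
    using b that by (auto simp: q'_def)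
  have q': "q' \<le> 2 * c" by (simp add: q'_def)
  have L: "b i \<and> b (i + c) \<longleftrightarrow> p \<le> i \<and> i < q' - c" and U: "b i \<or> b (i + c) \<longleftrightarrow> (p \<le> i \<and> i < q') \<or> (p \<le> i + c \<and> i + c < q')"
    if "i < c" for i using b'[of i] b'[of "i + c"] that by auto
  have 1: "bitonic c (\<lambda>i. b i \<and> b (i + c))" using L by (rule bitonic_interval)
  show ?thesis
  proof (cases "p + c < q'")
    case True
    then have "b i \<or> b (i + c)" if "i < c" for i using U[OF that] that q' by auto
    then show ?thesis using 1 bitonic_interval[of c "\<lambda>i. b i \<or> b (i + c)" 0 c] by auto
  next
    case False
    then have 2: "\<forall>i<c. \<not> (b i \<and> b (i + c))" using L by auto
    have "bitonic c (\<lambda>i. b i \<or> b (i + c))"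
    proof (cases "q' \<le> c")
      case True
      then show ?thesis using U by (intro bitonic_interval[of _ _ p q']) auto
    next
      case q: False
      show ?thesis
      proof (cases "c \<le> p")
        case True
        then show ?thesis using U q by (intro bitonic_interval[of _ _ "p - c" "q' - c"]) auto
      next
        case False
        then show ?thesis using U q \<open>\<not> p + c < q'\<close>
          by (intro bitonic_cointerval[of _ _ "q' - c" p]) auto
      qed
    qed
    then show ?thesis using 1 2 by blast
  qed
qed

text \<open>Complementation exchanges conjunction and disjunction, which reduces the second form of
  \<open>bitonic\<close> to intervals. The third fact says that the two halves are now in
  order.\<close>

lemma half_clean:
  assumes "bitonic (2 * c) b"
  shows "bitonic c (\<lambda>i. b i \<and> b (i + c))" and "bitonic c (\<lambda>i. b i \<or> b (i + c))"
    and "(\<forall>i<c. \<not> (b i \<and> b (i + c))) \<or> (\<forall>i<c. b i \<or> b (i + c))"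
proof -
  have "bitonic c (\<lambda>i. b i \<and> b (i + c)) \<and> bitonic c (\<lambda>i. b i \<or> b (i + c)) \<and>
    ((\<forall>i<c. \<not> (b i \<and> b (i + c))) \<or> (\<forall>i<c. b i \<or> b (i + c)))"
    using assms unfolding bitonic_def[of "2 * c"]
  proof (elim exE disjE)
    fix p q assume "\<forall>i<2 * c. b i \<longleftrightarrow> p \<le> i \<and> i < q"
    then show ?thesis by (intro half_clean_interval) auto
  next
    fix p q assume "\<forall>i<2 * c. b i \<longleftrightarrow> \<not> (p \<le> i \<and> i < q)"
    then have "bitonic c (\<lambda>i. \<not> b i \<and> \<not> b (i + c)) \<and> bitonic c (\<lambda>i. \<not> b i \<or> \<not> b (i + c)) \<and>
      ((\<forall>i<c. \<not> (\<not> b i \<and> \<not> b (i + c))) \<or> (\<forall>i<c. \<not> b i \<or> \<not> b (i + c)))"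
      by (intro half_clean_interval) auto
    then show ?thesis
      using bitonic_Not[of c "\<lambda>i. b i \<and> b (i + c)"] bitonic_Not[of c "\<lambda>i. b i \<or> b (i + c)"]
      by auto
  qed
  then show "bitonic c (\<lambda>i. b i \<and> b (i + c))" and "bitonic c (\<lambda>i. b i \<or> b (i + c))"
    and "(\<forall>i<c. \<not> (b i \<and> b (i + c))) \<or> (\<forall>i<c. b i \<or> b (i + c))" by blast+
qed

text \<open>Interpolates between bitonic and sorted blocks: inside each block of length
  \<open>k\<close>, the subblocks of length \<open>j\<close> are bitonic and in order among
  themselves.\<close>

definition merging :: "nat \<Rightarrow> nat \<Rightarrow> (nat \<Rightarrow> bool) \<Rightarrow> bool" where
  "merging k j b \<longleftrightarrow> (\<forall>x. bitonic j (\<lambda>i. b (x * j + i))) \<and>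
     (\<forall>x y. x div k = y div k \<and> x div j < y div j \<longrightarrow> b x \<longrightarrow> b y)"

section \<open>One merge: a reflection followed by half-cleaners\<close>

lemma block_split:
  fixes x c :: nat assumes "0 < c"
  obtains y i where "i < c" "x = y * (2 * c) + i" | y i where "i < c" "x = y * (2 * c) + c + i"
proof (cases "x mod (2 * c) < c")
  case True
  then show ?thesis using that(1)[of "x mod (2 * c)" "x div (2 * c)"] by (simp add: div_mult_mod_eq)
next
  case False
  have "x mod (2 * c) - c < c" using assms mod_less_divisor[of "2 * c" x] by linarith
  moreover have "x = x div (2 * c) * (2 * c) + c + (x mod (2 * c) - c)"
    using False div_mult_mod_eq[of x "2 * c"] by linarith
  ultimately show ?thesis using that(2) by blast
qed

lemma block_div:
  fixes y c i :: nat assumes "i < c"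
  shows "(y * (2 * c) + i) div c = 2 * y" "(y * (2 * c) + c + i) div c = 2 * y + 1"
    "(y * (2 * c) + i) div (2 * c) = y" "(y * (2 * c) + c + i) div (2 * c) = y"
    "(y * (2 * c) + i) mod (2 * c) = i" "(y * (2 * c) + c + i) mod (2 * c) = c + i"
proof -
  have "y * (2 * c) + i = 2 * y * c + i" "y * (2 * c) + c + i = (2 * y + 1) * c + i" by simp_all
  then show "(y * (2 * c) + i) div c = 2 * y" "(y * (2 * c) + c + i) div c = 2 * y + 1"
    using assms by (simp_all only: div_mult_self3[OF gr_implies_not0[OF assms]] div_less add_0_right)
  have "c + i < 2 * c" "i < 2 * c" using assms by auto
  then show "(y * (2 * c) + i) div (2 * c) = y" "(y * (2 * c) + c + i) div (2 * c) = y"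
    "(y * (2 * c) + i) mod (2 * c) = i" "(y * (2 * c) + c + i) mod (2 * c) = c + i"
    using assms by (simp_all add: add.assoc)
qed

lemma half_block:
  assumes "i < c"
  shows "half c (y * (2 * c) + i) = y * (2 * c) + c + i" "half c (y * (2 * c) + c + i) = y * (2 * c) + i"
  using assms by (simp_all add: half_def block_div)

lemma bstage_half:
  assumes "i < c"
  shows "bstage (half c) b (y * (2 * c) + i) \<longleftrightarrow> b (y * (2 * c) + i) \<and> b (y * (2 * c) + i + c)"
    "bstage (half c) b (y * (2 * c) + c + i) \<longleftrightarrow> b (y * (2 * c) + i) \<or> b (y * (2 * c) + i + c)"
  unfolding bstage_def half_block[OF assms] using assms by (auto simp: ac_simps)

text \<open>Inside a block of length \<open>2 * c\<close> the order of the two halves comes from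
  \<open>half_clean\<close>. Between such blocks the old order survives, as no comparator leaves its
  block: a one after the stage stems from a one in the block, and a block of ones stays so.\<close>

lemma merging_half:
  assumes c: "0 < c" and dvd: "2 * c dvd k" and b: "merging k (2 * c) b"
  shows "merging k c (bstage (half c) b)"
proof -
  let ?b = "bstage (half c) b"
  note clean = half_clean[OF b[unfolded merging_def, THEN conjunct1, rule_format], simplified]
  have bit: "bitonic c (\<lambda>i. ?b (x * c + i))" for x
  proof (cases "even x")
    case True
    then obtain y where x: "x = 2 * y" by (elim evenE)
    have "?b (x * c + i) \<longleftrightarrow> b (y * (2 * c) + i) \<and> b (y * (2 * c) + (i + c))" if "i < c" for i
      using bstage_half(1)[OF that, of b y] by (simp add: x ac_simps)
    then show ?thesis using clean(1)[of y] by (subst bitonic_cong) (auto simp: ac_simps)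
  next
    case False
    then obtain y where x: "x = 2 * y + 1" by (elim oddE)
    have "?b (x * c + i) \<longleftrightarrow> b (y * (2 * c) + i) \<or> b (y * (2 * c) + (i + c))" if "i < c" for i
      using bstage_half(2)[OF that, of b y] by (simp add: x ac_simps)
    then show ?thesis using clean(2)[of y] by (subst bitonic_cong) (auto simp: ac_simps)
  qed
  have range: "(?b x \<longrightarrow> (\<exists>z. z div (2 * c) = x div (2 * c) \<and> b z)) \<and>
      ((\<forall>z. z div (2 * c) = x div (2 * c) \<longrightarrow> b z) \<longrightarrow> ?b x)" for x
    using c
  proof (rule block_split[of c x])
    fix y i assume "i < c" "x = y * (2 * c) + i"
    then show ?thesis using bstage_half(1)[of i c b y] block_div[of i c y]
      by (metis add.assoc add.commute)
  next
    fix y i assume "i < c" "x = y * (2 * c) + c + i"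
    then show ?thesis using bstage_half(2)[of i c b y] block_div[of i c y]
      by (metis add.assoc add.commute)
  qed
  have "?b y" if xy: "x div k = y div k" "x div c < y div c" and bx: "?b x" for x y
  proof (cases "x div (2 * c) = y div (2 * c)")
    case True
    obtain i j z where ij: "i < c" "j < c" "x = z * (2 * c) + i" "y = z * (2 * c) + c + j"
      using c
    proof (rule block_split[of c x])
      fix z i assume x: "i < c" "x = z * (2 * c) + i"
      show ?thesis using c
      proof (rule block_split[of c y])
        fix z' j assume "j < c" "y = z' * (2 * c) + j"
        then show ?thesis using x True xy(2) by (simp add: block_div)
      next
        fix z' j assume "j < c" "y = z' * (2 * c) + c + j"
        then show ?thesis using x True that by (simp add: block_div)
      qed
    next
      fix z i assume x: "i < c" "x = z * (2 * c) + c + i"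
      show ?thesis using c
      proof (rule block_split[of c y])
        fix z' j assume "j < c" "y = z' * (2 * c) + j"
        then show ?thesis using x True xy(2) by (simp add: block_div)
      next
        fix z' j assume "j < c" "y = z' * (2 * c) + c + j"
        then show ?thesis using x True xy(2) by (simp add: block_div)
      qed
    qed
    then show ?thesis
      using clean(3)[of z] bx bstage_half(1)[OF ij(1), of b z] bstage_half(2)[OF ij(2), of b z]
      by (auto simp: add.assoc)
  next
    case False
    have "x div c \<le> y div c" using xy by simp
    then have "x div c div 2 \<le> y div c div 2" by (rule div_le_mono)
    then have lt: "x div (2 * c) < y div (2 * c)"
      using False by (simp add: div_mult2_eq mult.commute[of 2])
    obtain z where z: "z div (2 * c) = x div (2 * c)" "b z" using range[of x] bx by blast
    have blk: "z div k = x div k" if "z div (2 * c) = x div (2 * c)" for z x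
      using that dvd by (metis div_mult2_eq dvdE)
    have "b w" if "w div (2 * c) = y div (2 * c)" for w
      using b[unfolded merging_def, THEN conjunct2, rule_format, of z w] z blk[OF z(1)] blk[OF that] xy(1) lt that
      by simp
    then show ?thesis using range[of y] by blast
  qed
  then show ?thesis using bit by (auto simp: merging_def)
qed

lemma merging_sorted: "merging k 1 b \<Longrightarrow> bsorted k b"
  by (auto simp: merging_def bsorted_def)

lemma flip_block:
  assumes "i < k"
  shows "flip k (y * (2 * k) + i) = y * (2 * k) + k + (k - 1 - i)"
    "flip k (y * (2 * k) + k + i) = y * (2 * k) + (k - 1 - i)"
  using assms by (auto simp: flip_def block_div)

lemma bsorted_split:
  fixes b :: "nat \<Rightarrow> bool"
  assumes "\<forall>i j. i < j \<and> j < k \<longrightarrow> b i \<longrightarrow> b j"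
  shows "\<exists>p\<le>k. \<forall>i<k. b i \<longleftrightarrow> p \<le> i"
proof (cases "\<exists>i<k. b i")
  case True
  define p where "p = (LEAST i. b i)"
  have "b p" using True LeastI_ex[of b] by (auto simp: p_def)
  moreover have "p \<le> i" if "b i" for i using that by (simp add: p_def Least_le)
  moreover have "p < k" using True calculation(2) by force
  ultimately show ?thesis using assms by (intro exI[of _ p]) (auto simp: le_less)
qed auto

text \<open>If the ones of two sorted halves begin at offsets \<open>p\<close> and \<open>q\<close>,
  the minima with the reflection are one exactly from \<open>p\<close> up to \<open>k - q\<close>,
  and the maxima are zero exactly from \<open>k - p\<close> up to \<open>q\<close>. A one among the
  minima means \<open>p + q < k\<close>, which leaves no zero among the maxima.\<close>

lemma merging_flip:
  assumes k: "0 < k" and b: "bsorted k b"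
  shows "merging (2 * k) k (bstage (flip k) b)"
proof -
  let ?b = "bstage (flip k) b"
  have core: "\<exists>p q. (\<forall>i<k. ?b (y * (2 * k) + i) \<longleftrightarrow> p \<le> i \<and> i < k - q) \<and>
      (\<forall>i<k. ?b (y * (2 * k) + k + i) \<longleftrightarrow> \<not> (k - p \<le> i \<and> i < q)) \<and> p \<le> k \<and> q \<le> k" for y
  proof -
    have "\<forall>i j. i < j \<and> j < k \<longrightarrow> b (y * (2 * k) + i) \<longrightarrow> b (y * (2 * k) + j)"
    proof (intro allI impI)
      fix i j assume ij: "i < j \<and> j < k" "b (y * (2 * k) + i)"
      then have "i < k" by simp
      then show "b (y * (2 * k) + j)"
        using b[unfolded bsorted_def, rule_format, of "y * (2 * k) + i" "y * (2 * k) + j"] ij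
          block_div(1,2)[of i k y] block_div(1,2)[of j k y] by simp
    qed
    from bsorted_split[OF this] obtain p where
      p: "p \<le> k" "\<And>i. i < k \<Longrightarrow> b (y * (2 * k) + i) \<longleftrightarrow> p \<le> i" by blast
    have "\<forall>i j. i < j \<and> j < k \<longrightarrow> b (y * (2 * k) + k + i) \<longrightarrow> b (y * (2 * k) + k + j)"
    proof (intro allI impI)
      fix i j assume ij: "i < j \<and> j < k" "b (y * (2 * k) + k + i)"
      then have "i < k" by simp
      then show "b (y * (2 * k) + k + j)"
        using b[unfolded bsorted_def, rule_format, of "y * (2 * k) + k + i" "y * (2 * k) + k + j"] ij
          block_div(1,2)[of i k y] block_div(1,2)[of j k y] by simp
    qed
    from bsorted_split[OF this] obtain q where
      q: "q \<le> k" "\<And>i. i < k \<Longrightarrow> b (y * (2 * k) + k + i) \<longleftrightarrow> q \<le> i" by blast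
    have "?b (y * (2 * k) + i) \<longleftrightarrow> p \<le> i \<and> i < k - q" if "i < k" for i
      using that p(2)[of i] q(2)[of "k - 1 - i"] unfolding bstage_def flip_block(1)[OF that] by auto
    moreover have "?b (y * (2 * k) + k + i) \<longleftrightarrow> \<not> (k - p \<le> i \<and> i < q)" if "i < k" for i
      using that q(2)[of i] p(2)[of "k - 1 - i"] unfolding bstage_def flip_block(2)[OF that] by auto
    ultimately show ?thesis using p(1) q(1) by blast
  qed
  have "bitonic k (\<lambda>i. ?b (x * k + i))" for x
  proof (cases "even x")
    case True
    then obtain y where x: "x = 2 * y" by (elim evenE)
    obtain p q where "\<forall>i<k. ?b (y * (2 * k) + i) \<longleftrightarrow> p \<le> i \<and> i < k - q" using core by blast
    then show ?thesis by (intro bitonic_interval[of _ _ p "k - q"]) (auto simp: x ac_simps)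
  next
    case False
    then obtain y where x: "x = 2 * y + 1" by (elim oddE)
    have eq: "x * k = y * (2 * k) + k" by (simp add: x)
    obtain p q where "\<forall>i<k. ?b (y * (2 * k) + k + i) \<longleftrightarrow> \<not> (k - p \<le> i \<and> i < q)" using core by blast
    then show ?thesis unfolding eq by (intro bitonic_cointerval[of _ _ "k - p" q]) auto
  qed
  moreover have "?b w" if xw: "x div (2 * k) = w div (2 * k)" "x div k < w div k" and bx: "?b x" for x w
    using k
  proof (rule block_split[of k x])
    fix y i assume x: "i < k" "x = y * (2 * k) + i"
    show ?thesis using k
    proof (rule block_split[of k w])
      fix z j assume "j < k" "w = z * (2 * k) + j"
      then show ?thesis using x xw by (simp add: block_div)
    next
      fix z j assume w: "j < k" "w = z * (2 * k) + k + j"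
      then have "z = y" using x xw by (simp add: block_div)
      obtain p q where "\<forall>i<k. ?b (y * (2 * k) + i) \<longleftrightarrow> p \<le> i \<and> i < k - q"
        "\<forall>i<k. ?b (y * (2 * k) + k + i) \<longleftrightarrow> \<not> (k - p \<le> i \<and> i < q)" using core by blast
      then show ?thesis using x w bx \<open>z = y\<close> by auto
    qed
  next
    fix y i assume x: "i < k" "x = y * (2 * k) + k + i"
    show ?thesis using k
    proof (rule block_split[of k w])
      fix z j assume "j < k" "w = z * (2 * k) + j"
      then show ?thesis using x xw by (simp add: block_div)
    next
      fix z j assume "j < k" "w = z * (2 * k) + k + j"
      then show ?thesis using x xw by (simp add: block_div)
    qed
  qed
  ultimately show ?thesis by (auto simp: merging_def)
qed

section \<open>Comparator stages permute the records\<close>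

lemma flip_self:
  assumes "0 < k" shows "flip k (flip k i) = i"
  using assms
proof (rule block_split[of k i])
  fix y j assume "j < k" "i = y * (2 * k) + j"
  then show ?thesis using flip_block(2)[of "k - 1 - j" k y] by (simp add: flip_block(1))
next
  fix y j assume "j < k" "i = y * (2 * k) + k + j"
  then show ?thesis using flip_block(1)[of "k - 1 - j" k y] by (simp add: flip_block(2))
qed

lemma half_self: "0 < c \<Longrightarrow> half c (half c i) = i"
  by (rule block_split[of c i]) (auto simp: half_block)

text \<open>A permutation of indices rather than equality of multisets, because the permutation
  itself is later read off the array of record numbers.\<close>

definition rearranged :: "nat \<Rightarrow> (nat \<Rightarrow> 'a) \<Rightarrow> (nat \<Rightarrow> 'a) \<Rightarrow> bool" where
  "rearranged n a b \<longleftrightarrow> (\<exists>p. bij_betw p {..<n} {..<n} \<and> (\<forall>i<n. b i = a (p i)))"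

lemma rearranged_refl: "rearranged n a a"
  unfolding rearranged_def by (intro exI[of _ id]) simp

lemma rearranged_trans:
  assumes "rearranged n a b" "rearranged n b c"
  shows "rearranged n a c"
proof -
  obtain p where p: "bij_betw p {..<n} {..<n}" "\<forall>i<n. b i = a (p i)"
    using assms(1) by (auto simp: rearranged_def)
  obtain q where q: "bij_betw q {..<n} {..<n}" "\<forall>i<n. c i = b (q i)"
    using assms(2) by (auto simp: rearranged_def)
  have "q i < n" if "i < n" for i using bij_betwE[OF q(1)] that by auto
  then show ?thesis unfolding rearranged_def
    using bij_betw_trans[OF q(1) p(1)] p q by (intro exI[of _ "p \<circ> q"]) auto
qed

text \<open>The permutation \<open>p\<close> swaps exactly the pairs that are out of order. It is
  its own inverse, because both partners evaluate the same condition.\<close>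

lemma rearranged_stage:
  assumes inv: "\<And>i. f (f i) = i"
  shows "rearranged n a (stage n f a)"
proof -
  define p where "p i = (if f i < n \<and> (if i < f i then a (f i) < a i else a i < a (f i)) then f i else i)" for i
  have eq: "stage n f a i = a (p i)" for i
    by (auto simp: stage_def p_def min_def max_def)
  have pp: "p (p i) = i" if "i < n" for i
    using that inv[of i] by (auto simp: p_def split: if_splits)
  have pn: "p i < n" if "i < n" for i using that by (auto simp: p_def)
  have "bij_betw p {..<n} {..<n}"
    by (rule bij_betwI[of _ _ _ p]) (auto simp: pp pn)
  then show ?thesis using eq by (auto simp: rearranged_def)
qed

section \<open>Tracing points of a flow\<close>

text \<open>Right end of the interval of \<open>a\<close> when arcs with the same key are stacked by
  number. Tails as keys give the place in the outflow, heads that in the inflow.\<close>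

definition ends :: "(nat \<Rightarrow> nat) \<Rightarrow> (nat \<Rightarrow> real) \<Rightarrow> nat \<Rightarrow> real" where
  "ends key fl a = (\<Sum>b | b \<le> a \<and> key b = key a. fl b)"

text \<open>Arc numbers are shifted by one; 0 means that there is no such arc.\<close>

definition nxt :: "nat \<Rightarrow> (nat \<Rightarrow> nat) \<Rightarrow> (nat \<Rightarrow> real) \<Rightarrow> nat \<times> real \<Rightarrow> nat" where
  "nxt m key e p =
     (if \<exists>a<m. key a = fst p \<and> snd p \<le> e a then Suc (LEAST a. a < m \<and> key a = fst p \<and> snd p \<le> e a) else 0)"

definition adv ::
  "nat \<Rightarrow> (nat \<Rightarrow> nat) \<Rightarrow> (nat \<Rightarrow> real) \<Rightarrow> (nat \<Rightarrow> nat) \<Rightarrow> (nat \<Rightarrow> real) \<Rightarrow> nat \<times> real \<Rightarrow> nat \<times> real" where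
  "adv m key e key' e' p =
     (case nxt m key e p of 0 \<Rightarrow> p | Suc a \<Rightarrow> (key' a, snd p + (e' a - e a)))"

section \<open>The intervals of the arcs at one vertex\<close>

lemma ends_less:
  assumes pos: "\<And>a. a < m \<Longrightarrow> 0 < fl a" and "b < a" "a < m" "key b = key a"
  shows "ends key fl b \<le> ends key fl a - fl a"
proof -
  have "ends key fl a = fl a + (\<Sum>c\<in>{c. c \<le> a \<and> key c = key a} - {a}. fl c)"
    unfolding ends_def by (subst sum.remove[of _ a]) auto
  moreover have "(\<Sum>c | c \<le> b \<and> key c = key b. fl c) \<le> (\<Sum>c\<in>{c. c \<le> a \<and> key c = key a} - {a}. fl c)"
    using assms by (intro sum_mono2) (auto intro!: less_imp_le[OF pos])
  ultimately show ?thesis by (simp add: ends_def)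
qed

lemma ends_start_sum: "ends key fl a - fl a = (\<Sum>c | c < a \<and> key c = key a. fl c)"
proof -
  have "ends key fl a = fl a + (\<Sum>c\<in>{c. c \<le> a \<and> key c = key a} - {a}. fl c)"
    unfolding ends_def by (subst sum.remove[of _ a]) auto
  moreover have "{c. c \<le> a \<and> key c = key a} - {a} = {c. c < a \<and> key c = key a}" by auto
  ultimately show ?thesis by simp
qed

text \<open>The reason why tracing right ends suffices: every left end other than 0 is the right end
  of the preceding arc with the same key.\<close>

lemma ends_start:
  shows "ends key fl a - fl a = 0 \<or> (\<exists>b<a. key b = key a \<and> ends key fl a - fl a = ends key fl b)"
proof (cases "{c. c < a \<and> key c = key a} = {}")
  case True
  show ?thesis unfolding ends_start_sum True by simp
next
  case False
  define b where "b = Max {c. c < a \<and> key c = key a}"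
  have b: "b < a" "key b = key a" using Max_in[OF _ False] by (auto simp: b_def)
  have "{c. c < a \<and> key c = key a} = {c. c \<le> b \<and> key c = key b}"
    using b Max_ge[of "{c. c < a \<and> key c = key a}"] by (auto simp: b_def[symmetric])
  then have "ends key fl a - fl a = ends key fl b"
    unfolding ends_start_sum by (simp add: ends_def)
  then show ?thesis using b by blast
qed

lemma ends_total:
  assumes pos: "\<And>a. a < m \<Longrightarrow> 0 < fl a" and "a < m"
  shows "ends key fl a \<le> (\<Sum>b | b < m \<and> key b = key a. fl b)"
  unfolding ends_def using assms by (intro sum_mono2) (auto intro!: less_imp_le[OF pos])

lemma ends_total_attained:
  assumes "a < m"
  shows "\<exists>b<m. key b = key a \<and> ends key fl b = (\<Sum>c | c < m \<and> key c = key a. fl c)"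
proof -
  define b where "b = Max {c. c < m \<and> key c = key a}"
  have "{c. c < m \<and> key c = key a} \<noteq> {}" using assms by blast
  then have b: "b < m" "key b = key a"
    using Max_in[of "{c. c < m \<and> key c = key a}"] by (auto simp: b_def)
  have "{c. c < m \<and> key c = key a} = {c. c \<le> b \<and> key c = key b}"
    using b Max_ge[of "{c. c < m \<and> key c = key a}"] by (auto simp: b_def[symmetric])
  then have "ends key fl b = (\<Sum>c | c < m \<and> key c = key a. fl c)" by (simp only: ends_def)
  then show ?thesis using b by blast
qed

lemma nxt_SucI:
  assumes pos: "\<And>a. a < m \<Longrightarrow> 0 < fl a" and "a < m" "key a = v"
    "ends key fl a - fl a < x" "x \<le> ends key fl a"
  shows "nxt m key (ends key fl) (v, x) = Suc a"
proof -
  have "(LEAST a. a < m \<and> key a = v \<and> x \<le> ends key fl a) = a"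
  proof (rule Least_equality)
    fix b assume b: "b < m \<and> key b = v \<and> x \<le> ends key fl b"
    show "a \<le> b"
    proof (rule ccontr)
      assume "\<not> a \<le> b"
      then show False using ends_less[OF pos, where a1 = "\<lambda>a. a" and a = a and b = b and key = key] b assms by force
    qed
  qed (use assms in auto)
  then show ?thesis using assms by (auto simp: nxt_def)
qed

text \<open>If the interval found began at or above \<open>x\<close>, its left end would be the
  right end of an earlier arc that also qualifies, against minimality. The condition
  \<open>0 < x\<close> settles the first interval, which begins at 0.\<close>

lemma nxt_SucD:
  assumes "nxt m key (ends key fl) (v, x) = Suc a" "0 < x"
  shows "a < m" "key a = v" "x \<le> ends key fl a" "ends key fl a - fl a < x"
proof -
  have ex: "\<exists>a<m. key a = v \<and> x \<le> ends key fl a"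
    and a: "a = (LEAST a. a < m \<and> key a = v \<and> x \<le> ends key fl a)"
    using assms by (auto simp: nxt_def split: if_splits)
  show am: "a < m" "key a = v" "x \<le> ends key fl a"
    using LeastI_ex[of "\<lambda>a. a < m \<and> key a = v \<and> x \<le> ends key fl a"] ex by (auto simp: a)
  show "ends key fl a - fl a < x"
  proof (rule ccontr)
    assume n: "\<not> ends key fl a - fl a < x"
    with \<open>0 < x\<close> have "ends key fl a - fl a \<noteq> 0" by simp
    then obtain b where b: "b < a" "key b = key a" "ends key fl a - fl a = ends key fl b"
      using ends_start[of key fl a] by auto
    have "a \<le> b" unfolding a by (rule Least_le) (use b am n in auto)
    then show False using b by simp
  qed
qed

text \<open>The last interval ends at the total, so a search within the total can fail only at a
  vertex without arcs of this kind.\<close>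

lemma nxt_0:
  assumes "nxt m key (ends key fl) (v, x) = 0" "x \<le> (\<Sum>c | c < m \<and> key c = v. fl c)" "a < m"
  shows "key a \<noteq> v"
  using assms ends_total_attained[OF assms(3), of key fl] by (auto simp: nxt_def split: if_splits)

text \<open>The last gap reaches from \<open>x\<close> down to its predecessor in \<open>X\<close>,
  or to 0; the rest is induction on the number of smaller elements.\<close>

lemma telescope:
  fixes X :: "real set"
  assumes "finite X" "\<And>y. y \<in> X \<Longrightarrow> 0 < y" "x \<in> X"
  shows "(\<Sum>y | y \<in> X \<and> y \<le> x. y - Max (insert 0 {z \<in> X. z < y})) = x"
  using assms(3)
proof (induction "card {z \<in> X. z < x}" arbitrary: x rule: less_induct)
  case less
  let ?g = "\<lambda>y. y - Max (insert 0 {z \<in> X. z < y})"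
  have split: "{y. y \<in> X \<and> y \<le> x} = insert x {y \<in> X. y < x}" using less.prems by auto
  have sum: "(\<Sum>y | y \<in> X \<and> y \<le> x. ?g y) = ?g x + (\<Sum>y\<in>{y \<in> X. y < x}. ?g y)"
    unfolding split using assms(1) by (subst sum.insert) auto
  show ?case
  proof (cases "{y \<in> X. y < x} = {}")
    case True
    show ?thesis unfolding sum True by simp
  next
    case False
    define p where "p = Max {z \<in> X. z < x}"
    have p: "p \<in> X" "p < x" using Max_in[OF _ False] assms(1) by (auto simp: p_def)
    have le: "z \<le> p" if "z \<in> X" "z < x" for z using that assms(1) by (auto simp: p_def)
    have "{z \<in> X. z < p} \<subset> {z \<in> X. z < x}" using p by auto
    then have "card {z \<in> X. z < p} < card {z \<in> X. z < x}" using assms(1) by (intro psubset_card_mono) auto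
    from less.hyps[OF this p(1)] have IH: "(\<Sum>y | y \<in> X \<and> y \<le> p. ?g y) = p" .
    have eq: "{y \<in> X. y < x} = {y. y \<in> X \<and> y \<le> p}" using le p by auto
    have "Max (insert 0 {z \<in> X. z < x}) = p"
      using assms(1,2) p le by (intro Max_eqI) (auto intro: less_imp_le)
    then show ?thesis unfolding sum using IH by (simp add: eq)
  qed
qed

text \<open>\<open>lay\<close> only witnesses that a layering exists. It occurs in no algorithmic
  definition, but bounds walks by \<open>h\<close> arcs and is the measure of inductions.
  Conservation is formulated through arcs that meet head to tail, which avoids naming sources and
  sinks.\<close>

locale layered_flow =
  fixes m h :: nat and tl hd :: "nat \<Rightarrow> nat" and fl :: "nat \<Rightarrow> real" and lay :: "nat \<Rightarrow> nat"
  assumes pos: "a < m \<Longrightarrow> 0 < fl a"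
    and lay: "a < m \<Longrightarrow> 1 \<le> lay (tl a)" "a < m \<Longrightarrow> lay (tl a) < lay (hd a)" "a < m \<Longrightarrow> lay (hd a) \<le> h + 1"
    and conservation: "a < m \<Longrightarrow> b < m \<Longrightarrow> hd a = tl b \<Longrightarrow>
      (\<Sum>c | c < m \<and> hd c = hd a. fl c) = (\<Sum>c | c < m \<and> tl c = hd a. fl c)"
begin

abbreviation "eo \<equiv> ends tl fl"
abbreviation "ei \<equiv> ends hd fl"
abbreviation "nx \<equiv> nxt m tl eo"
abbreviation "fw \<equiv> adv m tl eo hd ei"
abbreviation "bw \<equiv> adv m hd ei tl eo"
abbreviation "outflow v \<equiv> \<Sum>c | c < m \<and> tl c = v. fl c"
abbreviation "inflow v \<equiv> \<Sum>c | c < m \<and> hd c = v. fl c"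

text \<open>As this is a set, ends of arcs that are traced back to the same point count
  once.\<close>

definition points :: "(nat \<times> real) set" where
  "points = (\<lambda>a. (bw ^^ h) (tl a, eo a)) ` {..<m}"

definition amount :: "nat \<times> real \<Rightarrow> real" where
  "amount p = snd p - Max (insert 0 {y. (fst p, y) \<in> points \<and> y < snd p})"

definition plen :: "nat \<times> real \<Rightarrow> nat" where
  "plen p = (LEAST k. nx ((fw ^^ k) p) = 0)"

definition path :: "nat \<times> real \<Rightarrow> nat list" where
  "path p = map (\<lambda>k. nx ((fw ^^ k) p) - 1) [0..<plen p]"

definition on_out :: "nat \<times> real \<Rightarrow> bool" where
  "on_out p \<longleftrightarrow> (\<exists>a<m. tl a = fst p) \<and> 0 < snd p \<and> snd p \<le> outflow (fst p)"

section \<open>Tracing back to the sources\<close>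

lemma fl_nonneg: "a < m \<Longrightarrow> 0 \<le> fl a" using pos[of a] by simp

lemma eo_pos: "a < m \<Longrightarrow> 0 \<le> eo a - fl a" "a < m \<Longrightarrow> 0 \<le> ei a - fl a"
  unfolding ends_start_sum by (auto intro!: sum_nonneg fl_nonneg)

text \<open>On the interval of one arc, moving back and moving forward are inverse
  translations.\<close>

lemma bw_step:
  assumes p: "on_out p" and n: "nxt m hd ei p = Suc a"
  shows "a < m" "bw p = (tl a, snd p + (eo a - ei a))" "hd a = fst p" "on_out (bw p)" "fw (bw p) = p"
proof -
  obtain v x where vx: "p = (v, x)" by (cases p)
  have x0: "0 < x" using p by (simp add: on_out_def vx)
  note a = nxt_SucD[OF n[unfolded vx] x0]
  show "a < m" "hd a = fst p" using a by (auto simp: vx)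
  show bw: "bw p = (tl a, snd p + (eo a - ei a))" using n by (simp add: adv_def)
  show "on_out (bw p)"
    using a eo_pos[OF a(1)] ends_total[of m fl a tl, OF pos a(1)] pos[OF a(1)] unfolding bw on_out_def
    by (auto simp: vx)
  have "nx (tl a, x + (eo a - ei a)) = Suc a"
    by (rule nxt_SucI) (use a pos in auto)
  then show "fw (bw p) = p" unfolding bw using a by (simp add: adv_def vx)
qed

text \<open>At a vertex with an entering arc, conservation places the position within the inflow, so
  the backward search would have succeeded.\<close>

lemma bw_stop:
  assumes p: "on_out p" and n: "nxt m hd ei p = 0"
  shows "bw p = p" "a < m \<Longrightarrow> hd a \<noteq> fst p"
proof -
  show "bw p = p" using n by (simp add: adv_def)
  assume a: "a < m"
  show "hd a \<noteq> fst p"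
  proof
    assume ha: "hd a = fst p"
    obtain b where b: "b < m" "tl b = fst p" using p by (auto simp: on_out_def)
    have "inflow (fst p) = outflow (fst p)" using conservation[OF a b(1)] ha b(2) by simp
    then show False using nxt_0[of m hd fl "fst p" "snd p" a] n a ha p by (auto simp: on_out_def)
  qed
qed

text \<open>The third claim is the termination measure: every successful step lowers the layer by at
  least one. The second retraces the same arcs forward.\<close>

lemma bw_iter:
  assumes "on_out p"
  shows "on_out ((bw ^^ k) p)" "\<exists>j. (fw ^^ j) ((bw ^^ k) p) = p"
    "nxt m hd ei ((bw ^^ k) p) = 0 \<or> lay (fst ((bw ^^ k) p)) + k \<le> lay (fst p)"
proof (induction k)
  case 0
  {
    case 1
    then show ?case using assms by simp
  next
    case 2
    show ?case by (rule exI[of _ 0]) simp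
  next
    case 3
    then show ?case by simp
  }
next
  case (Suc k)
  let ?q = "(bw ^^ k) p"
  have "on_out (bw ?q) \<and> (\<exists>j. (fw ^^ j) (bw ?q) = p) \<and>
    (nxt m hd ei (bw ?q) = 0 \<or> lay (fst (bw ?q)) + Suc k \<le> lay (fst p))"
  proof (cases "nxt m hd ei ?q")
    case 0
    then show ?thesis using bw_stop(1)[OF Suc.IH(1) 0] Suc.IH by simp
  next
    case (Suc a)
    note s = bw_step[OF Suc.IH(1) Suc]
    obtain j where j: "(fw ^^ j) ?q = p" using Suc.IH(2) by blast
    have "(fw ^^ Suc j) (bw ?q) = p" unfolding funpow_Suc_right o_apply s(5) by (rule j)
    moreover have "lay (fst (bw ?q)) < lay (fst ?q)" using lay(2)[OF s(1)] s(2,3) by simp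
    moreover have "lay (fst ?q) + k \<le> lay (fst p)" using Suc.IH(3) Suc by simp
    ultimately have "(\<exists>j. (fw ^^ j) (bw ?q) = p)" "lay (fst (bw ?q)) + Suc k \<le> lay (fst p)" by (blast, linarith)
    then show ?thesis using s(4) by blast
  qed
  then show "on_out ((bw ^^ Suc k) p)" "\<exists>j. (fw ^^ j) ((bw ^^ Suc k) p) = p"
    "nxt m hd ei ((bw ^^ Suc k) p) = 0 \<or> lay (fst ((bw ^^ Suc k) p)) + Suc k \<le> lay (fst p)"
    by simp_all
qed

lemma on_out_end: "a < m \<Longrightarrow> on_out (tl a, eo a)"
  using ends_total[of m fl a tl, OF pos] eo_pos[of a] pos[of a] by (auto simp: on_out_def)

text \<open>Tails have layer at most \<open>h\<close> and layers are at least 1, so fewer than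
  \<open>h\<close> backward steps can succeed. Thus the iteration has come to rest, which happens
  only where no arc enters.\<close>

lemma points:
  assumes "p \<in> points"
  shows "on_out p" "a < m \<Longrightarrow> hd a \<noteq> fst p"
proof -
  obtain b where b: "b < m" "p = (bw ^^ h) (tl b, eo b)" using assms by (auto simp: points_def)
  note it = bw_iter[OF on_out_end[OF b(1)], of h, folded b(2)]
  show "on_out p" by (rule it(1))
  obtain c where "c < m" "tl c = fst p" using \<open>on_out p\<close> by (auto simp: on_out_def)
  then have "lay (fst p) \<ge> 1" using lay(1)[of c] by simp
  moreover have "lay (tl b) \<le> h" using lay(2,3)[OF b(1)] by simp
  ultimately have "nxt m hd ei p = 0" using it(3) by auto
  then show "a < m \<Longrightarrow> hd a \<noteq> fst p" by (rule bw_stop(2)[OF \<open>on_out p\<close>])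
qed

lemma finite_points: "finite points" and card_points: "card points \<le> m"
  unfolding points_def using card_image_le[of "{..<m}"] by auto

section \<open>The forward paths of the points\<close>

definition visits :: "nat \<times> real \<Rightarrow> nat \<times> real \<Rightarrow> bool" where
  "visits p q \<longleftrightarrow> (\<exists>k. (fw ^^ k) p = q)"

text \<open>Points that have left the sources need not lie on a vertex with outgoing arcs.\<close>

definition on_path :: "nat \<times> real \<Rightarrow> bool" where
  "on_path p \<longleftrightarrow> 0 < snd p \<and> ((\<exists>a<m. tl a = fst p) \<longrightarrow> snd p \<le> outflow (fst p))"

lemma fw_step:
  assumes p: "on_path p" and n: "nx p = Suc a"
  shows "a < m" "fw p = (hd a, snd p + (ei a - eo a))" "tl a = fst p"
    "eo a - fl a < snd p" "snd p \<le> eo a" "on_path (fw p)"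
proof -
  obtain v x where vx: "p = (v, x)" by (cases p)
  have x0: "0 < x" using p by (simp add: on_path_def vx)
  note a = nxt_SucD[OF n[unfolded vx] x0]
  show "a < m" "tl a = fst p" "eo a - fl a < snd p" "snd p \<le> eo a" using a by (auto simp: vx)
  show fw: "fw p = (hd a, snd p + (ei a - eo a))" using n by (simp add: adv_def)
  have "x + (ei a - eo a) \<le> outflow (hd a)" if "b < m" "tl b = hd a" for b
    using conservation[OF a(1) that(1)] that(2) ends_total[of m fl a hd, OF pos a(1)] a by simp
  then show "on_path (fw p)"
    using a eo_pos[OF a(1)] unfolding fw on_path_def by (auto simp: vx)
qed

lemma fw_stop:
  assumes p: "on_path p" and n: "nx p = 0"
  shows "(fw ^^ k) p = p" "a < m \<Longrightarrow> tl a \<noteq> fst p"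
proof -
  have "fw p = p" using n by (simp add: adv_def)
  then show "(fw ^^ k) p = p" by (induction k) simp_all
  show "a < m \<Longrightarrow> tl a \<noteq> fst p"
    using nxt_0[of m tl fl "fst p" "snd p" a] n p by (auto simp: on_path_def)
qed

lemma on_path_points: "p \<in> points \<Longrightarrow> on_path p"
  using points(1) by (auto simp: on_out_def on_path_def)

lemma on_path_iter: "on_path p \<Longrightarrow> on_path ((fw ^^ k) p)"
proof (induction k)
  case (Suc k)
  then show ?case using fw_step(6)[of "(fw ^^ k) p"] fw_stop(1)[of "(fw ^^ k) p" 1]
    by (cases "nx ((fw ^^ k) p)") auto
qed simp

lemma lay_iter:
  assumes "on_path p"
  shows "nx p \<noteq> 0 \<Longrightarrow> lay (fst p) < lay (fst ((fw ^^ Suc k) p))"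
    "nx ((fw ^^ k) p) = 0 \<or> lay (fst p) + k \<le> lay (fst ((fw ^^ k) p))"
proof -
  have one: "lay (fst q) < lay (fst (fw q))" if q: "on_path q" "nx q \<noteq> 0" for q
  proof -
    obtain a where a: "nx q = Suc a" using q(2) by (cases "nx q") auto
    show ?thesis using fw_step(1-3)[OF q(1) a] lay(2)[of a] by simp
  qed
  have one': "lay (fst q) \<le> lay (fst (fw q))" if "on_path q" for q
    using one[OF that] fw_stop(1)[OF that, of 1] by (cases "nx q = 0") auto
  show "lay (fst p) < lay (fst ((fw ^^ Suc k) p))" if "nx p \<noteq> 0"
  proof (induction k)
    case 0
    then show ?case using one[OF assms that] by simp
  next
    case (Suc k)
    then show ?case using one'[OF on_path_iter[OF assms, of "Suc k"]] by simp
  qed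
  show "nx ((fw ^^ k) p) = 0 \<or> lay (fst p) + k \<le> lay (fst ((fw ^^ k) p))"
  proof (induction k)
    case (Suc k)
    show ?case
    proof (cases "nx ((fw ^^ k) p) = 0")
      case True
      then show ?thesis using fw_stop(1)[OF on_path_iter[OF assms, of k] True, of 1] by simp
    next
      case False
      then show ?thesis using Suc one[OF on_path_iter[OF assms, of k] False] by simp
    qed
  qed simp
qed

text \<open>A start in layer at least 1 followed by \<open>h\<close> moves leads to layer at least
  \<open>h + 1\<close>, where no tail lies.\<close>

lemma fw_end:
  assumes "p \<in> points"
  shows "nx ((fw ^^ h) p) = 0"
proof (rule ccontr)
  assume n: "nx ((fw ^^ h) p) \<noteq> 0"
  have op: "on_path p" using on_path_points assms by simp
  obtain a where a: "nx ((fw ^^ h) p) = Suc a" using n by (cases "nx ((fw ^^ h) p)") auto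
  have "lay (fst p) + h \<le> lay (fst ((fw ^^ h) p))" using lay_iter(2)[OF op, of h] n by simp
  moreover obtain c where "c < m" "tl c = fst p" using points(1)[OF assms] by (auto simp: on_out_def)
  then have "1 \<le> lay (fst p)" using lay(1)[of c] by simp
  moreover have "lay (fst ((fw ^^ h) p)) < h + 1"
    using fw_step[OF on_path_iter[OF op, of h] a] lay(2,3)[of a] by auto
  ultimately show False by simp
qed

lemma plen:
  assumes "p \<in> points"
  shows "plen p \<le> h" "nx ((fw ^^ k) p) = 0 \<longleftrightarrow> plen p \<le> k" "0 < plen p"
proof -
  show "plen p \<le> h" unfolding plen_def by (rule Least_le) (rule fw_end[OF assms])
  have z: "nx ((fw ^^ plen p) p) = 0" unfolding plen_def by (rule LeastI) (rule fw_end[OF assms])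
  have op: "on_path ((fw ^^ plen p) p)" using on_path_iter on_path_points assms by blast
  show iff: "nx ((fw ^^ k) p) = 0 \<longleftrightarrow> plen p \<le> k" for k
  proof
    assume "plen p \<le> k"
    then have "(fw ^^ k) p = (fw ^^ (k - plen p)) ((fw ^^ plen p) p)"
      by (simp flip: funpow_add[THEN fun_cong, unfolded o_apply])
    then show "nx ((fw ^^ k) p) = 0" using z fw_stop(1)[OF op z] by simp
  qed (auto simp: plen_def intro: Least_le)
  obtain a where "a < m" "tl a = fst p" using points(1)[OF assms] by (auto simp: on_out_def)
  then have "nx p \<noteq> 0" using fw_stop(2)[OF on_path_points[OF assms]] by auto
  then show "0 < plen p" using iff[of 0] by (cases "plen p") auto
qed

lemma visits_on_path: "p \<in> points \<Longrightarrow> visits p q \<Longrightarrow> on_path q"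
  unfolding visits_def using on_path_iter[OF on_path_points] by blast

text \<open>Layers rise strictly as long as the point moves, so it cannot return to a vertex with
  another position.\<close>

lemma visits_unique:
  assumes p: "p \<in> points" and "visits p (u, x)" "visits p (u, y)"
  shows "x = y"
proof -
  have "x = y" if kl: "(fw ^^ k) p = (u, x)" "(fw ^^ l) p = (u, y)" "k \<le> l" for k l x y
  proof -
    have l: "(fw ^^ (l - k)) (u, x) = (u, y)"
      using that by (simp flip: kl(1) funpow_add[THEN fun_cong, unfolded o_apply])
    have op: "on_path (u, x)" using visits_on_path[OF p] kl(1) by (auto simp: visits_def)
    show ?thesis
    proof (cases "nx (u, x) = 0 \<or> k = l")
      case True
      then show ?thesis using l fw_stop(1)[OF op, of "l - k"] by auto
    next
      case False
      then have "lay u < lay (fst ((fw ^^ Suc (l - k - 1)) (u, x)))" using lay_iter(1)[OF op] by simp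
      then show ?thesis using False kl(3) l by (simp add: Suc_diff_Suc del: funpow.simps)
    qed
  qed
  then show ?thesis using assms(2,3) unfolding visits_def by (metis nat_le_linear)
qed

lemma visits_next:
  assumes "p \<in> points" "visits p q" "nx q = Suc a"
  shows "visits p (hd a, snd q + (ei a - eo a))"
proof -
  obtain k where k: "(fw ^^ k) p = q" using assms(2) by (auto simp: visits_def)
  then have "(fw ^^ Suc k) p = (hd a, snd q + (ei a - eo a))"
    using fw_step(2)[OF visits_on_path[OF assms(1,2)] assms(3)] by simp
  then show ?thesis unfolding visits_def by blast
qed

lemma visits_prev:
  assumes p: "p \<in> points" and v: "visits p (u, x)" and ne: "p \<noteq> (u, x)"
  obtains a y where "visits p (tl a, y)" "a < m" "hd a = u" "x = y + (ei a - eo a)"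
    "eo a - fl a < y" "y \<le> eo a"
proof -
  obtain k where "(fw ^^ k) p = (u, x)" using v by (auto simp: visits_def)
  then have "\<exists>a y. visits p (tl a, y) \<and> a < m \<and> hd a = u \<and> x = y + (ei a - eo a) \<and> eo a - fl a < y \<and> y \<le> eo a"
  proof (induction k)
    case 0
    then show ?case using ne by simp
  next
    case (Suc k)
    let ?q = "(fw ^^ k) p"
    have op: "on_path ?q" using on_path_iter on_path_points p by blast
    show ?case
    proof (cases "nx ?q")
      case 0
      then show ?thesis using fw_stop(1)[OF op 0, of 1] Suc by simp
    next
      case (Suc a)
      note s = fw_step[OF op Suc]
      have "visits p (tl a, snd ?q)" unfolding visits_def s(3) by auto
      then show ?thesis using s Suc.prems by (intro exI[of _ a] exI[of _ "snd ?q"]) auto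
    qed
  qed
  then show ?thesis using that by blast
qed

section \<open>The amounts add up to the flow of each arc\<close>

definition thru :: "nat \<Rightarrow> (nat \<times> real) set" where
  "thru a = {p \<in> points. \<exists>y. visits p (tl a, y) \<and> eo a - fl a < y \<and> y \<le> eo a}"

definition upto :: "nat \<Rightarrow> real \<Rightarrow> (nat \<times> real) set" where
  "upto u x = {p \<in> points. \<exists>y\<le>x. visits p (u, y)}"

text \<open>One of the points arose by tracing this very end back, and \<open>bw_iter\<close> leads
  forward again.\<close>

lemma end_visited:
  assumes "a < m" shows "\<exists>p\<in>points. visits p (tl a, eo a)"
  using bw_iter(2)[OF on_out_end[OF assms], of h] assms unfolding points_def visits_def by auto

lemma nx_thru: "a < m \<Longrightarrow> eo a - fl a < y \<Longrightarrow> y \<le> eo a \<Longrightarrow> nx (tl a, y) = Suc a"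
  by (rule nxt_SucI) (use pos in auto)

text \<open>Difference of two cumulative sums; \<open>visits_unique\<close> prevents a point from
  being counted on both sides of \<open>x\<close>.\<close>

lemma sum_between:
  assumes cum: "\<And>x. x = 0 \<or> (\<exists>p\<in>points. visits p (u, x)) \<Longrightarrow> sum amount (upto u x) = x"
    and x: "x = 0 \<or> (\<exists>p\<in>points. visits p (u, x))" and y: "\<exists>p\<in>points. visits p (u, y)" and "x \<le> y"
  shows "sum amount {p \<in> points. \<exists>z. visits p (u, z) \<and> x < z \<and> z \<le> y} = y - x"
proof -
  have "(\<exists>z\<le>y. visits p (u, z)) \<longleftrightarrow> (\<exists>z\<le>x. visits p (u, z)) \<or> (\<exists>z. visits p (u, z) \<and> x < z \<and> z \<le> y)" for p
    using \<open>x \<le> y\<close> by (meson not_le order_trans)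
  then have "upto u y = upto u x \<union> {p \<in> points. \<exists>z. visits p (u, z) \<and> x < z \<and> z \<le> y}"
    unfolding upto_def by blast
  moreover have "upto u x \<inter> {p \<in> points. \<exists>z. visits p (u, z) \<and> x < z \<and> z \<le> y} = {}"
    using visits_unique by (force simp: upto_def)
  ultimately have "sum amount (upto u y) = sum amount (upto u x) + sum amount {p \<in> points. \<exists>z. visits p (u, z) \<and> x < z \<and> z \<le> y}"
    using finite_points by (simp add: sum.union_disjoint upto_def)
  then show ?thesis using cum[of x] cum[of y] x y by simp
qed

lemma start_visited:
  assumes "a < m" shows "eo a - fl a = 0 \<or> (\<exists>p\<in>points. visits p (tl a, eo a - fl a))"
proof (cases "eo a - fl a = 0")
  case False
  then obtain b where b: "b < a" "tl b = tl a" "eo a - fl a = eo b" using ends_start[of tl fl a] by auto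
  then show ?thesis using end_visited[of b] assms by auto
qed simp

lemma sum_thru:
  assumes "a < m"
    and cum: "\<And>x. x = 0 \<or> (\<exists>p\<in>points. visits p (tl a, x)) \<Longrightarrow> sum amount (upto (tl a) x) = x"
  shows "sum amount (thru a) = fl a"
  using sum_between[OF cum start_visited[OF assms(1)] end_visited[OF assms(1)]] pos[OF assms(1)]
  unfolding thru_def by simp

text \<open>Weights assigned at the sources measure positions at every vertex. Induction on the
  layer: where no arc enters, the weights telescope. Elsewhere let the visit at \<open>x\<close>
  come through arc \<open>a0\<close>; the visits up to \<open>x\<close> are those through earlier
  arcs, which contribute their full flow by the hypothesis at their tails, and those through
  \<open>a0\<close> up to the matching position. The position \<open>x\<close> has to be 0 or
  visited, because each weight is counted as a whole.\<close>

lemma cumulative: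
  "x = 0 \<or> (\<exists>p\<in>points. visits p (u, x)) \<Longrightarrow> sum amount (upto u x) = x"
proof (induction "lay u" arbitrary: u x rule: less_induct)
  case less
  show ?case
  proof (cases "x = 0")
    case True
    have "upto u 0 = {}" using visits_on_path by (force simp: upto_def on_path_def)
    then show ?thesis using True by simp
  next
    case x0: False
    then obtain p0 where p0: "p0 \<in> points" "visits p0 (u, x)" using less.prems by blast
    show ?thesis
    proof (cases "\<exists>a<m. hd a = u")
      case False
      have start: "p = (u, y)" if "p \<in> points" "visits p (u, y)" for p y
        by (rule ccontr) (use visits_prev[OF that] False in metis)
      have refl: "visits p p" for p unfolding visits_def by (rule exI[of _ 0]) simp
      let ?X = "{y. (u, y) \<in> points}"
      have fin: "finite ?X"
        by (rule finite_subset[OF _ finite_imageI[OF finite_points, of snd]]) force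
      have "upto u x = (\<lambda>y. (u, y)) ` {y. y \<in> ?X \<and> y \<le> x}"
        using start refl by (force simp: upto_def)
      then have "sum amount (upto u x) = (\<Sum>y | y \<in> ?X \<and> y \<le> x. amount (u, y))"
        by (simp add: sum.reindex inj_on_def)
      also have "\<dots> = (\<Sum>y | y \<in> ?X \<and> y \<le> x. y - Max (insert 0 {z \<in> ?X. z < y}))"
        by (simp add: amount_def)
      also have "\<dots> = x"
        using telescope[OF fin, of x] points(1) start[OF p0] p0(1) by (force simp: on_out_def)
      finally show ?thesis .
    next
      case True
      then have "p0 \<noteq> (u, x)" using points(2)[OF p0(1)] by (metis fst_conv)
      from visits_prev[OF p0 this] obtain a0 y0 where a0: "visits p0 (tl a0, y0)" "a0 < m" "hd a0 = u"
        "x = y0 + (ei a0 - eo a0)" "eo a0 - fl a0 < y0" "y0 \<le> eo a0"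
        by blast
      have cum: "sum amount (upto (tl b) z) = z"
        if "b < m" "hd b = u" "z = 0 \<or> (\<exists>p\<in>points. visits p (tl b, z))" for b z
        using less.hyps[of "tl b" z] lay(2)[of b] that by auto
      \<comment> \<open>\<open>B\<close> consists of the arcs whose intervals lie entirely below
        that of \<open>a0\<close>, and \<open>R\<close> of the points that use \<open>a0\<close> up
        to \<open>x\<close>, measured as \<open>y0\<close> at its tail.\<close>
      define B where "B = {b. b < a0 \<and> hd b = u}"
      define R where "R = {p \<in> points. \<exists>z. visits p (tl a0, z) \<and> eo a0 - fl a0 < z \<and> z \<le> y0}"
      have Bm: "b < m" "hd b = u" "b < a0" if "b \<in> B" for b using that a0 by (auto simp: B_def)
      have arrive: "visits p (u, z + (ei b - eo b))"
        if "p \<in> points" "visits p (tl b, z)" "b < m" "hd b = u" "eo b - fl b < z" "z \<le> eo b" for p b z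
        using visits_next[OF that(1,2) nx_thru[OF that(3,5,6)]] that(4) by simp
      have ei_less: "ei b \<le> ei a - fl a" if "b < a" "a < m" "hd b = u" "hd a = u" for a b
        using ends_less[of m fl b a hd, OF pos] that by simp
      have "upto u x \<subseteq> (\<Union>b\<in>B. thru b) \<union> R"
      proof
        fix p assume "p \<in> upto u x"
        then obtain y where y: "p \<in> points" "y \<le> x" "visits p (u, y)" by (auto simp: upto_def)
        then have "p \<noteq> (u, y)" using points(2)[OF y(1)] True by (metis fst_conv)
        from visits_prev[OF y(1,3) this] obtain b z where b: "visits p (tl b, z)" "b < m" "hd b = u"
          "y = z + (ei b - eo b)" "eo b - fl b < z" "z \<le> eo b"
          by blast
        have "\<not> a0 < b"
        proof
          assume "a0 < b"
          then have "ei a0 \<le> ei b - fl b" using ei_less b a0 by blast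
          then show False using b a0 y(2) by simp
        qed
        then consider "b < a0" | "b = a0" by linarith
        then show "p \<in> (\<Union>b\<in>B. thru b) \<union> R"
        proof cases
          case 1
          then show ?thesis using b y(1) by (auto simp: B_def thru_def)
        next
          case 2
          then show ?thesis using b y(1,2) a0(4) by (auto simp: R_def)
        qed
      qed
      moreover have "thru b \<subseteq> upto u x" if b: "b \<in> B" for b
      proof
        fix p assume "p \<in> thru b"
        then obtain z where z: "p \<in> points" "visits p (tl b, z)" "eo b - fl b < z" "z \<le> eo b"
          by (auto simp: thru_def)
        have "z + (ei b - eo b) \<le> x" using ei_less[of b a0] Bm[OF b] a0 z by simp
        then show "p \<in> upto u x" using arrive[OF z(1,2) Bm(1,2)[OF b] z(3,4)] z(1) by (auto simp: upto_def)
      qed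
      moreover have "R \<subseteq> upto u x"
      proof
        fix p assume "p \<in> R"
        then obtain z where z: "p \<in> points" "visits p (tl a0, z)" "eo a0 - fl a0 < z" "z \<le> y0"
          by (auto simp: R_def)
        have "z + (ei a0 - eo a0) \<le> x" using a0 z by simp
        then show "p \<in> upto u x" using arrive[OF z(1,2) a0(2,3) z(3)] z(1,4) a0(6) by (auto simp: upto_def)
      qed
      ultimately have eq: "upto u x = (\<Union>b\<in>B. thru b) \<union> R" by blast
      have sep: "b = c" if bc: "b < m" "hd b = u" "c < m" "hd c = u" "p \<in> thru b" "p \<in> thru c" for b c p
      proof -
        obtain y z where yz: "p \<in> points" "visits p (tl b, y)" "eo b - fl b < y" "y \<le> eo b"
          "visits p (tl c, z)" "eo c - fl c < z" "z \<le> eo c" using bc by (auto simp: thru_def)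
        have eq: "y + (ei b - eo b) = z + (ei c - eo c)"
          using visits_unique[OF yz(1) arrive[OF yz(1,2) bc(1,2) yz(3,4)] arrive[OF yz(1,5) bc(3,4) yz(6,7)]] .
        show ?thesis
          by (rule ccontr) (use ei_less[of b c] ei_less[of c b] bc eq yz in linarith)
      qed
      have Rsub: "R \<subseteq> thru a0" using a0(6) by (auto simp: R_def thru_def)
      have fin: "finite (thru b)" "finite R" for b using finite_points by (auto simp: thru_def R_def)
      have finB: "finite B" by (simp add: B_def)
      have "sum amount (upto u x) = sum amount (\<Union>b\<in>B. thru b) + sum amount R"
        unfolding eq using fin finB sep Rsub Bm a0 by (intro sum.union_disjoint) (auto, fastforce)
      also have "sum amount (\<Union>b\<in>B. thru b) = (\<Sum>b\<in>B. sum amount (thru b))"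
        using fin finB sep Bm by (intro sum.UNION_disjoint) (auto simp: disjoint_iff)
      also have "\<dots> = (\<Sum>b\<in>B. fl b)"
        using sum_thru cum Bm by (intro sum.cong) auto
      also have "\<dots> = ei a0 - fl a0" unfolding ends_start_sum B_def using a0(3) by simp
      also have "sum amount R = y0 - (eo a0 - fl a0)"
        unfolding R_def using cum[OF a0(2,3)] start_visited[OF a0(2)] p0 a0 by (intro sum_between) auto
      finally show ?thesis using a0(4) by simp
    qed
  qed
qed

lemma in_path_iff:
  assumes "p \<in> points" "a < m"
  shows "a \<in> set (path p) \<longleftrightarrow> p \<in> thru a"
proof
  assume "a \<in> set (path p)"
  then obtain k where k: "k < plen p" "a = nx ((fw ^^ k) p) - 1" by (auto simp: path_def)
  then have s: "nx ((fw ^^ k) p) = Suc a" using plen(2)[OF assms(1), of k] by simp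
  have op: "on_path ((fw ^^ k) p)" using on_path_iter on_path_points assms by blast
  have "visits p (tl a, snd ((fw ^^ k) p))" unfolding visits_def fw_step(3)[OF op s] by auto
  then show "p \<in> thru a" using fw_step(4,5)[OF op s] assms by (auto simp: thru_def)
next
  assume "p \<in> thru a"
  then obtain y where y: "visits p (tl a, y)" "eo a - fl a < y" "y \<le> eo a" by (auto simp: thru_def)
  then obtain k where k: "(fw ^^ k) p = (tl a, y)" by (auto simp: visits_def)
  have s: "nx ((fw ^^ k) p) = Suc a" using nx_thru[OF assms(2) y(2,3)] k by simp
  then have "k < plen p" using plen(2)[OF assms(1), of k] by simp
  then show "a \<in> set (path p)" using s by (force simp: path_def image_iff)
qed

theorem path_sum:
  assumes "a < m"
  shows "(\<Sum>p | p \<in> points \<and> a \<in> set (path p). amount p) = fl a"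
proof -
  have "{p. p \<in> points \<and> a \<in> set (path p)} = thru a"
    using in_path_iff[OF _ assms] by (auto simp: thru_def)
  then show ?thesis using sum_thru[OF assms cumulative] by simp
qed

section \<open>The paths as lists of arcs\<close>

lemma path_nth:
  assumes "p \<in> points" "k < plen p"
  shows "path p ! k < m" "tl (path p ! k) = fst ((fw ^^ k) p)" "hd (path p ! k) = fst ((fw ^^ Suc k) p)"
    "snd ((fw ^^ Suc k) p) = snd ((fw ^^ k) p) + (ei (path p ! k) - eo (path p ! k))"
    "eo (path p ! k) - fl (path p ! k) < snd ((fw ^^ k) p)" "snd ((fw ^^ k) p) \<le> eo (path p ! k)"
proof -
  have n: "nx ((fw ^^ k) p) = Suc (path p ! k)"
    using plen(2)[OF assms(1), of k] assms(2) by (simp add: path_def)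
  have op: "on_path ((fw ^^ k) p)" using on_path_iter on_path_points assms by blast
  note s = fw_step[OF op n]
  show "path p ! k < m" "tl (path p ! k) = fst ((fw ^^ k) p)" "hd (path p ! k) = fst ((fw ^^ Suc k) p)"
    "snd ((fw ^^ Suc k) p) = snd ((fw ^^ k) p) + (ei (path p ! k) - eo (path p ! k))"
    "eo (path p ! k) - fl (path p ! k) < snd ((fw ^^ k) p)" "snd ((fw ^^ k) p) \<le> eo (path p ! k)"
    using s by auto
qed

lemma length_path: "length (path p) = plen p"
  by (simp add: path_def)

lemma path_end:
  assumes "p \<in> points" "a < m"
  shows "tl a \<noteq> fst ((fw ^^ plen p) p)"
  using fw_stop(2)[OF on_path_iter[OF on_path_points[OF assms(1)]]] plen(2)[OF assms(1)] assms(2) by blast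

text \<open>A point is the end of some arc on its path, so a larger point cannot pass this arc.\<close>

lemma inj_path: "inj_on path points"
proof -
  have le: "\<not> snd p < snd q" if pq: "p \<in> points" "q \<in> points" "path p = path q" for p q
  proof
    assume less: "snd p < snd q"
    have len: "plen p = plen q" using pq(3) length_path by metis
    obtain a where a: "a < m" "p = (bw ^^ h) (tl a, eo a)" using pq(1) by (auto simp: points_def)
    obtain j where j: "(fw ^^ j) p = (tl a, eo a)" using bw_iter(2)[OF on_out_end[OF a(1)], of h] a(2) by auto
    have "nx (tl a, eo a) = Suc a" using nx_thru[OF a(1)] pos[OF a(1)] by simp
    then have jp: "j < plen p" and pj: "path p ! j = a"
      using plen(2)[OF pq(1), of j] j by (auto simp: path_def)
    have "k \<le> j \<Longrightarrow> snd ((fw ^^ k) q) - snd ((fw ^^ k) p) = snd q - snd p" for k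
    proof (induction k)
      case (Suc k)
      then have "k < plen p" using jp by simp
      then show ?case
        using Suc path_nth(4)[OF pq(1), of k] path_nth(4)[OF pq(2), of k] len pq(3) by simp
    qed simp
    then have "snd ((fw ^^ j) q) > eo a" using less j by force
    then show False using path_nth(6)[OF pq(2), of j] jp len pj pq(3) by simp
  qed
  have eq: "fst p = fst q" if "p \<in> points" "q \<in> points" "path p = path q" for p q
    using path_nth(2)[OF that(1) plen(3)[OF that(1)]] path_nth(2)[OF that(2) plen(3)[OF that(2)]] that(3) by simp
  show ?thesis
  proof (rule inj_onI)
    fix p q assume pq: "p \<in> points" "q \<in> points" "path p = path q"
    have "snd p = snd q" using le[OF pq] le[OF pq(2,1) pq(3)[symmetric]] by simp
    then show "p = q" using eq[OF pq] by (simp add: prod_eq_iff)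
  qed
qed

text \<open>The maximum is attained, by 0 or by a position strictly below; both are smaller than the
  position of \<open>p\<close>.\<close>

lemma amount_pos: "p \<in> points \<Longrightarrow> 0 < amount p"
proof -
  assume p: "p \<in> points"
  have fin: "finite {y. (fst p, y) \<in> points \<and> y < snd p}"
    by (rule finite_subset[OF _ finite_imageI[OF finite_points, of snd]]) force
  have "Max (insert 0 {y. (fst p, y) \<in> points \<and> y < snd p}) \<in> insert 0 {y. (fst p, y) \<in> points \<and> y < snd p}"
    using fin by (intro Max_in) auto
  then show ?thesis using points(1)[OF p] by (auto simp: amount_def on_out_def)
qed

end

section \<open>Passes over arrays\<close>

text \<open>
  Registers 1 to 4 hold \<open>n\<close>, \<open>m\<close>, \<open>h\<close> and \<open>2 m\<close>, registers 5 to 7 are loop counters. In the arrays of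
  length \<open>2 m\<close> the first half belongs to the points and the second half to the arcs. Arrays 10 and 11
  and the real array 10 contain the records to be sorted (vertex, number, position), array 12 and the real
  array 12 copies of neighbours' data, arrays 13 and 14 and the real array 11 the data moved by scans.
  The vertices and positions of the points are in array 17 and the real array 15, the arcs just found in
  array 18, and the real arrays 13 and 14 contain the ends of the intervals of the arcs.
\<close>

lemma lstep_push:
  "lstep (g, Arith b d x y) (r, q, M, X) = (r(d := if holds g r q then arith_val b (opv r x) (opv r y) else r d), q, M, X)"
  "lstep (g, Load d A i) (r, q, M, X) = (r(d := if holds g r q then M (A, opv r i) else r d), q, M, X)"
  "lstep (g, Store A i x) (r, q, M, X) = (r, q, if holds g r q then M((A, opv r i) := opv r x) else M, X)"
  "lstep (g, RAdd d j k) (r, q, M, X) = (r, q(d := if holds g r q then q j + q k else q d), M, X)"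
  "lstep (g, RSub d j k) (r, q, M, X) = (r, q(d := if holds g r q then q j - q k else q d), M, X)"
  "lstep (g, RLoad d A i) (r, q, M, X) = (r, q(d := if holds g r q then X (A, opv r i) else q d), M, X)"
  "lstep (g, RStore A i k) (r, q, M, X) = (r, q, M, if holds g r q then X((A, opv r i) := q k) else X)"
  by auto

lemma lrun_append: "lrun (b @ b') s = lrun b' (lrun b s)"
  by (induction b arbitrary: s) auto

lemma foot_append: "foot (b @ b') s = foot b s \<union> foot b' (lrun b s)"
  by (induction b arbitrary: s) auto

lemma safe_append: "safe W (b @ b') s \<longleftrightarrow> safe W b s \<and> safe W b' (lrun b s)"
  by (induction b arbitrary: s) auto

abbreviation always :: guard where "always \<equiv> GLess (Imm 0) (Imm 1)"

definition put :: "nat \<Rightarrow> nat \<Rightarrow> (nat \<Rightarrow> 'a) \<Rightarrow> (nat \<times> nat \<Rightarrow> 'a) \<Rightarrow> nat \<times> nat \<Rightarrow> 'a" where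
  "put A c f M x = (if fst x = A \<and> snd x < c then f (snd x) else M x)"

lemma put_apply: "put A c f M (B, i) = (if B = A \<and> i < c then f i else M (B, i))"
  by (simp add: put_def)

definition same :: "nat set \<Rightarrow> (nat \<times> nat \<Rightarrow> 'a) \<Rightarrow> (nat \<times> nat \<Rightarrow> 'a) \<Rightarrow> bool" where
  "same S M M' \<longleftrightarrow> (\<forall>A i. A \<notin> S \<longrightarrow> M' (A, i) = M (A, i))"

lemma same_refl: "same S M M" by (simp add: same_def)

lemma same_put: "A \<in> S \<Longrightarrow> same S M M' \<Longrightarrow> same S M (put A c f M')"
  by (auto simp: same_def put_apply)

lemma same_at: "same S M M' \<Longrightarrow> A \<notin> S \<Longrightarrow> M' (A, i) = M (A, i)"
  by (simp add: same_def)

text \<open>\<open>W_bound\<close> covers the numbers formed by the passes: counters and partner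
  indices are below a small multiple of \<open>N\<close>, vertex numbers and the key of surplus
  records are at most \<open>n\<close>, rounds at most \<open>h\<close>, cells of the path array are
  numbered below \<open>N * h\<close>, and the rest is slack for small constants.\<close>

locale pram =
  fixes N n h W :: nat
  assumes N_pos: "0 < N" and W_bound: "8 * N + n + 2 * h + N * h + 16 \<le> W"
begin

definition cfg :: "(nat \<Rightarrow> nat) \<Rightarrow> bool" where
  "cfg u \<longleftrightarrow> u 1 = n \<and> u 2 = N \<and> u 3 = h \<and> u 4 = 2 * N"

text \<open>Binary logarithm of the number of records, rounded up; it counts the merges of a sort
  and also the doublings of a scan.\<close>

definition lg :: nat where "lg = (LEAST l. 2 * N \<le> 2 ^ l)"

lemma lg: "2 * N \<le> 2 ^ lg" "s < lg \<Longrightarrow> 2 ^ s < 2 * N"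
proof -
  have "2 * N \<le> 2 ^ (2 * N)" by (rule less_imp_le[OF less_exp])
  then show "2 * N \<le> 2 ^ lg" unfolding lg_def by (rule LeastI)
  show "s < lg \<Longrightarrow> 2 ^ s < 2 * N" unfolding lg_def using not_less_Least[of s] by fastforce
qed

end

text \<open>The record number as last component makes all keys distinct. Since points are numbered
  below arcs, a point exactly at the end of an arc is sorted before this arc.\<close>

definition keys :: "(nat \<times> nat \<Rightarrow> nat) \<Rightarrow> (nat \<times> nat \<Rightarrow> real) \<Rightarrow> nat \<Rightarrow> nat \<times> real \<times> nat" where
  "keys M X i = (M (10, i), X (10, i), M (11, i))"

definition grd :: "guard \<Rightarrow> instr list \<Rightarrow> ginstr list" where
  "grd g is = map (Pair g) is"

lemma grd_simps: "grd g [] = []" "grd g (i # is) = (g, i) # grd g is"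
  by (simp_all add: grd_def)

lemma length_grd: "length (grd g is) = length is" by (simp add: grd_def)

lemma grd_idle:
  assumes "\<not> holds g r q"
  shows "lrun (grd g is) (r, q, M, X) = (r, q, M, X)" "foot (grd g is) (r, q, M, X) = {}"
    "safe W (grd g is) (r, q, M, X)"
  using assms by (induction "is") (auto simp: grd_simps)

section \<open>Compare-exchange as straight-line code\<close>

abbreviation "pos k \<equiv> GLess (Imm 0) (Reg k)"

text \<open>Register 11 holds the partner. By truncated subtraction register 12 becomes positive
  exactly when the partner is larger and inside the array, so only the lower of two partners
  acts.\<close>

definition cmpx_test :: "ginstr list" where
  "cmpx_test =
     [(always, Arith Sub 12 (Reg 4) (Reg 11)),
      (always, Arith Sub 13 (Reg 11) (Reg 10)),
      (GLess (Reg 13) (Imm 1), Arith Sub 12 (Imm 0) (Imm 0))]"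

definition cmpx_load :: "ginstr list" where
  "cmpx_load = grd (pos 12)
     [Load 14 10 (Reg 10), Load 15 10 (Reg 11), Load 16 11 (Reg 10), Load 17 11 (Reg 11),
      RLoad 0 10 (Reg 10), RLoad 1 10 (Reg 11)]"

text \<open>Lexicographic comparison from the least to the most significant component, each test
  overriding the earlier ones; the last instruction cancels the result for idle processors.\<close>

definition cmpx_compare :: "ginstr list" where
  "cmpx_compare =
     [(always, Arith Sub 18 (Imm 0) (Imm 0)),
      (GLess (Reg 17) (Reg 16), Arith Add 18 (Imm 1) (Imm 0)),
      (GRLess 1 0, Arith Add 18 (Imm 1) (Imm 0)),
      (GRLess 0 1, Arith Add 18 (Imm 0) (Imm 0)),
      (GLess (Reg 15) (Reg 14), Arith Add 18 (Imm 1) (Imm 0)),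
      (GLess (Reg 14) (Reg 15), Arith Add 18 (Imm 0) (Imm 0)),
      (GLess (Reg 12) (Imm 1), Arith Add 18 (Imm 0) (Imm 0))]"

definition cmpx_store :: "ginstr list" where
  "cmpx_store = grd (pos 18)
     [Store 10 (Reg 10) (Reg 15), Store 10 (Reg 11) (Reg 14), Store 11 (Reg 10) (Reg 17),
      Store 11 (Reg 11) (Reg 16), RStore 10 (Reg 10) 1, RStore 10 (Reg 11) 0]"

definition cmpx :: "ginstr list" where
  "cmpx = cmpx_test @ cmpx_load @ cmpx_compare @ cmpx_store"

definition pair_cells :: "nat \<Rightarrow> nat \<Rightarrow> cell set" where
  "pair_cells i l = {Cell (10, i), Cell (10, l), Cell (11, i), Cell (11, l), RCell (10, i), RCell (10, l)}"

lemma cmpx_test: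
  "case lrun cmpx_test (r, q, M, X) of (r', q', M', X') \<Rightarrow>
     q' = q \<and> M' = M \<and> X' = X \<and> (0 < r' 12 \<longleftrightarrow> r 10 < r 11 \<and> r 11 < r 4) \<and> (\<forall>k\<le>11. r' k = r k)"
  "foot cmpx_test (r, q, M, X) = {}" "safe W cmpx_test (r, q, M, X)"
  by (auto simp: cmpx_test_def lstep_push simp del: lstep.simps)

lemma cmpx_load:
  assumes "0 < r 12"
  shows "case lrun cmpx_load (r, q, M, X) of (r', q', M', X') \<Rightarrow>
     M' = M \<and> X' = X \<and> (\<forall>k\<le>12. r' k = r k) \<and>
     (r' 14, q' 0, r' 16) = keys M X (r 10) \<and> (r' 15, q' 1, r' 17) = keys M X (r 11)"
    "foot cmpx_load (r, q, M, X) \<subseteq> pair_cells (r 10) (r 11)" "safe W cmpx_load (r, q, M, X)"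
  using assms by (simp_all add: cmpx_load_def grd_simps pair_cells_def keys_def)

lemma cmpx_store:
  assumes "0 < r 18"
  shows "lrun cmpx_store (r, q, M, X) = (r, q, M((10, r 10) := r 15, (10, r 11) := r 14, (11, r 10) := r 17,
      (11, r 11) := r 16), X((10, r 10) := q 1, (10, r 11) := q 0))"
    "foot cmpx_store (r, q, M, X) \<subseteq> pair_cells (r 10) (r 11)" "safe W cmpx_store (r, q, M, X)"
  using assms by (simp_all add: cmpx_store_def grd_simps pair_cells_def)

lemma cmpx_compare:
  "case lrun cmpx_compare (r, q, M, X) of (r', q', M', X') \<Rightarrow>
     q' = q \<and> M' = M \<and> X' = X \<and>
     (0 < r' 18 \<longleftrightarrow> 0 < r 12 \<and> (r 15, q 1, r 17) < (r 14, q 0, r 16)) \<and> (\<forall>k\<le>17. r' k = r k)"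
  by (simp add: cmpx_compare_def lstep_push less_prod_simp del: lstep.simps split del: if_split) (auto)

lemma foot_quiet: "\<forall>a\<in>set b. \<forall>r. acc (snd a) r = {} \<Longrightarrow> foot b s = {}"
proof (induction b arbitrary: s)
  case (Cons a b)
  then show ?case by (cases a, cases s) auto
qed simp

lemma lsafe_quiet: "\<forall>r. word_ok W (snd a) r \<Longrightarrow> lsafe W a s"
  by (cases a; cases s) auto

lemma safe_quiet: "\<forall>a\<in>set b. \<forall>r. word_ok W (snd a) r \<Longrightarrow> safe W b s"
proof (induction b arbitrary: s)
  case (Cons a b)
  then show ?case using lsafe_quiet[of W a] by (simp del: lsafe.simps lstep.simps)
qed simp

lemma cmpx_compare':
  "foot cmpx_compare s = {}" "1 \<le> W \<Longrightarrow> safe W cmpx_compare s"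
  by (rule foot_quiet, simp add: cmpx_compare_def) (rule safe_quiet, auto simp: cmpx_compare_def)

lemma cmpx:
  fixes r :: "nat \<Rightarrow> nat"
  assumes "1 \<le> W"
  defines "i \<equiv> r 10" and "l \<equiv> r 11"
  shows "safe W cmpx (r, q, M, X)"
    and "\<not> (i < l \<and> l < r 4) \<Longrightarrow> foot cmpx (r, q, M, X) = {} \<and>
      lmem (lrun cmpx (r, q, M, X)) = M \<and> lrmem (lrun cmpx (r, q, M, X)) = X"
    and "i < l \<Longrightarrow> l < r 4 \<Longrightarrow> foot cmpx (r, q, M, X) \<subseteq> pair_cells i l"
    and "i < l \<Longrightarrow> l < r 4 \<Longrightarrow> keys M X l < keys M X i \<Longrightarrow>
      lmem (lrun cmpx (r, q, M, X)) = M((10, i) := M (10, l), (10, l) := M (10, i),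
        (11, i) := M (11, l), (11, l) := M (11, i)) \<and>
      lrmem (lrun cmpx (r, q, M, X)) = X((10, i) := X (10, l), (10, l) := X (10, i))"
    and "i < l \<Longrightarrow> l < r 4 \<Longrightarrow> \<not> keys M X l < keys M X i \<Longrightarrow>
      lmem (lrun cmpx (r, q, M, X)) = M \<and> lrmem (lrun cmpx (r, q, M, X)) = X"
proof -
  obtain r1 where 1: "lrun cmpx_test (r, q, M, X) = (r1, q, M, X)"
    "0 < r1 12 \<longleftrightarrow> i < l \<and> l < r 4" "\<And>k. k \<le> 11 \<Longrightarrow> r1 k = r k"
    using cmpx_test(1)[where r = r and q = q and M = M and X = X] by (auto simp: i_def l_def split: prod.splits)
  have il: "r1 10 = i" "r1 11 = l" using 1(3) by (auto simp: i_def l_def)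
  consider (idle) "\<not> (i < l \<and> l < r 4)" | (busy) "i < l" "l < r 4" by blast
  then have "safe W cmpx (r, q, M, X) \<and>
    (\<not> (i < l \<and> l < r 4) \<longrightarrow> foot cmpx (r, q, M, X) = {} \<and>
      lmem (lrun cmpx (r, q, M, X)) = M \<and> lrmem (lrun cmpx (r, q, M, X)) = X) \<and>
    (i < l \<and> l < r 4 \<longrightarrow> foot cmpx (r, q, M, X) \<subseteq> pair_cells i l) \<and>
    (i < l \<and> l < r 4 \<and> keys M X l < keys M X i \<longrightarrow>
      lmem (lrun cmpx (r, q, M, X)) = M((10, i) := M (10, l), (10, l) := M (10, i),
        (11, i) := M (11, l), (11, l) := M (11, i)) \<and>
      lrmem (lrun cmpx (r, q, M, X)) = X((10, i) := X (10, l), (10, l) := X (10, i))) \<and>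
    (i < l \<and> l < r 4 \<and> \<not> keys M X l < keys M X i \<longrightarrow>
      lmem (lrun cmpx (r, q, M, X)) = M \<and> lrmem (lrun cmpx (r, q, M, X)) = X)"
  proof cases
    case idle
    then have r1: "\<not> holds (pos 12) r1 q" using 1(2) by simp
    have 2: "lrun cmpx_load (r1, q, M, X) = (r1, q, M, X)" "foot cmpx_load (r1, q, M, X) = {}"
      "safe W cmpx_load (r1, q, M, X)"
      using grd_idle[OF r1] by (simp_all add: cmpx_load_def)
    obtain r3 where 3: "lrun cmpx_compare (r1, q, M, X) = (r3, q, M, X)" "r3 18 = 0"
      using cmpx_compare[where r = r1 and q = q and M = M and X = X] r1 by (auto split: prod.splits)
    then have r3: "\<not> holds (pos 18) r3 q" by simp
    have 4: "lrun cmpx_store (r3, q, M, X) = (r3, q, M, X)" "foot cmpx_store (r3, q, M, X) = {}"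
      "safe W cmpx_store (r3, q, M, X)"
      using grd_idle[OF r3] by (simp_all add: cmpx_store_def)
    show ?thesis
      using idle assms(1) by (auto simp: cmpx_def lrun_append foot_append safe_append 1(1) 2 3(1) 4
        cmpx_test(2,3) cmpx_compare')
  next
    case busy
    then have r1: "0 < r1 12" using 1(2) by simp
    obtain r2 q2 where 2: "lrun cmpx_load (r1, q, M, X) = (r2, q2, M, X)" "\<And>k. k \<le> 12 \<Longrightarrow> r2 k = r1 k"
      "(r2 14, q2 0, r2 16) = keys M X i" "(r2 15, q2 1, r2 17) = keys M X l"
      using cmpx_load(1)[where r = r1 and q = q and M = M and X = X, OF r1] by (auto simp: il split: prod.splits)
    obtain r3 where 3: "lrun cmpx_compare (r2, q2, M, X) = (r3, q2, M, X)"
      "0 < r3 18 \<longleftrightarrow> keys M X l < keys M X i" "\<And>k. k \<le> 17 \<Longrightarrow> r3 k = r2 k"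
      using cmpx_compare[where r = r2 and q = q2 and M = M and X = X] r1 unfolding 2(3,4) by (auto simp: 2(2) split: prod.splits)
    have il3: "r3 10 = i" "r3 11 = l" using 2(2) 3(3) il by auto
    have v: "r3 14 = M (10, i)" "r3 15 = M (10, l)" "r3 16 = M (11, i)" "r3 17 = M (11, l)"
      "q2 0 = X (10, i)" "q2 (Suc 0) = X (10, l)"
      using 2(3,4) 3(3) by (auto simp: keys_def)
    have f: "foot cmpx_load (r1, q, M, X) \<subseteq> pair_cells i l" "safe W cmpx_load (r1, q, M, X)"
      using cmpx_load(2,3)[where r = r1, OF r1] by (auto simp: il)
    show ?thesis
    proof (cases "keys M X l < keys M X i")
      case True
      then have r3: "0 < r3 18" using 3(2) by simp
      show ?thesis
        using busy assms(1) True f cmpx_store(2,3)[where r = r3, OF r3]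
        by (auto simp: cmpx_def lrun_append foot_append safe_append 1(1) 2(1) 3(1)
          cmpx_store(1)[where r = r3, OF r3] cmpx_test(2,3) cmpx_compare' il3 v)
    next
      case False
      then have r3: "\<not> holds (pos 18) r3 q2" using 3(2) by simp
      have 4: "lrun cmpx_store (r3, q2, M, X) = (r3, q2, M, X)" "foot cmpx_store (r3, q2, M, X) = {}"
        "safe W cmpx_store (r3, q2, M, X)"
        using grd_idle[OF r3] by (simp_all add: cmpx_store_def)
      show ?thesis
        using busy assms(1) False f by (auto simp: cmpx_def lrun_append foot_append safe_append
          1(1) 2(1) 3(1) 4 cmpx_test(2,3) cmpx_compare')
    qed
  qed
  then show "safe W cmpx (r, q, M, X)"
    and "\<not> (i < l \<and> l < r 4) \<Longrightarrow> foot cmpx (r, q, M, X) = {} \<and>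
      lmem (lrun cmpx (r, q, M, X)) = M \<and> lrmem (lrun cmpx (r, q, M, X)) = X"
    and "i < l \<Longrightarrow> l < r 4 \<Longrightarrow> foot cmpx (r, q, M, X) \<subseteq> pair_cells i l"
    and "i < l \<Longrightarrow> l < r 4 \<Longrightarrow> keys M X l < keys M X i \<Longrightarrow>
      lmem (lrun cmpx (r, q, M, X)) = M((10, i) := M (10, l), (10, l) := M (10, i),
        (11, i) := M (11, l), (11, l) := M (11, i)) \<and>
      lrmem (lrun cmpx (r, q, M, X)) = X((10, i) := X (10, l), (10, l) := X (10, i))"
    and "i < l \<Longrightarrow> l < r 4 \<Longrightarrow> \<not> keys M X l < keys M X i \<Longrightarrow>
      lmem (lrun cmpx (r, q, M, X)) = M \<and> lrmem (lrun cmpx (r, q, M, X)) = X"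
    by blast+
qed

context pram
begin

text \<open>The prefix \<open>pre\<close> computes the partner. A processor that is not the lower
  partner may compute anything up to its own number, which makes it idle. As \<open>f\<close> is an
  involution, the pairs served by different processors are disjoint.\<close>

lemma runs_stage:
  assumes u: "cfg u"
    and pre_ok: "\<forall>a\<in>set pre. simple (snd a) \<and> dest_ok (snd a)"
    and inv: "\<And>i. f (f i) = i"
    and pre: "\<And>v r q M X. v < 2 * N \<Longrightarrow> \<forall>k\<in>{1..<10}. r k = u k \<Longrightarrow> r 10 = v \<Longrightarrow>
      foot pre (r, q, M, X) = {} \<and> safe W pre (r, q, M, X) \<and>
      (case lrun pre (r, q, M, X) of (r', q', M', X') \<Rightarrow>
         M' = M \<and> X' = X \<and> (if v < f v then r' 11 = f v else r' 11 \<le> v))"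
  shows "runs N W (Pass (pre @ cmpx)) (u, M, X) (6 * length pre + 138)
    (u, put 10 (2 * N) (\<lambda>i. fst (stage (2 * N) f (keys M X) i))
         (put 11 (2 * N) (\<lambda>i. snd (snd (stage (2 * N) f (keys M X) i))) M),
     put 10 (2 * N) (\<lambda>i. fst (snd (stage (2 * N) f (keys M X) i))) X)"
proof -
  define F where "F v = (if v < f v \<and> f v < 2 * N then pair_cells v (f v) else {})" for v
  let ?K = "stage (2 * N) f (keys M X)"
  let ?M = "put 10 (2 * N) (\<lambda>i. fst (?K i)) (put 11 (2 * N) (\<lambda>i. snd (snd (?K i))) M)"
  let ?X = "put 10 (2 * N) (\<lambda>i. fst (snd (?K i))) X"
  have len: "6 * length (pre @ cmpx) + 6 = 6 * length pre + 138"
    by (simp add: cmpx_def cmpx_test_def cmpx_load_def cmpx_compare_def cmpx_store_def length_grd)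
  have W1: "1 \<le> W" using W_bound by simp
  have still: "keys M X i = ?K i" if "\<not> (i < f i \<and> f i < 2 * N)" "\<not> (f i < i \<and> i < 2 * N)" "i < 2 * N" for i
    using that by (cases "f i < 2 * N"; cases "f i = i") (auto simp: stage_def)
  have outside: "?M x = M x" if "\<forall>v<2*N. Cell x \<notin> F v" for x
  proof (cases "(fst x = 10 \<or> fst x = 11) \<and> snd x < 2 * N")
    case True
    let ?i = "snd x"
    have x: "x = (10, ?i) \<or> x = (11, ?i)" using True by (cases x) auto
    have "\<not> (?i < f ?i \<and> f ?i < 2 * N)"
      using that[rule_format, of ?i] True x by (auto simp: F_def pair_cells_def)
    moreover have "\<not> (f ?i < ?i \<and> ?i < 2 * N)"
      using that[rule_format, of "f ?i"] True x inv by (auto simp: F_def pair_cells_def)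
    ultimately have "?K ?i = keys M X ?i" using still True by simp
    then show ?thesis using True by (cases x) (auto simp: put_def keys_def)
  qed (auto simp: put_def)
  have routside: "?X x = X x" if "\<forall>v<2*N. RCell x \<notin> F v" for x
  proof (cases "fst x = 10 \<and> snd x < 2 * N")
    case True
    let ?i = "snd x"
    have x: "x = (10, ?i)" using True by (cases x) auto
    have "\<not> (?i < f ?i \<and> f ?i < 2 * N)"
      using that[rule_format, of ?i] True x by (auto simp: F_def pair_cells_def)
    moreover have "\<not> (f ?i < ?i \<and> ?i < 2 * N)"
      using that[rule_format, of "f ?i"] True x inv by (auto simp: F_def pair_cells_def)
    ultimately have "?K ?i = keys M X ?i" using still True by simp
    then show ?thesis using x True by (auto simp: put_def keys_def)
  qed (auto simp: put_def)
  have "runs N W (Pass (pre @ cmpx)) (u, M, X) (6 * length (pre @ cmpx) + 6) (u, ?M, ?X)"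
  proof (rule runs_Pass[where F = F])
    show "u 2 = N" "2 * N \<le> W" using u W_bound by (auto simp: cfg_def)
    show "\<forall>a\<in>set (pre @ cmpx). simple (snd a) \<and> dest_ok (snd a)"
      using pre_ok by (auto simp: cmpx_def cmpx_test_def cmpx_load_def cmpx_compare_def cmpx_store_def grd_simps)
    show "F v \<inter> F w = {}" if "v < 2 * N" "w < 2 * N" "v \<noteq> w" for v w
    proof -
      have "v < f v \<Longrightarrow> w < f w \<Longrightarrow> v \<noteq> f w \<and> f v \<noteq> w \<and> f v \<noteq> f w"
        using inv[of v] inv[of w] that(3) by (metis less_asym)
      then show ?thesis using that(3) by (auto simp: F_def pair_cells_def)
    qed
    fix v r q assume v: "v < 2 * N" and r: "\<forall>k\<in>{1..<10}. r k = u k" "r 10 = v"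
    obtain r' q' where p: "lrun pre (r, q, M, X) = (r', q', M, X)" "foot pre (r, q, M, X) = {}"
      "safe W pre (r, q, M, X)" "if v < f v then r' 11 = f v else r' 11 \<le> v"
      using pre[OF v r, of q M X] by (auto split: prod.splits)
    have keep: "r' k = r k" if "k \<le> 10" for k
      using lrun_keeps[of pre k "(r, q, M, X)"] pre_ok that p(1) by simp
    have r10: "r' 10 = v" and r4: "r' 4 = 2 * N" using keep r u by (auto simp: cfg_def)
    note c = cmpx[OF W1, where r = r' and q = q' and M = M and X = X, unfolded r10 r4]
    have run: "lrun (pre @ cmpx) (r, q, M, X) = lrun cmpx (r', q', M, X)"
      "foot (pre @ cmpx) (r, q, M, X) = foot cmpx (r', q', M, X)"
      "safe W (pre @ cmpx) (r, q, M, X)"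
      using p c(1) by (auto simp: lrun_append foot_append safe_append)
    show "foot (pre @ cmpx) (r, q, M, X) \<subseteq> F v \<and> safe W (pre @ cmpx) (r, q, M, X) \<and>
        agree (F v) (lrun (pre @ cmpx) (r, q, M, X)) ?M ?X"
    proof (cases "v < f v \<and> f v < 2 * N")
      case False
      then have "\<not> (v < r' 11 \<and> r' 11 < 2 * N)" using p(4) by (auto split: if_splits)
      then show ?thesis using c(2) run False by (auto simp: F_def agree_def)
    next
      case True
      then have l: "r' 11 = f v" using p(4) by simp
      have s: "?K v = (if keys M X (f v) < keys M X v then keys M X (f v) else keys M X v)"
        "?K (f v) = (if keys M X (f v) < keys M X v then keys M X v else keys M X (f v))"
        using True v inv[of v] by (auto simp: stage_def min_def max_def)
      show ?thesis
      proof (cases "keys M X (f v) < keys M X v")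
        case less: True
        then show ?thesis
          using c(3,4) run True l s
          by (auto simp: F_def agree_def pair_cells_def put_apply keys_def)
      next
        case less: False
        then show ?thesis
          using c(3,5) run True l s
          by (auto simp: F_def agree_def pair_cells_def put_apply keys_def)
      qed
    qed
  qed (use outside routside in auto)
  then show ?thesis unfolding len .
qed

end

text \<open>Register 13 becomes the start of the block and register 14 the offset in it.\<close>

definition flip_pre :: "ginstr list" where
  "flip_pre = grd always
     [Arith Mul 11 (Reg 5) (Imm 2), Arith Div 13 (Reg 10) (Reg 11), Arith Mul 13 (Reg 13) (Reg 11),
      Arith Sub 14 (Reg 10) (Reg 13), Arith Add 11 (Reg 11) (Reg 13), Arith Sub 11 (Reg 11) (Imm 1),
      Arith Sub 11 (Reg 11) (Reg 14)]"

text \<open>By default register 11 is the own number, which idles the upper half of each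
  block.\<close>

definition half_pre :: "ginstr list" where
  "half_pre = grd always
     [Arith Mul 11 (Reg 6) (Imm 2), Arith Div 13 (Reg 10) (Reg 11), Arith Mul 13 (Reg 13) (Reg 11),
      Arith Sub 14 (Reg 10) (Reg 13), Arith Sub 11 (Reg 10) (Imm 0)] @
     [(GLess (Reg 14) (Reg 6), Arith Add 11 (Reg 10) (Reg 6))]"

text \<open>Register 5 is the length of the sorted blocks, register 6 the distance of the
  comparators, halved until it becomes 0.\<close>

definition sort_code :: com where
  "sort_code =
     Upd Add 5 (Imm 1) (Imm 0) ;;
     While (Reg 5) (Reg 4)
       (Pass (flip_pre @ cmpx) ;;
        Upd Div 6 (Reg 5) (Imm 2) ;;
        While (Imm 0) (Reg 6) (Pass (half_pre @ cmpx) ;; Upd Div 6 (Reg 6) (Imm 2)) ;;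
        Upd Mul 5 (Reg 5) (Imm 2))"

section \<open>The sorting network on the machine\<close>

lemma threshold_cong: "(\<And>i. i < n \<Longrightarrow> a i = b i) \<Longrightarrow> threshold n x a = threshold n x b"
  by (auto simp: threshold_def fun_eq_iff)

lemma rearranged_cong: "(\<And>i. i < n \<Longrightarrow> b i = c i) \<Longrightarrow> rearranged n a b = rearranged n a c"
  by (auto simp: rearranged_def)

context pram
begin

lemma base_le: "(v :: nat) div (k * 2) * (k * 2) \<le> v"
  by (metis div_times_less_eq_dividend)

lemma runs_flip:
  assumes u: "cfg u" "0 < u 5" "u 5 < 2 * N"
  shows "runs N W (Pass (flip_pre @ cmpx)) (u, M, X) 180
    (u, put 10 (2 * N) (\<lambda>i. fst (stage (2 * N) (flip (u 5)) (keys M X) i))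
         (put 11 (2 * N) (\<lambda>i. snd (snd (stage (2 * N) (flip (u 5)) (keys M X) i))) M),
     put 10 (2 * N) (\<lambda>i. fst (snd (stage (2 * N) (flip (u 5)) (keys M X) i))) X)"
proof -
  have "6 * length flip_pre + 138 = 180" by (simp add: flip_pre_def length_grd)
  moreover have "runs N W (Pass (flip_pre @ cmpx)) (u, M, X) (6 * length flip_pre + 138)
    (u, put 10 (2 * N) (\<lambda>i. fst (stage (2 * N) (flip (u 5)) (keys M X) i))
         (put 11 (2 * N) (\<lambda>i. snd (snd (stage (2 * N) (flip (u 5)) (keys M X) i))) M),
     put 10 (2 * N) (\<lambda>i. fst (snd (stage (2 * N) (flip (u 5)) (keys M X) i))) X)"
  proof (rule runs_stage[OF u(1)])
    show "\<forall>a\<in>set flip_pre. simple (snd a) \<and> dest_ok (snd a)" by (simp add: flip_pre_def grd_simps)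
    show "flip (u 5) (flip (u 5) i) = i" for i by (rule flip_self[OF u(2)])
    fix v and r :: "nat \<Rightarrow> nat" and q :: "nat \<Rightarrow> real" and M X assume v: "v < 2 * N" and r: "\<forall>k\<in>{1..<10}. r k = u k" "r 10 = v"
    define k where "k = u 5"
    have r5: "r 5 = k" using r by (simp add: k_def)
    have b: "v div (k * 2) * (k * 2) \<le> v" by (rule base_le)
    have k: "0 < k" "k < 2 * N" using u by (simp_all add: k_def)
    have bW: "v div (k * 2) * (k * 2) \<le> W" "k * 2 + v div (k * 2) * (k * 2) \<le> W"
      using b v k W_bound by linarith+
    have m: "v - v div (k * 2) * (k * 2) = v mod (k * 2)" by (simp add: minus_div_mult_eq_mod)
    have "v mod (k * 2) < k * 2" using k by simp
    then have "k * 2 + v div (k * 2) * (k * 2) - Suc 0 - v mod (k * 2) = flip k v"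
      by (simp add: flip_def mult.commute)
    then show "foot flip_pre (r, q, M, X) = {} \<and> safe W flip_pre (r, q, M, X) \<and>
      (case lrun flip_pre (r, q, M, X) of (r', q', M', X') \<Rightarrow>
         M' = M \<and> X' = X \<and> (if v < flip (u 5) v then r' 11 = flip (u 5) v else r' 11 \<le> v))"
      using W_bound v bW k unfolding k_def[symmetric]
      by (simp add: flip_pre_def grd_simps r5 r(2) m)
  qed
  ultimately show ?thesis by simp
qed

lemma runs_half:
  assumes u: "cfg u" "0 < u 6" "u 6 < 2 * N"
  shows "runs N W (Pass (half_pre @ cmpx)) (u, M, X) 174
    (u, put 10 (2 * N) (\<lambda>i. fst (stage (2 * N) (half (u 6)) (keys M X) i))
         (put 11 (2 * N) (\<lambda>i. snd (snd (stage (2 * N) (half (u 6)) (keys M X) i))) M),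
     put 10 (2 * N) (\<lambda>i. fst (snd (stage (2 * N) (half (u 6)) (keys M X) i))) X)"
proof -
  have "6 * length half_pre + 138 = 174" by (simp add: half_pre_def length_grd)
  moreover have "runs N W (Pass (half_pre @ cmpx)) (u, M, X) (6 * length half_pre + 138)
    (u, put 10 (2 * N) (\<lambda>i. fst (stage (2 * N) (half (u 6)) (keys M X) i))
         (put 11 (2 * N) (\<lambda>i. snd (snd (stage (2 * N) (half (u 6)) (keys M X) i))) M),
     put 10 (2 * N) (\<lambda>i. fst (snd (stage (2 * N) (half (u 6)) (keys M X) i))) X)"
  proof (rule runs_stage[OF u(1)])
    show "\<forall>a\<in>set half_pre. simple (snd a) \<and> dest_ok (snd a)" by (auto simp: half_pre_def grd_simps)
    show "half (u 6) (half (u 6) i) = i" for i by (rule half_self[OF u(2)])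
    fix v and r :: "nat \<Rightarrow> nat" and q :: "nat \<Rightarrow> real" and M X assume v: "v < 2 * N" and r: "\<forall>k\<in>{1..<10}. r k = u k" "r 10 = v"
    define k where "k = u 6"
    have r5: "r 6 = k" using r by (simp add: k_def)
    have b: "v div (k * 2) * (k * 2) \<le> v" by (rule base_le)
    have k: "0 < k" "k < 2 * N" using u by (simp_all add: k_def)
    have bW: "v div (k * 2) * (k * 2) \<le> W" "k * 2 + v div (k * 2) * (k * 2) \<le> W"
      using b v k W_bound by linarith+
    have m: "v - v div (k * 2) * (k * 2) = v mod (k * 2)" by (simp add: minus_div_mult_eq_mod)
    show "foot half_pre (r, q, M, X) = {} \<and> safe W half_pre (r, q, M, X) \<and>
      (case lrun half_pre (r, q, M, X) of (r', q', M', X') \<Rightarrow>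
         M' = M \<and> X' = X \<and> (if v < half (u 6) v then r' 11 = half (u 6) v else r' 11 \<le> v))"
      using W_bound v bW k unfolding k_def[symmetric]
      by (simp add: half_pre_def grd_simps r5 r(2) m half_def mult.commute[of 2])
  qed
  ultimately show ?thesis by simp
qed

lemma keys_put:
  "i < 2 * N \<Longrightarrow> keys (put 10 (2 * N) (\<lambda>i. fst (K i)) (put 11 (2 * N) (\<lambda>i. snd (snd (K i))) M))
     (put 10 (2 * N) (\<lambda>i. fst (snd (K i))) X) i = K i"
  by (simp add: keys_def put_apply)

definition sort_inv where
  "sort_inv u M X g \<longleftrightarrow> (case g of (u', M', X') \<Rightarrow>
     (\<forall>k. k \<noteq> 5 \<and> k \<noteq> 6 \<longrightarrow> u' k = u k) \<and> same {10, 11} M M' \<and> same {10} X X' \<and>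
     rearranged (2 * N) (keys M X) (keys M' X'))"

lemma sort_inv_stage:
  assumes "sort_inv u M X (u', M', X')" "\<And>i. f (f i) = i"
  defines "K \<equiv> stage (2 * N) f (keys M' X')"
  defines "M'' \<equiv> put 10 (2 * N) (\<lambda>i. fst (K i)) (put 11 (2 * N) (\<lambda>i. snd (snd (K i))) M')"
    and "X'' \<equiv> put 10 (2 * N) (\<lambda>i. fst (snd (K i))) X'"
  shows "sort_inv u M X (u', M'', X'')"
    and "threshold (2 * N) x (keys M'' X'') = bstage f (threshold (2 * N) x (keys M' X'))"
proof -
  have k: "keys M'' X'' i = K i" if "i < 2 * N" for i
    unfolding M''_def X''_def by (rule keys_put[OF that])
  have "rearranged (2 * N) (keys M X) K"
    unfolding K_def using rearranged_trans[OF _ rearranged_stage[OF assms(2)]] assms(1)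
    by (auto simp: sort_inv_def)
  then have "rearranged (2 * N) (keys M X) (keys M'' X'')" using rearranged_cong[OF k] by simp
  then show "sort_inv u M X (u', M'', X'')"
    using assms(1) by (auto simp: sort_inv_def M''_def X''_def intro!: same_put)
  show "threshold (2 * N) x (keys M'' X'') = bstage f (threshold (2 * N) x (keys M' X'))"
    using threshold_cong[OF k] by (simp add: K_def threshold_stage)
qed

lemma sort_inv_upd:
  "sort_inv u M X (u', M', X') \<Longrightarrow> d = 5 \<or> d = 6 \<Longrightarrow> sort_inv u M X (u'(d := w), M', X')"
  by (auto simp: sort_inv_def)

lemma cfg_sort_inv: "cfg u \<Longrightarrow> sort_inv u M X (u', M', X') \<Longrightarrow> cfg u'"
  by (simp add: cfg_def sort_inv_def)

text \<open>The reflection turns sorted blocks into the invariant \<open>merging\<close>, which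
  \<open>s\<close> half-cleaners refine to subblocks of length 1. A half-cleaner costs 174 steps,
  one for the update and two for the loop, hence 177.\<close>

lemma runs_merge:
  assumes u: "cfg u" and inv: "sort_inv u M X (u1, M1, X1)" and s: "2 ^ s < 2 * N" "u1 5 = 2 ^ s"
    and sorted: "sorted_blocks (2 * N) (2 ^ s) (keys M1 X1)"
  shows "\<exists>g. runs N W (Pass (flip_pre @ cmpx) ;; Upd Div 6 (Reg 5) (Imm 2) ;;
      While (Imm 0) (Reg 6) (Pass (half_pre @ cmpx) ;; Upd Div 6 (Reg 6) (Imm 2)) ;;
      Upd Mul 5 (Reg 5) (Imm 2)) (u1, M1, X1) (s * 177 + 184) g \<and>
    sort_inv u M X g \<and> ureg g 5 = 2 ^ Suc s \<and>
    (case g of (u', M', X') \<Rightarrow> sorted_blocks (2 * N) (2 ^ Suc s) (keys M' X'))"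
proof -
  have cfg: "cfg u'" if "sort_inv u M X (u', M', X')" for u' M' X' by (rule cfg_sort_inv[OF u that])
  have k0: "0 < u1 5" using s by simp
  obtain M2 X2 where 1: "runs N W (Pass (flip_pre @ cmpx)) (u1, M1, X1) 180 (u1, M2, X2)"
    and inv2: "sort_inv u M X (u1, M2, X2)"
    and th2: "\<And>x. threshold (2 * N) x (keys M2 X2) = bstage (flip (2 ^ s)) (threshold (2 * N) x (keys M1 X1))"
    using runs_flip[OF cfg[OF inv] k0, of M1 X1] sort_inv_stage[OF inv, of "flip (2 ^ s)"] flip_self[of "2 ^ s"] s
    by simp
  have merging2: "merging (2 * 2 ^ s) (2 ^ s) (threshold (2 * N) x (keys M2 X2))" for x
    unfolding th2 using sorted by (intro merging_flip) (auto simp: sorted_blocks_threshold)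
  \<comment> \<open>The division makes the next distance 0 for \<open>t = s\<close>, which ends the
    inner loop.\<close>
  define J where "J t g \<longleftrightarrow> sort_inv u M X g \<and> (case g of (u', M', X') \<Rightarrow>
    u' 5 = 2 ^ s \<and> u' 6 = 2 ^ s div 2 ^ Suc t \<and>
    (\<forall>x. merging (2 * 2 ^ s) (2 ^ (s - t)) (threshold (2 * N) x (keys M' X'))))" for t g
  define u2 where "u2 = u1(6 := arith_val Div (opv u1 (Reg 5)) (opv u1 (Imm 2)))"
  have 2: "runs N W (Upd Div 6 (Reg 5) (Imm 2)) (u1, M2, X2) 1 (u2, M2, X2)"
    unfolding u2_def using s W_bound by (intro runs_Upd) auto
  have J0: "J 0 (u2, M2, X2)"
    using sort_inv_upd[OF inv2, of 6] merging2 s by (simp add: J_def u2_def)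
  have "\<exists>g'. runs N W (While (Imm 0) (Reg 6) (Pass (half_pre @ cmpx) ;; Upd Div 6 (Reg 6) (Imm 2)))
      (u2, M2, X2) (s * (175 + 2) + 2) g' \<and> J s g'"
  proof (rule runs_While)
    show "J 0 (u2, M2, X2)" by (rule J0)
    fix t g assume t: "t < s" and J: "J t g"
    obtain u3 M3 X3 where g: "g = (u3, M3, X3)" by (cases g)
    have inv3: "sort_inv u M X (u3, M3, X3)" and u3: "u3 5 = 2 ^ s" "u3 6 = 2 ^ s div 2 ^ Suc t"
      and m3: "\<And>x. merging (2 * 2 ^ s) (2 ^ (s - t)) (threshold (2 * N) x (keys M3 X3))"
      using J by (auto simp: J_def g)
    have c: "u3 6 = 2 ^ (s - Suc t)" using t u3(2) power_diff[of "2 :: nat" "Suc t" s] by simp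
    have st: "(2 :: nat) ^ (s - t) = 2 * 2 ^ (s - Suc t)" using t Suc_diff_Suc[OF t] by (metis power_Suc)
    have "(2 :: nat) ^ (s - Suc t) \<le> 2 ^ s" by (rule power_increasing) auto
    from le_less_trans[OF this s(1)] have c2: "0 < u3 6" "u3 6 < 2 * N" using c by auto
    obtain M4 X4 where 4: "runs N W (Pass (half_pre @ cmpx)) (u3, M3, X3) 174 (u3, M4, X4)"
      and inv4: "sort_inv u M X (u3, M4, X4)"
      and th4: "\<And>x. threshold (2 * N) x (keys M4 X4) = bstage (half (u3 6)) (threshold (2 * N) x (keys M3 X3))"
      using runs_half[OF cfg[OF inv3] c2, of M3 X3] sort_inv_stage[OF inv3, of "half (u3 6)"] half_self[OF c2(1)]
      by simp
    have dvd: "2 * 2 ^ (s - Suc t) dvd (2 * 2 ^ s :: nat)"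
      by (intro mult_dvd_mono le_imp_power_dvd) auto
    have m4: "merging (2 * 2 ^ s) (2 ^ (s - Suc t)) (threshold (2 * N) x (keys M4 X4))" for x
      unfolding th4 c using m3[of x] by (intro merging_half dvd) (auto simp: st)
    define u4 where "u4 = u3(6 := arith_val Div (opv u3 (Reg 6)) (opv u3 (Imm 2)))"
    have 5: "runs N W (Upd Div 6 (Reg 6) (Imm 2)) (u3, M4, X4) 1 (u4, M4, X4)"
      unfolding u4_def using c2 W_bound by (intro runs_Upd) auto
    have "2 ^ s div 2 ^ Suc t div 2 = (2 ^ s div 2 ^ Suc (Suc t) :: nat)"
      by (simp only: div_mult2_eq[symmetric] power_Suc2[of 2 "Suc t", symmetric])
    then have "J (Suc t) (u4, M4, X4)"
      using sort_inv_upd[OF inv4, of 6] m4 u3 by (simp add: J_def u4_def)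
    moreover have "opv (ureg g) (Imm 0) < opv (ureg g) (Reg 6)" using c2 by (simp add: g)
    ultimately show "opv (ureg g) (Imm 0) < opv (ureg g) (Reg 6) \<and>
      (\<exists>g'. runs N W (Pass (half_pre @ cmpx) ;; Upd Div 6 (Reg 6) (Imm 2)) g 175 g' \<and> J (Suc t) g')"
      using runs_Seq[OF 4 5] g by auto
  next
    fix g assume "J s g"
    then show "\<not> opv (ureg g) (Imm 0) < opv (ureg g) (Reg 6)" by (cases g) (auto simp: J_def)
  qed simp_all
  then obtain u5 M5 X5 where
    3: "runs N W (While (Imm 0) (Reg 6) (Pass (half_pre @ cmpx) ;; Upd Div 6 (Reg 6) (Imm 2)))
      (u2, M2, X2) (s * 177 + 2) (u5, M5, X5)" and J: "J s (u5, M5, X5)"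
    by (auto simp: numeral_eq_Suc)
  have inv5: "sort_inv u M X (u5, M5, X5)" and u5: "u5 5 = 2 ^ s" using J by (auto simp: J_def)
  have so: "sorted_blocks (2 * N) (2 ^ Suc s) (keys M5 X5)"
    unfolding sorted_blocks_threshold using J merging_sorted by (auto simp: J_def)
  define u6 where "u6 = u5(5 := arith_val Mul (opv u5 (Reg 5)) (opv u5 (Imm 2)))"
  have 4: "runs N W (Upd Mul 5 (Reg 5) (Imm 2)) (u5, M5, X5) 1 (u6, M5, X5)"
    unfolding u6_def using s u5 W_bound by (intro runs_Upd) auto
  have "180 + (1 + (s * 177 + 2 + 1)) = s * 177 + 184" by simp
  then have "runs N W (Pass (flip_pre @ cmpx) ;; Upd Div 6 (Reg 5) (Imm 2) ;;
      While (Imm 0) (Reg 6) (Pass (half_pre @ cmpx) ;; Upd Div 6 (Reg 6) (Imm 2)) ;;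
      Upd Mul 5 (Reg 5) (Imm 2)) (u1, M1, X1) (s * 177 + 184) (u6, M5, X5)"
    using runs_Seq[OF 1 runs_Seq[OF 2 runs_Seq[OF 3 4]]] by (simp only:)
  then show ?thesis
    using sort_inv_upd[OF inv5, of 5] so u5 by (intro exI[of _ "(u6, M5, X5)"]) (simp add: u6_def)
qed

text \<open>Every merge is charged as if it had \<open>lg\<close> half-cleaners; 186 is its
  remaining cost including the outer loop, 3 is for initialisation and exit.\<close>

definition tsort :: nat where "tsort = lg * (lg * 177 + 186) + 3"

text \<open>Array 11 numbers the records at first, so afterwards it is the permutation itself,
  through which further data is fetched and returned. Its distinct entries also make the order
  strict.\<close>

lemma runs_sort:
  assumes u: "cfg u" and id: "\<And>i. i < 2 * N \<Longrightarrow> M (11, i) = i"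
  obtains u' M' X' where "runs N W sort_code (u, M, X) tsort (u', M', X')"
    "\<And>k. k \<noteq> 5 \<Longrightarrow> k \<noteq> 6 \<Longrightarrow> u' k = u k" "same {10, 11} M M'" "same {10} X X'"
    "bij_betw (\<lambda>i. M' (11, i)) {..<2 * N} {..<2 * N}"
    "\<And>i. i < 2 * N \<Longrightarrow> M' (10, i) = M (10, M' (11, i))"
    "\<And>i. i < 2 * N \<Longrightarrow> X' (10, i) = X (10, M' (11, i))"
    "\<And>i j. i < j \<Longrightarrow> j < 2 * N \<Longrightarrow> keys M' X' i < keys M' X' j"
proof -
  define I where "I s g \<longleftrightarrow> sort_inv u M X g \<and> (case g of (u', M', X') \<Rightarrow>
    u' 5 = 2 ^ s \<and> sorted_blocks (2 * N) (2 ^ s) (keys M' X'))" for s g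
  define u1 where "u1 = u(5 := arith_val Add (opv u (Imm 1)) (opv u (Imm 0)))"
  have 1: "runs N W (Upd Add 5 (Imm 1) (Imm 0)) (u, M, X) 1 (u1, M, X)"
    unfolding u1_def using W_bound by (intro runs_Upd) auto
  have "sort_inv u M X (u, M, X)" by (simp add: sort_inv_def same_refl rearranged_refl)
  then have I0: "I 0 (u1, M, X)"
    using sort_inv_upd[of u M X u M X 5] by (auto simp: I_def u1_def sorted_blocks_def)
  have "\<exists>g'. runs N W (While (Reg 5) (Reg 4)
       (Pass (flip_pre @ cmpx) ;; Upd Div 6 (Reg 5) (Imm 2) ;;
        While (Imm 0) (Reg 6) (Pass (half_pre @ cmpx) ;; Upd Div 6 (Reg 6) (Imm 2)) ;;
        Upd Mul 5 (Reg 5) (Imm 2))) (u1, M, X) (lg * ((lg * 177 + 184) + 2) + 2) g' \<and> I lg g'"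
  proof (rule runs_While)
    show "I 0 (u1, M, X)" by (rule I0)
    fix s g assume s: "s < lg" and I: "I s g"
    obtain u2 M2 X2 where g: "g = (u2, M2, X2)" by (cases g)
    have inv: "sort_inv u M X (u2, M2, X2)" and u2: "u2 5 = 2 ^ s"
      and so: "sorted_blocks (2 * N) (2 ^ s) (keys M2 X2)" using I by (auto simp: I_def g)
    have "u2 4 = 2 * N" using cfg_sort_inv[OF u inv] by (simp add: cfg_def)
    then have "opv (ureg g) (Reg 5) < opv (ureg g) (Reg 4)" using u2 lg(2)[OF s] by (simp add: g)
    moreover obtain g' where g': "runs N W (Pass (flip_pre @ cmpx) ;; Upd Div 6 (Reg 5) (Imm 2) ;;
        While (Imm 0) (Reg 6) (Pass (half_pre @ cmpx) ;; Upd Div 6 (Reg 6) (Imm 2)) ;;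
        Upd Mul 5 (Reg 5) (Imm 2)) (u2, M2, X2) (s * 177 + 184) g'"
        "sort_inv u M X g'" "ureg g' 5 = 2 ^ Suc s"
        "case g' of (u', M', X') \<Rightarrow> sorted_blocks (2 * N) (2 ^ Suc s) (keys M' X')"
      using runs_merge[OF u inv lg(2)[OF s] u2 so] by blast
    ultimately show "opv (ureg g) (Reg 5) < opv (ureg g) (Reg 4) \<and>
      (\<exists>g'. runs N W (Pass (flip_pre @ cmpx) ;; Upd Div 6 (Reg 5) (Imm 2) ;;
        While (Imm 0) (Reg 6) (Pass (half_pre @ cmpx) ;; Upd Div 6 (Reg 6) (Imm 2)) ;;
        Upd Mul 5 (Reg 5) (Imm 2)) g (lg * 177 + 184) g' \<and> I (Suc s) g')"
      using runs_mono[OF g'(1), of "lg * 177 + 184"] s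
      by (intro conjI exI[of _ g']) (cases g'; auto simp: g I_def)+
  next
    fix g assume "I lg g"
    then obtain u' M' X' where g: "g = (u', M', X')" and i: "sort_inv u M X (u', M', X')" "u' 5 = 2 ^ lg"
      by (cases g) (auto simp: I_def)
    then show "\<not> opv (ureg g) (Reg 5) < opv (ureg g) (Reg 4)"
      using cfg_sort_inv[OF u i(1)] lg(1) by (simp add: cfg_def)
  qed simp_all
  then obtain u' M' X' where 2: "runs N W (While (Reg 5) (Reg 4)
       (Pass (flip_pre @ cmpx) ;; Upd Div 6 (Reg 5) (Imm 2) ;;
        While (Imm 0) (Reg 6) (Pass (half_pre @ cmpx) ;; Upd Div 6 (Reg 6) (Imm 2)) ;;
        Upd Mul 5 (Reg 5) (Imm 2))) (u1, M, X) (lg * ((lg * 177 + 184) + 2) + 2) (u', M', X')"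
    and I: "I lg (u', M', X')" by (metis prod_cases3)
  have inv: "sort_inv u M X (u', M', X')" and so: "sorted_blocks (2 * N) (2 ^ lg) (keys M' X')"
    using I by (auto simp: I_def)
  obtain p where p: "bij_betw p {..<2 * N} {..<2 * N}" "\<And>i. i < 2 * N \<Longrightarrow> keys M' X' i = keys M X (p i)"
    using inv by (auto simp: sort_inv_def rearranged_def)
  have p11: "M' (11, i) = p i" "M' (10, i) = M (10, p i)" "X' (10, i) = X (10, p i)" if "i < 2 * N" for i
    using p(2)[OF that] id[of "p i"] bij_betwE[OF p(1)] that by (auto simp: keys_def)
  show ?thesis
  proof (rule that[of u' M' X'])
    have "1 + (lg * ((lg * 177 + 184) + 2) + 2) = tsort" by (simp add: tsort_def)
    then show "runs N W sort_code (u, M, X) tsort (u', M', X')"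
      using runs_Seq[OF 1 2] by (simp only: sort_code_def)
    show "u' k = u k" if "k \<noteq> 5" "k \<noteq> 6" for k using inv that by (auto simp: sort_inv_def)
    show "same {10, 11} M M'" "same {10} X X'" using inv by (auto simp: sort_inv_def)
    show "bij_betw (\<lambda>i. M' (11, i)) {..<2 * N} {..<2 * N}"
      using p(1) by (rule iffD1[OF bij_betw_cong, rotated]) (simp add: p11)
    show "M' (10, i) = M (10, M' (11, i))" "X' (10, i) = X (10, M' (11, i))" if "i < 2 * N" for i
      using p11[OF that] by auto
    show "keys M' X' i < keys M' X' j" if ij: "i < j" "j < 2 * N" for i j
    proof -
      have "j < 2 ^ lg" using ij lg(1) by simp
      then have "keys M' X' i \<le> keys M' X' j" using so ij unfolding sorted_blocks_def by auto
      moreover have "M' (11, i) \<noteq> M' (11, j)"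
        using p11 ij bij_betw_imp_inj_on[OF p(1)] by (auto dest: inj_onD)
      ultimately show ?thesis by (auto simp: keys_def le_less)
    qed
  qed
qed

end

section \<open>Segmented scans\<close>

definition doubling :: "com \<Rightarrow> com" where
  "doubling c = Upd Add 5 (Imm 1) (Imm 0) ;; While (Reg 5) (Reg 4) (c ;; Upd Mul 5 (Reg 5) (Imm 2))"

definition copy_nat :: "nat \<Rightarrow> nat \<Rightarrow> ginstr list" where
  "copy_nat A B = grd always [Load 11 A (Reg 10), Store B (Reg 10) (Reg 11)]"

definition copy_real :: "nat \<Rightarrow> nat \<Rightarrow> ginstr list" where
  "copy_real A B = grd always [RLoad 0 A (Reg 10), RStore B (Reg 10) 0]"

text \<open>Equality has to be assembled from two strict comparisons.\<close>

definition equal_test :: "nat \<Rightarrow> nat \<Rightarrow> nat \<Rightarrow> ginstr list" where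
  "equal_test a b c =
     [(always, Arith Add c (Imm 1) (Imm 0)),
      (GLess (Reg a) (Reg b), Arith Sub c (Imm 0) (Imm 0)),
      (GLess (Reg b) (Reg a), Arith Sub c (Imm 0) (Imm 0))]"

text \<open>The neighbour's data is read from a copy, because its owner uses the original cell in
  the same pass. Adding 1 before the truncated subtraction makes register 12 positive exactly if the
  index is at least the shift.\<close>

definition sum_step :: "ginstr list" where
  "sum_step =
     grd always [Arith Add 12 (Reg 10) (Imm 1), Arith Sub 12 (Reg 12) (Reg 5),
       Arith Sub 11 (Reg 10) (Reg 5), Load 14 10 (Reg 10)] @
     grd (pos 12) [Load 13 12 (Reg 11), RLoad 0 12 (Reg 11)] @
     equal_test 13 14 15 @
     [(GLess (Reg 12) (Imm 1), Arith Sub 15 (Imm 0) (Imm 0))] @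
     grd (pos 15) [RLoad 1 11 (Reg 10), RAdd 1 1 0, RStore 11 (Reg 10) 1]"

definition sum_scan :: com where
  "sum_scan = Pass (copy_nat 10 12) ;; doubling (Pass (copy_real 11 12) ;; Pass sum_step)"

text \<open>A record without a tag in array 13 takes over tag and data from the right, at the
  current distance, if the keys agree. A tag of its own, in register 19, blocks the
  transfer.\<close>

definition copy_step :: "ginstr list" where
  "copy_step =
     grd always [Arith Add 11 (Reg 10) (Reg 5), Arith Sub 12 (Reg 4) (Reg 11), Load 14 10 (Reg 10),
       Load 19 13 (Reg 10)] @
     grd (pos 12) [Load 13 12 (Reg 11), Load 17 15 (Reg 11), Load 18 16 (Reg 11), RLoad 0 12 (Reg 11)] @
     equal_test 13 14 15 @
     [(pos 19, Arith Sub 15 (Imm 0) (Imm 0)),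
      (GLess (Reg 12) (Imm 1), Arith Sub 15 (Imm 0) (Imm 0))] @
     grd (pos 15) [Store 13 (Reg 10) (Reg 17), Store 14 (Reg 10) (Reg 18), RStore 11 (Reg 10) 0]"

definition copy_scan :: com where
  "copy_scan = Pass (copy_nat 10 12) ;;
     doubling (Pass (copy_nat 13 15 @ copy_nat 14 16 @ copy_real 11 12) ;; Pass copy_step)"

context pram
begin

lemma cfg_reg: "cfg u \<Longrightarrow> \<forall>k\<in>{1..<10}. r k = u k \<Longrightarrow> r 1 = n \<and> r 2 = N \<and> r 3 = h \<and> r 4 = 2 * N \<and> r 5 = u 5 \<and> r 7 = u 7"
  by (auto simp: cfg_def)

text \<open>\<open>runs_Pass\<close> with the values of the common registers filled in, ready for
  symbolic execution.\<close>

lemma runs_pass: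
  assumes u: "cfg u" and t: "t = 6 * length b + 6"
    and "\<forall>a\<in>set b. simple (snd a) \<and> dest_ok (snd a)"
    and "\<And>v w. v < 2 * N \<Longrightarrow> w < 2 * N \<Longrightarrow> v \<noteq> w \<Longrightarrow> F v \<inter> F w = {}"
    and loc: "\<And>r q. r 10 < 2 * N \<Longrightarrow> r (Suc 0) = n \<Longrightarrow> r 2 = N \<Longrightarrow> r 3 = h \<Longrightarrow> r 4 = 2 * N \<Longrightarrow>
      r 5 = u 5 \<Longrightarrow> r 7 = u 7 \<Longrightarrow>
      foot b (r, q, M, X) \<subseteq> F (r 10) \<and> safe W b (r, q, M, X) \<and> agree (F (r 10)) (lrun b (r, q, M, X)) M' X'"
    and out: "\<And>A i. \<forall>v<2*N. Cell (A, i) \<notin> F v \<Longrightarrow> M' (A, i) = M (A, i)"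
      "\<And>A i. \<forall>v<2*N. RCell (A, i) \<notin> F v \<Longrightarrow> X' (A, i) = X (A, i)"
  shows "runs N W (Pass b) (u, M, X) t (u, M', X')"
  unfolding t
proof (rule runs_Pass[where F = F])
  show "u 2 = N" "2 * N \<le> W" using u W_bound by (auto simp: cfg_def)
  fix v and r :: "nat \<Rightarrow> nat" and q :: "nat \<Rightarrow> real"
  assume v: "v < 2 * N" and r: "\<forall>k\<in>{1..<10}. r k = u k" "r 10 = v"
  show "foot b (r, q, M, X) \<subseteq> F v \<and> safe W b (r, q, M, X) \<and> agree (F v) (lrun b (r, q, M, X)) M' X'"
    using loc[of r q] cfg_reg[OF u r(1)] r v by simp
next
  show "M' x = M x" if "\<forall>v<2*N. Cell x \<notin> F v" for x using out(1) that by (cases x) auto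
  show "X' x = X x" if "\<forall>v<2*N. RCell x \<notin> F v" for x using out(2) that by (cases x) auto
qed (use assms in auto)

lemma runs_doubling:
  assumes u: "cfg u"
    and body: "\<And>s u1 M1 X1. s < lg \<Longrightarrow> cfg u1 \<Longrightarrow> u1 5 = 2 ^ s \<Longrightarrow> I s M1 X1 \<Longrightarrow>
      \<exists>M' X'. runs N W c (u1, M1, X1) t (u1, M', X') \<and> I (Suc s) M' X'"
    and init: "I 0 M X"
  obtains u' M' X' where "runs N W (doubling c) (u, M, X) (lg * (t + 3) + 3) (u', M', X')"
    "\<And>k. k \<noteq> 5 \<Longrightarrow> u' k = u k" "I lg M' X'"
proof -
  define J where "J s g \<longleftrightarrow> (case g of (u', M', X') \<Rightarrow> (\<forall>k. k \<noteq> 5 \<longrightarrow> u' k = u k) \<and> u' 5 = 2 ^ s \<and> I s M' X')" for s g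
  define u1 where "u1 = u(5 := arith_val Add (opv u (Imm 1)) (opv u (Imm 0)))"
  have 1: "runs N W (Upd Add 5 (Imm 1) (Imm 0)) (u, M, X) 1 (u1, M, X)"
    unfolding u1_def using W_bound by (intro runs_Upd) auto
  have cfgJ: "cfg u'" if "J s (u', M', X')" for s u' M' X' using that u by (auto simp: J_def cfg_def)
  have "\<exists>g'. runs N W (While (Reg 5) (Reg 4) (c ;; Upd Mul 5 (Reg 5) (Imm 2))) (u1, M, X)
      (lg * ((t + 1) + 2) + 2) g' \<and> J lg g'"
  proof (rule runs_While)
    show "J 0 (u1, M, X)" using init by (simp add: J_def u1_def)
    fix s g assume s: "s < lg" and J: "J s g"
    obtain u2 M2 X2 where g: "g = (u2, M2, X2)" by (cases g)
    have c2: "cfg u2" and u2: "u2 5 = 2 ^ s" "I s M2 X2" using J cfgJ by (auto simp: J_def g)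
    obtain M3 X3 where 3: "runs N W c (u2, M2, X2) t (u2, M3, X3)" "I (Suc s) M3 X3"
      using body[OF s c2 u2] by blast
    define u3 where "u3 = u2(5 := arith_val Mul (opv u2 (Reg 5)) (opv u2 (Imm 2)))"
    have 4: "runs N W (Upd Mul 5 (Reg 5) (Imm 2)) (u2, M3, X3) 1 (u3, M3, X3)"
      unfolding u3_def using u2 lg(2)[OF s] W_bound by (intro runs_Upd) auto
    have "J (Suc s) (u3, M3, X3)" using J 3(2) by (auto simp: J_def g u3_def)
    then show "opv (ureg g) (Reg 5) < opv (ureg g) (Reg 4) \<and>
      (\<exists>g'. runs N W (c ;; Upd Mul 5 (Reg 5) (Imm 2)) g (t + 1) g' \<and> J (Suc s) g')"
      using runs_Seq[OF 3(1) 4] c2 u2 lg(2)[OF s] by (auto simp: g cfg_def)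
  next
    fix g assume J: "J lg g"
    then show "\<not> opv (ureg g) (Reg 5) < opv (ureg g) (Reg 4)"
      using lg(1) cfgJ by (cases g) (auto simp: J_def cfg_def)
  qed simp_all
  then obtain u' M' X' where 2: "runs N W (While (Reg 5) (Reg 4) (c ;; Upd Mul 5 (Reg 5) (Imm 2))) (u1, M, X)
      (lg * ((t + 1) + 2) + 2) (u', M', X')" and J: "J lg (u', M', X')" by (metis prod_cases3)
  have "1 + (lg * ((t + 1) + 2) + 2) = lg * (t + 3) + 3" by (simp add: algebra_simps)
  then have "runs N W (doubling c) (u, M, X) (lg * (t + 3) + 3) (u', M', X')"
    using runs_Seq[OF 1 2] by (simp only: doubling_def)
  then show ?thesis using that J by (auto simp: J_def)
qed

section \<open>Prefix sums within segments of equal keys\<close>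

lemma runs_copy_key:
  assumes "cfg u"
  shows "runs N W (Pass (copy_nat 10 12)) (u, M, X) 18 (u, put 12 (2 * N) (\<lambda>i. M (10, i)) M, X)"
  by (rule runs_pass[OF assms, where F = "\<lambda>v. {Cell (10, v), Cell (12, v)}"])
    (auto simp: copy_nat_def grd_simps put_apply agree_def)

lemma runs_copy_sum:
  assumes "cfg u"
  shows "runs N W (Pass (copy_real 11 12)) (u, M, X) 18 (u, M, put 12 (2 * N) (\<lambda>i. X (11, i)) X)"
  by (rule runs_pass[OF assms, where F = "\<lambda>v. {RCell (11, v), RCell (12, v)}"])
    (auto simp: copy_real_def grd_simps put_apply agree_def)

lemma runs_sum_step:
  assumes u: "cfg u" and d: "u 5 = d"
  shows "runs N W (Pass sum_step) (u, M, X) 84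
    (u, M, put 11 (2 * N) (\<lambda>i. if d \<le> i \<and> M (12, i - d) = M (10, i) then X (11, i) + X (12, i - d) else X (11, i)) X)"
    (is "runs _ _ _ _ _ (_, ?M, ?X)")
proof -
  let ?F = "\<lambda>v. {Cell (10, v), RCell (11, v)} \<union>
      (if d \<le> v then {Cell (12, v - d), RCell (12, v - d)} else {})"
  show ?thesis
  proof (rule runs_pass[OF u, where F = ?F])
    fix r :: "nat \<Rightarrow> nat" and q :: "nat \<Rightarrow> real"
    assume r: "r 10 < 2 * N" "r 4 = 2 * N" "r 5 = u 5"
    let ?v = "r 10"
    consider "?v < d" | "d \<le> ?v" "M (12, ?v - d) = M (10, ?v)" | "d \<le> ?v" "M (12, ?v - d) < M (10, ?v)"
      | "d \<le> ?v" "M (10, ?v) < M (12, ?v - d)" by linarith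
    then show "foot sum_step (r, q, M, X) \<subseteq> ?F ?v \<and>
      safe W sum_step (r, q, M, X) \<and>
      agree (?F ?v) (lrun sum_step (r, q, M, X)) M
        ?X"
      using r d W_bound
      by cases (simp_all add: sum_step_def equal_test_def grd_simps put_apply agree_def lstep_push del: lstep.simps)
  qed (auto simp: sum_step_def equal_test_def grd_simps put_apply length_grd split: if_splits)
qed

text \<open>The window \<open>S d i\<close> contains the last \<open>d\<close> places up to
  \<open>i\<close> that belong to its segment. Sorted keys make segments contiguous, so comparing
  the keys at distance \<open>d\<close> decides whether the window extends to the left.\<close>

lemma runs_sum_scan:
  assumes u: "cfg u" and mono: "\<And>i j. i \<le> j \<Longrightarrow> j < 2 * N \<Longrightarrow> M (10, i) \<le> M (10, j)"
  obtains u' M' X' where "runs N W sum_scan (u, M, X) (lg * 105 + 21) (u', M', X')"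
    "\<And>k. k \<noteq> 5 \<Longrightarrow> u' k = u k" "same {12} M M'" "same {11, 12} X X'"
    "\<And>i. i < 2 * N \<Longrightarrow> X' (11, i) = (\<Sum>j | j \<le> i \<and> M (10, j) = M (10, i). X (11, j))"
proof -
  define S where "S d i = {j. j \<le> i \<and> i < j + d \<and> M (10, j) = M (10, i)}" for d i
  define I where "I s M' X' \<longleftrightarrow> same {12} M M' \<and> (\<forall>i<2*N. M' (12, i) = M (10, i)) \<and>
    same {11, 12} X X' \<and> (\<forall>i<2*N. X' (11, i) = (\<Sum>j\<in>S (2 ^ s) i. X (11, j)))" for s M' X'
  have fin: "finite (S d i)" for d i by (rule finite_subset[of _ "{..i}"]) (auto simp: S_def)
  have S1: "S 1 i = {i}" for i by (auto simp: S_def)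
  have double: "(\<Sum>j\<in>S (2 * d) i. X (11, j)) =
      (\<Sum>j\<in>S d i. X (11, j)) + (if d \<le> i \<and> M (10, i - d) = M (10, i) then \<Sum>j\<in>S d (i - d). X (11, j) else 0)"
    if "i < 2 * N" "0 < d" for i d
  proof (cases "d \<le> i \<and> M (10, i - d) = M (10, i)")
    case True
    have "S (2 * d) i = S d i \<union> S d (i - d)" "S d i \<inter> S d (i - d) = {}" using True by (auto simp: S_def)
    then show ?thesis using True by (simp add: sum.union_disjoint fin)
  next
    case False
    have "S (2 * d) i \<subseteq> S d i"
    proof
      fix j assume j: "j \<in> S (2 * d) i"
      show "j \<in> S d i"
      proof (rule ccontr)
        assume "j \<notin> S d i"
        then have *: "j \<le> i - d" "d \<le> i" using j by (auto simp: S_def)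
        then have "M (10, j) \<le> M (10, i - d)" "M (10, i - d) \<le> M (10, i)" using mono that by auto
        then show False using False * j by (auto simp: S_def)
      qed
    qed
    then have "S (2 * d) i = S d i" by (auto simp: S_def)
    then show ?thesis by (simp only: False if_False add_0_right)
  qed
  have 1: "runs N W (Pass (copy_nat 10 12)) (u, M, X) 18 (u, put 12 (2 * N) (\<lambda>i. M (10, i)) M, X)"
    by (rule runs_copy_key[OF u])
  have init: "I 0 (put 12 (2 * N) (\<lambda>i. M (10, i)) M) X"
    using S1 by (auto simp: I_def put_apply intro!: same_put same_refl)
  have body: "\<exists>M' X'. runs N W (Pass (copy_real 11 12) ;; Pass sum_step) (u1, M1, X1) 102 (u1, M', X') \<and> I (Suc s) M' X'"
    if "s < lg" "cfg u1" "u1 5 = 2 ^ s" "I s M1 X1" for s u1 M1 X1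
  proof -
    let ?X2 = "put 12 (2 * N) (\<lambda>i. X1 (11, i)) X1"
    let ?X3 = "put 11 (2 * N) (\<lambda>i. if 2 ^ s \<le> i \<and> M1 (12, i - 2 ^ s) = M1 (10, i)
      then ?X2 (11, i) + ?X2 (12, i - 2 ^ s) else ?X2 (11, i)) ?X2"
    have "runs N W (Pass (copy_real 11 12) ;; Pass sum_step) (u1, M1, X1) (18 + 84) (u1, M1, ?X3)"
      by (rule runs_Seq[OF runs_copy_sum[OF that(2)] runs_sum_step[OF that(2,3)]])
    moreover have "I (Suc s) M1 ?X3"
    proof -
      have M1: "M1 (10, i) = M (10, i)" for i using that(4) by (auto simp: I_def same_def)
      have "?X3 (11, i) = (\<Sum>j\<in>S (2 * 2 ^ s) i. X (11, j))" if i: "i < 2 * N" for i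
        unfolding double[OF i zero_less_power[OF zero_less_numeral]] using \<open>I s M1 X1\<close> i less_imp_diff_less[OF i, of "2 ^ s"] by (simp add: put_apply I_def M1)
      then show ?thesis using that(4) by (auto simp: I_def intro!: same_put)
    qed
    ultimately show ?thesis by auto
  qed
  obtain u' M' X' where 2: "runs N W (doubling (Pass (copy_real 11 12) ;; Pass sum_step))
      (u, put 12 (2 * N) (\<lambda>i. M (10, i)) M, X) (lg * (102 + 3) + 3) (u', M', X')"
    "\<And>k. k \<noteq> 5 \<Longrightarrow> u' k = u k" "I lg M' X'"
    using runs_doubling[where I = I, OF u body init] by blast
  show ?thesis
  proof (rule that[of u' M' X'])
    show "runs N W sum_scan (u, M, X) (lg * 105 + 21) (u', M', X')"
      using runs_Seq[OF 1 2(1)] by (simp add: sum_scan_def add.commute)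
    show "u' k = u k" if "k \<noteq> 5" for k using 2(2) that by simp
    show "same {12} M M'" "same {11, 12} X X'" using 2(3) by (auto simp: I_def)
    fix i assume i: "i < 2 * N"
    have "S (2 ^ lg) i = {j. j \<le> i \<and> M (10, j) = M (10, i)}" using i lg(1) by (auto simp: S_def)
    then show "X' (11, i) = (\<Sum>j | j \<le> i \<and> M (10, j) = M (10, i). X (11, j))"
      using 2(3) i by (auto simp: I_def)
  qed
qed

section \<open>The nearest tagged record to the right\<close>

lemma runs_copy_data:
  assumes "cfg u"
  shows "runs N W (Pass (copy_nat 13 15 @ copy_nat 14 16 @ copy_real 11 12)) (u, M, X) 42
    (u, put 15 (2 * N) (\<lambda>i. M (13, i)) (put 16 (2 * N) (\<lambda>i. M (14, i)) M), put 12 (2 * N) (\<lambda>i. X (11, i)) X)"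
  by (rule runs_pass[OF assms, where F = "\<lambda>v. {Cell (13, v), Cell (14, v), Cell (15, v), Cell (16, v), RCell (11, v), RCell (12, v)}"])
    (auto simp: copy_real_def copy_nat_def grd_simps put_apply agree_def)

lemma runs_copy_step:
  fixes M :: "nat \<times> nat \<Rightarrow> nat" and X :: "nat \<times> nat \<Rightarrow> real"
  assumes u: "cfg u" and d: "u 5 = d" "d < 2 * N"
  defines "C \<equiv> \<lambda>i. i + d < 2 * N \<and> M (12, i + d) = M (10, i) \<and> M (13, i) = 0"
  shows "runs N W (Pass copy_step) (u, M, X) 102
    (u, put 13 (2 * N) (\<lambda>i. if C i then M (15, i + d) else M (13, i))
         (put 14 (2 * N) (\<lambda>i. if C i then M (16, i + d) else M (14, i)) M),
     put 11 (2 * N) (\<lambda>i. if C i then X (12, i + d) else X (11, i)) X)"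
    (is "runs _ _ _ _ _ (_, ?M, ?X)")
proof -
  let ?F = "\<lambda>v. {Cell (10, v), Cell (13, v), Cell (14, v), RCell (11, v)} \<union>
      (if v + d < 2 * N then {Cell (12, v + d), Cell (15, v + d), Cell (16, v + d), RCell (12, v + d)} else {})"
  show ?thesis
  proof (rule runs_pass[OF u, where F = ?F])
    fix r :: "nat \<Rightarrow> nat" and q :: "nat \<Rightarrow> real"
    assume r: "r 10 < 2 * N" "r 4 = 2 * N" "r 5 = u 5"
    let ?v = "r 10"
    consider "2 * N \<le> ?v + d" | "?v + d < 2 * N" "M (12, ?v + d) = M (10, ?v)" "M (13, ?v) = 0"
      | "?v + d < 2 * N" "M (12, ?v + d) = M (10, ?v)" "0 < M (13, ?v)"
      | "?v + d < 2 * N" "M (12, ?v + d) < M (10, ?v)"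
      | "?v + d < 2 * N" "M (10, ?v) < M (12, ?v + d)" by linarith
    then show "foot copy_step (r, q, M, X) \<subseteq> ?F ?v \<and>
      safe W copy_step (r, q, M, X) \<and>
      agree (?F ?v) (lrun copy_step (r, q, M, X)) ?M ?X"
      using r d W_bound unfolding C_def
      by cases (simp_all add: copy_step_def equal_test_def grd_simps put_apply agree_def lstep_push del: lstep.simps)
  qed (auto simp: copy_step_def equal_test_def grd_simps put_apply length_grd split: if_splits)
qed

text \<open>\<open>nz d i j\<close> says that \<open>j\<close> is the first tagged record among the
  \<open>d\<close> places from \<open>i\<close> on, within the segment. A record that has found none
  takes the result of the record at distance \<open>d\<close>, whose window adjoins its own; tag 0
  means that nothing has been found.\<close>

lemma runs_copy_scan:
  assumes u: "cfg u" and mono: "\<And>i j. i \<le> j \<Longrightarrow> j < 2 * N \<Longrightarrow> M (10, i) \<le> M (10, j)"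
  obtains u' M' X' where "runs N W copy_scan (u, M, X) (lg * 147 + 21) (u', M', X')"
    "\<And>k. k \<noteq> 5 \<Longrightarrow> u' k = u k" "same {12, 13, 14, 15, 16} M M'" "same {11, 12} X X'"
    "\<And>i j. i \<le> j \<Longrightarrow> j < 2 * N \<Longrightarrow> M (10, j) = M (10, i) \<Longrightarrow> M (13, j) \<noteq> 0 \<Longrightarrow>
       (\<forall>k. i \<le> k \<and> k < j \<longrightarrow> M (13, k) = 0) \<Longrightarrow>
       M' (13, i) = M (13, j) \<and> M' (14, i) = M (14, j) \<and> X' (11, i) = X (11, j)"
    "\<And>i. i < 2 * N \<Longrightarrow> (\<forall>j. i \<le> j \<and> j < 2 * N \<and> M (10, j) = M (10, i) \<longrightarrow> M (13, j) = 0) \<Longrightarrow> M' (13, i) = 0"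
proof -
  define nz where "nz d i j \<longleftrightarrow> i \<le> j \<and> j < 2 * N \<and> j < i + d \<and> M (10, j) = M (10, i) \<and> M (13, j) \<noteq> 0 \<and>
    (\<forall>k. i \<le> k \<and> k < j \<longrightarrow> M (13, k) = 0)" for d i j
  define I where "I s M' X' \<longleftrightarrow> same {12, 13, 14, 15, 16} M M' \<and> (\<forall>i<2*N. M' (12, i) = M (10, i)) \<and>
    same {11, 12} X X' \<and>
    (\<forall>i<2*N. \<forall>j. nz (2 ^ s) i j \<longrightarrow> M' (13, i) = M (13, j) \<and> M' (14, i) = M (14, j) \<and> X' (11, i) = X (11, j)) \<and>
    (\<forall>i<2*N. (\<forall>j. \<not> nz (2 ^ s) i j) \<longrightarrow> M' (13, i) = 0)" for s and M' :: "nat \<times> nat \<Rightarrow> nat" and X' :: "nat \<times> nat \<Rightarrow> real"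
  have first: "\<exists>j. nz d i j" if "i \<le> l" "l < 2 * N" "l < i + d" "M (10, l) = M (10, i)" "M (13, l) \<noteq> 0" for d i l
  proof -
    define j where "j = (LEAST j. i \<le> j \<and> M (13, j) \<noteq> 0)"
    have j: "i \<le> j" "M (13, j) \<noteq> 0"
      using LeastI[of "\<lambda>j. i \<le> j \<and> M (13, j) \<noteq> 0" l] that by (auto simp: j_def)
    have "j \<le> l" unfolding j_def by (rule Least_le) (use that in auto)
    moreover have "M (13, k) = 0" if "i \<le> k" "k < j" for k
      using not_less_Least[of k "\<lambda>j. i \<le> j \<and> M (13, j) \<noteq> 0"] that by (auto simp: j_def)
    moreover have "M (10, j) = M (10, i)"
      using mono[of i j] mono[of j l] j that \<open>j \<le> l\<close> by simp
    ultimately show ?thesis using j that unfolding nz_def by (intro exI[of _ j]) auto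
  qed
  have 1: "runs N W (Pass (copy_nat 10 12)) (u, M, X) 18 (u, put 12 (2 * N) (\<lambda>i. M (10, i)) M, X)"
    by (rule runs_copy_key[OF u])
  have init: "I 0 (put 12 (2 * N) (\<lambda>i. M (10, i)) M) X"
  proof -
    have "j = i" if "nz 1 i j" for i j using that by (auto simp: nz_def)
    moreover have "nz 1 i i" if "i < 2 * N" "M (13, i) \<noteq> 0" for i using that by (auto simp: nz_def)
    ultimately show ?thesis by (fastforce simp: I_def put_apply intro!: same_put same_refl)
  qed
  have body: "\<exists>M' X'. runs N W (Pass (copy_nat 13 15 @ copy_nat 14 16 @ copy_real 11 12) ;; Pass copy_step)
      (u1, M1, X1) 144 (u1, M', X') \<and> I (Suc s) M' X'"
    if s: "s < lg" and u1: "cfg u1" "u1 5 = 2 ^ s" and I: "I s M1 X1" for s u1 M1 X1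
  proof -
    define d :: nat where "d = 2 ^ s"
    have d: "u1 5 = d" "d < 2 * N" "0 < d" using u1 lg(2)[OF s] by (auto simp: d_def)
    define M2 where "M2 = put 15 (2 * N) (\<lambda>i. M1 (13, i)) (put 16 (2 * N) (\<lambda>i. M1 (14, i)) M1)"
    define X2 where "X2 = put 12 (2 * N) (\<lambda>i. X1 (11, i)) X1"
    define C where "C i \<longleftrightarrow> i + d < 2 * N \<and> M2 (12, i + d) = M2 (10, i) \<and> M2 (13, i) = 0" for i
    define M3 where "M3 = put 13 (2 * N) (\<lambda>i. if C i then M2 (15, i + d) else M2 (13, i))
         (put 14 (2 * N) (\<lambda>i. if C i then M2 (16, i + d) else M2 (14, i)) M2)"
    define X3 where "X3 = put 11 (2 * N) (\<lambda>i. if C i then X2 (12, i + d) else X2 (11, i)) X2"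
    have "runs N W (Pass (copy_nat 13 15 @ copy_nat 14 16 @ copy_real 11 12) ;; Pass copy_step)
      (u1, M1, X1) (42 + 102) (u1, M3, X3)"
    proof (rule runs_Seq)
      show "runs N W (Pass (copy_nat 13 15 @ copy_nat 14 16 @ copy_real 11 12)) (u1, M1, X1) 42 (u1, M2, X2)"
        unfolding M2_def X2_def by (rule runs_copy_data[OF u1(1)])
      show "runs N W (Pass copy_step) (u1, M2, X2) 102 (u1, M3, X3)"
        unfolding M3_def X3_def C_def by (rule runs_copy_step[OF u1(1) d(1,2)])
    qed
    moreover have "I (Suc s) M3 X3"
    proof -
      have sm: "same {12, 13, 14, 15, 16} M M1" and k12: "\<And>i. i < 2 * N \<Longrightarrow> M1 (12, i) = M (10, i)"
        and sx: "same {11, 12} X X1"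
        and old: "\<And>i j. i < 2 * N \<Longrightarrow> nz d i j \<Longrightarrow> M1 (13, i) = M (13, j) \<and> M1 (14, i) = M (14, j) \<and> X1 (11, i) = X (11, j)"
        and none: "\<And>i. i < 2 * N \<Longrightarrow> (\<forall>j. \<not> nz d i j) \<Longrightarrow> M1 (13, i) = 0"
        using I by (auto simp: I_def d_def)
      have M10: "M1 (10, i) = M (10, i)" for i using sm by (simp add: same_def)
      have C: "C i \<longleftrightarrow> i + d < 2 * N \<and> M (10, i + d) = M (10, i) \<and> M1 (13, i) = 0" if "i < 2 * N" for i
        using that k12[of "i + d"] by (auto simp: C_def M2_def put_apply M10)
      have new: "M3 (13, i) = (if C i then M1 (13, i + d) else M1 (13, i))"
        "M3 (14, i) = (if C i then M1 (14, i + d) else M1 (14, i))"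
        "X3 (11, i) = (if C i then X1 (11, i + d) else X1 (11, i))" if "i < 2 * N" for i
        using that by (auto simp: M3_def X3_def M2_def X2_def put_apply C_def)
      have "M3 (13, i) = M (13, j) \<and> M3 (14, i) = M (14, j) \<and> X3 (11, i) = X (11, j)"
        if i: "i < 2 * N" and j: "nz (2 * d) i j" for i j
      proof (cases "j < i + d")
        case True
        then have "nz d i j" using j by (auto simp: nz_def)
        then have "M1 (13, i) \<noteq> 0" using old[OF i] j by (auto simp: nz_def)
        then have "\<not> C i" using C[OF i] by simp
        then show ?thesis using new[OF i] old[OF i \<open>nz d i j\<close>] by simp
      next
        case False
        have "\<not> nz d i k" for k
        proof
          assume k: "nz d i k"
          then have "i \<le> k" "k < j" "M (13, k) \<noteq> 0" using False by (auto simp: nz_def)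
          then show False using j by (auto simp: nz_def)
        qed
        then have z: "M1 (13, i) = 0" using none[OF i] by blast
        have id: "i + d < 2 * N" using j False by (auto simp: nz_def)
        have "M (10, i + d) = M (10, i)"
          using mono[of i "i + d"] mono[of "i + d" j] j False id by (auto simp: nz_def)
        then have c: "C i" using C[OF i] z id by simp
        have "nz d (i + d) j" using j False \<open>M (10, i + d) = M (10, i)\<close> by (auto simp: nz_def)
        then show ?thesis using new[OF i] c old[OF id] by simp
      qed
      moreover have "M3 (13, i) = 0" if i: "i < 2 * N" and no: "\<forall>j. \<not> nz (2 * d) i j" for i
      proof -
        have "\<not> nz d i j" for j using no[rule_format, of j] by (auto simp: nz_def)
        then have z: "M1 (13, i) = 0" using none[OF i] by blast
        show ?thesis
        proof (cases "C i")
          case False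
          then show ?thesis using new[OF i] z by simp
        next
          case True
          then have id: "i + d < 2 * N" "M (10, i + d) = M (10, i)" using C[OF i] by auto
          have "\<not> nz d (i + d) j" for j
          proof
            assume "nz d (i + d) j"
            then have "\<exists>j. nz (2 * d) i j" using id by (intro first[of i j]) (auto simp: nz_def)
            then show False using no by blast
          qed
          then have "M1 (13, i + d) = 0" using none[OF id(1)] by blast
          then show ?thesis using new[OF i] True by simp
        qed
      qed
      moreover have "same {12, 13, 14, 15, 16} M M3" using sm by (auto simp: M3_def M2_def intro!: same_put)
      moreover have "same {11, 12} X X3" using sx by (auto simp: X3_def X2_def intro!: same_put)
      moreover have "M3 (12, i) = M (10, i)" if "i < 2 * N" for i
        using k12[OF that] by (simp add: M3_def M2_def put_apply)
      ultimately show ?thesis by (auto simp: I_def d_def)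
    qed
    ultimately show ?thesis by auto
  qed
  obtain u' M' X' where 2: "runs N W (doubling (Pass (copy_nat 13 15 @ copy_nat 14 16 @ copy_real 11 12) ;; Pass copy_step))
      (u, put 12 (2 * N) (\<lambda>i. M (10, i)) M, X) (lg * (144 + 3) + 3) (u', M', X')"
    "\<And>k. k \<noteq> 5 \<Longrightarrow> u' k = u k" "I lg M' X'"
    using runs_doubling[where I = I, OF u body init] by blast
  show ?thesis
  proof (rule that[of u' M' X'])
    show "runs N W copy_scan (u, M, X) (lg * 147 + 21) (u', M', X')"
      using runs_Seq[OF 1 2(1)] by (simp add: copy_scan_def add.commute)
    show "u' k = u k" if "k \<noteq> 5" for k using 2(2) that by simp
    show "same {12, 13, 14, 15, 16} M M'" "same {11, 12} X X'" using 2(3) by (auto simp: I_def)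
    fix i j assume "i \<le> j" "j < 2 * N" "M (10, j) = M (10, i)" "M (13, j) \<noteq> 0"
       "\<forall>k. i \<le> k \<and> k < j \<longrightarrow> M (13, k) = 0"
    then have "nz (2 ^ lg) i j" "i < 2 * N" using lg(1) by (auto simp: nz_def)
    then show "M' (13, i) = M (13, j) \<and> M' (14, i) = M (14, j) \<and> X' (11, i) = X (11, j)"
      using 2(3) by (auto simp: I_def)
  next
    fix i assume i: "i < 2 * N" "\<forall>j. i \<le> j \<and> j < 2 * N \<and> M (10, j) = M (10, i) \<longrightarrow> M (13, j) = 0"
    then have "\<forall>j. \<not> nz (2 ^ lg) i j" by (auto simp: nz_def)
    then show "M' (13, i) = 0" using 2(3) i by (auto simp: I_def)
  qed
qed

end

section \<open>Advancing all points by one arc\<close>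

text \<open>Surplus records get the key \<open>n\<close>, which is no vertex, and end up behind all
  arcs. Equal real keys leave the arcs of a vertex in the order of their numbers. Subtracting a
  register from itself provides the real 0.\<close>

definition init_ends :: "nat \<Rightarrow> ginstr list" where
  "init_ends K = grd always [Arith Sub 11 (Reg 1) (Imm 0)] @ grd (GLess (Reg 10) (Reg 2)) [Load 11 K (Reg 10)] @
     grd always [Store 10 (Reg 10) (Reg 11), RSub 0 0 0, RStore 10 (Reg 10) 0, Store 11 (Reg 10) (Reg 10)]"

definition gather_ends :: "ginstr list" where
  "gather_ends = grd always [Load 11 11 (Reg 10), RSub 0 0 0] @ grd (GLess (Reg 11) (Reg 2)) [RLoad 0 0 (Reg 11)] @
     grd always [RStore 11 (Reg 10) 0]"

definition scatter_ends :: "nat \<Rightarrow> ginstr list" where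
  "scatter_ends D = grd always [Load 11 11 (Reg 10), RLoad 0 11 (Reg 10)] @
     grd (GLess (Reg 11) (Reg 2)) [RStore D (Reg 11) 0]"

definition ends_code :: "nat \<Rightarrow> nat \<Rightarrow> com" where
  "ends_code K D = Pass (init_ends K) ;; sort_code ;; Pass gather_ends ;; sum_scan ;; Pass (scatter_ends D)"

text \<open>Records below \<open>N\<close> are points, the others arcs, keyed by the ends of their
  intervals. The guard with register 13 expresses a weak inequality by a strict one.\<close>

definition init_adv :: "nat \<Rightarrow> nat \<Rightarrow> ginstr list" where
  "init_adv K E = grd always [Arith Sub 12 (Reg 10) (Reg 2), Arith Add 13 (Reg 10) (Imm 1)] @
     grd (GLess (Reg 10) (Reg 2)) [Load 11 17 (Reg 10), RLoad 0 15 (Reg 10)] @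
     grd (GLess (Reg 2) (Reg 13)) [Load 11 K (Reg 12), RLoad 0 E (Reg 12)] @
     grd always [Store 10 (Reg 10) (Reg 11), RStore 10 (Reg 10) 0, Store 11 (Reg 10) (Reg 10)]"

text \<open>An arc record carries its number plus one, which keeps it apart from the tag 0 of
  points, the vertex at its other end, and the translation between its two intervals.\<close>

definition gather_adv :: "nat \<Rightarrow> nat \<Rightarrow> nat \<Rightarrow> ginstr list" where
  "gather_adv E K' E' = grd always [Load 11 11 (Reg 10), Arith Sub 12 (Reg 11) (Reg 2), Arith Add 13 (Reg 11) (Imm 1),
       Arith Sub 14 (Imm 0) (Imm 0), Arith Sub 15 (Imm 0) (Imm 0), RSub 0 0 0] @
     grd (GLess (Reg 2) (Reg 13)) [Arith Add 14 (Reg 12) (Imm 1), Load 15 K' (Reg 12), RLoad 0 E' (Reg 12),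
       RLoad 1 E (Reg 12), RSub 0 0 1] @
     grd always [Store 13 (Reg 10) (Reg 14), Store 14 (Reg 10) (Reg 15), RStore 11 (Reg 10) 0]"

definition scatter_adv :: "ginstr list" where
  "scatter_adv = grd always [Load 11 11 (Reg 10), Load 12 13 (Reg 10), Load 13 14 (Reg 10), RLoad 0 11 (Reg 10),
       Arith Add 15 (Reg 11) (Imm 1), Arith Sub 14 (Reg 12) (Imm 0)] @
     grd (GLess (Reg 11) (Reg 2)) [Store 18 (Reg 11) (Reg 12)] @
     grd (GLess (Reg 2) (Reg 15)) [Arith Sub 14 (Imm 0) (Imm 0)] @
     grd (pos 14) [Store 17 (Reg 11) (Reg 13), RLoad 1 15 (Reg 11), RAdd 1 1 0, RStore 15 (Reg 11) 1]"

definition adv_code :: "nat \<Rightarrow> nat \<Rightarrow> nat \<Rightarrow> nat \<Rightarrow> com" where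
  "adv_code K E K' E' = Pass (init_adv K E) ;; sort_code ;; Pass (gather_adv E K' E') ;; copy_scan ;; Pass scatter_adv"

context pram
begin

definition perm :: "(nat \<times> nat \<Rightarrow> nat) \<Rightarrow> bool" where
  "perm M \<longleftrightarrow> bij_betw (\<lambda>i. M (11, i)) {..<2 * N} {..<2 * N}"

definition place :: "(nat \<times> nat \<Rightarrow> nat) \<Rightarrow> nat \<Rightarrow> nat" where
  "place M a = inv_into {..<2 * N} (\<lambda>i. M (11, i)) a"

lemma place:
  assumes "perm M"
  shows "a < 2 * N \<Longrightarrow> place M a < 2 * N" "a < 2 * N \<Longrightarrow> M (11, place M a) = a"
    "i < 2 * N \<Longrightarrow> place M (M (11, i)) = i" "i < 2 * N \<Longrightarrow> M (11, i) < 2 * N"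
    "i < 2 * N \<Longrightarrow> j < 2 * N \<Longrightarrow> M (11, i) = M (11, j) \<Longrightarrow> i = j"
proof -
  have b: "bij_betw (\<lambda>i. M (11, i)) {..<2 * N} {..<2 * N}" using assms by (simp add: perm_def)
  show "a < 2 * N \<Longrightarrow> place M a < 2 * N"
    using bij_betw_imp_surj_on[OF b] inv_into_into[of a "\<lambda>i. M (11, i)" "{..<2 * N}"] by (simp add: place_def)
  show "a < 2 * N \<Longrightarrow> M (11, place M a) = a"
    using bij_betw_inv_into_right[OF b] by (simp add: place_def)
  show "i < 2 * N \<Longrightarrow> place M (M (11, i)) = i"
    using bij_betw_inv_into_left[OF b] by (simp add: place_def)
  show "i < 2 * N \<Longrightarrow> M (11, i) < 2 * N" using bij_betwE[OF b] by simp
  show "i < 2 * N \<Longrightarrow> j < 2 * N \<Longrightarrow> M (11, i) = M (11, j) \<Longrightarrow> i = j"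
    using bij_betw_imp_inj_on[OF b] by (auto dest: inj_onD)
qed

section \<open>The passes before and after a sort\<close>

lemma runs_init_ends:
  assumes "cfg u" "K < 10"
  shows "runs N W (Pass (init_ends K)) (u, M, X) 42
    (u, put 10 (2 * N) (\<lambda>i. if i < N then M (K, i) else n) (put 11 (2 * N) (\<lambda>i. i) M), put 10 (2 * N) (\<lambda>i. 0) X)"
    (is "runs _ _ _ _ _ (_, ?M, ?X)")
proof -
  let ?F = "\<lambda>v. {Cell (10, v), Cell (11, v), RCell (10, v), Cell (K, v)}"
  show ?thesis
  proof (rule runs_pass[OF assms(1), where F = ?F])
    fix A i assume "\<forall>v<2 * N. Cell (A, i) \<notin> ?F v"
    then show "?M (A, i) = M (A, i)"
      by (cases "i < 2 * N") (auto simp: put_apply)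
  qed (use assms(2) in \<open>auto simp: init_ends_def grd_simps put_apply agree_def length_grd\<close>)
qed

text \<open>The indirect reads are exclusive because array 11 is a permutation.\<close>

lemma runs_gather_ends:
  assumes "cfg u" "perm M"
  shows "runs N W (Pass gather_ends) (u, M, X) 30
    (u, M, put 11 (2 * N) (\<lambda>i. if M (11, i) < N then X (0, M (11, i)) else 0) X)"
  by (rule runs_pass[OF assms(1), where F = "\<lambda>v. {Cell (11, v), RCell (11, v), RCell (0, M (11, v))}"])
    (use place(5)[OF assms(2)] in \<open>auto simp: gather_ends_def grd_simps put_apply agree_def length_grd\<close>)

lemma runs_scatter_ends:
  assumes "cfg u" "perm M" "D \<noteq> 11"
  shows "runs N W (Pass (scatter_ends D)) (u, M, X) 24 (u, M, put D N (\<lambda>a. X (11, place M a)) X)"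
proof (rule runs_pass[OF assms(1), where F = "\<lambda>v. {Cell (11, v), RCell (11, v), RCell (D, M (11, v))}"])
  fix A i assume "\<forall>v<2 * N. RCell (A, i) \<notin> {Cell (11, v), RCell (11, v), RCell (D, M (11, v))}"
  then show "put D N (\<lambda>a. X (11, place M a)) X (A, i) = X (A, i)"
    using place(1,2)[OF assms(2), of i] by (force simp: put_apply)
qed (use place(3,5)[OF assms(2)] assms(3) in \<open>auto simp: scatter_ends_def grd_simps put_apply agree_def length_grd\<close>)

lemma sorted_keys:
  assumes "\<And>i j. i < j \<Longrightarrow> j < 2 * N \<Longrightarrow> keys M X i < keys M X j"
  shows "i \<le> j \<Longrightarrow> j < 2 * N \<Longrightarrow> M (10, i) \<le> M (10, j)"
    "i \<le> j \<Longrightarrow> j < 2 * N \<Longrightarrow> M (10, i) = M (10, j) \<Longrightarrow> X (10, i) \<le> X (10, j)"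
    "i < j \<Longrightarrow> j < 2 * N \<Longrightarrow> M (10, i) = M (10, j) \<Longrightarrow> X (10, i) = X (10, j) \<Longrightarrow> M (11, i) < M (11, j)"
  using assms[of i j] by (cases "i = j"; fastforce simp: keys_def less_prod_simp)+

definition tscan :: nat where "tscan = lg * 147 + 21"

text \<open>In sorted order the arcs of a vertex form a segment ordered by number, so a prefix sum
  within it is exactly \<open>ends\<close>. The cost of the summing scan is bounded by
  \<open>tscan\<close>, the cost of the more expensive copying scan.\<close>

lemma runs_ends:
  assumes u: "cfg u" and K: "K < 10" and D: "D > 12" and keys: "\<forall>a<N. M (K, a) < n"
  obtains u' M' X' where "runs N W (ends_code K D) (u, M, X) (tsort + tscan + 96) (u', M', X')"
    "\<And>k. k \<noteq> 5 \<Longrightarrow> k \<noteq> 6 \<Longrightarrow> u' k = u k" "same {10, 11, 12} M M'" "same {10, 11, 12, D} X X'"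
    "\<And>a. a < N \<Longrightarrow> X' (D, a) = ends (\<lambda>a. M (K, a)) (\<lambda>a. X (0, a)) a"
proof -
  note key = keys[rule_format]
  define M1 where "M1 = put 10 (2 * N) (\<lambda>i. if i < N then M (K, i) else n) (put 11 (2 * N) (\<lambda>i. i) M)"
  define X1 where "X1 = put 10 (2 * N) (\<lambda>i. 0) X"
  have 1: "runs N W (Pass (init_ends K)) (u, M, X) 42 (u, M1, X1)"
    unfolding M1_def X1_def by (rule runs_init_ends[OF u K])
  have "M1 (11, i) = i" if "i < 2 * N" for i using that by (simp add: M1_def put_apply)
  from runs_sort[OF u this] obtain u2 M2 X2 where
    2: "runs N W sort_code (u, M1, X1) tsort (u2, M2, X2)"
    and u2: "\<And>k. k \<noteq> 5 \<Longrightarrow> k \<noteq> 6 \<Longrightarrow> u2 k = u k" and same2: "same {10, 11} M1 M2" "same {10} X1 X2"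
    and p2: "perm M2" and key2: "\<And>i. i < 2 * N \<Longrightarrow> M2 (10, i) = M1 (10, M2 (11, i))"
      "\<And>i. i < 2 * N \<Longrightarrow> X2 (10, i) = X1 (10, M2 (11, i))"
    and sorted: "\<And>i j. i < j \<Longrightarrow> j < 2 * N \<Longrightarrow> keys M2 X2 i < keys M2 X2 j"
    unfolding perm_def by blast
  have cfg2: "cfg u2" using u u2 by (simp add: cfg_def)
  define X3 where "X3 = put 11 (2 * N) (\<lambda>i. if M2 (11, i) < N then X2 (0, M2 (11, i)) else 0) X2"
  have 3: "runs N W (Pass gather_ends) (u2, M2, X2) 30 (u2, M2, X3)"
    unfolding X3_def by (rule runs_gather_ends[OF cfg2 p2])
  obtain u4 M4 X4 where
    4: "runs N W sum_scan (u2, M2, X3) (lg * 105 + 21) (u4, M4, X4)" "\<And>k. k \<noteq> 5 \<Longrightarrow> u4 k = u2 k"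
      "same {12} M2 M4" "same {11, 12} X3 X4"
    and sum: "\<And>i. i < 2 * N \<Longrightarrow> X4 (11, i) = (\<Sum>j | j \<le> i \<and> M2 (10, j) = M2 (10, i). X3 (11, j))"
    using runs_sum_scan[where M = M2 and X = X3, OF cfg2 sorted_keys(1)[OF sorted]] by blast
  have cfg4: "cfg u4" using cfg2 4(2) by (simp add: cfg_def)
  have M4: "M4 (11, i) = M2 (11, i)" for i using 4(3) by (simp add: same_def)
  then have p4: "perm M4" and pl4: "place M4 a = place M2 a" for a using p2 by (simp_all add: perm_def place_def)
  define X5 where "X5 = put D N (\<lambda>a. X4 (11, place M4 a)) X4"
  have 5: "runs N W (Pass (scatter_ends D)) (u4, M4, X4) 24 (u4, M4, X5)"
    unfolding X5_def using D by (intro runs_scatter_ends[OF cfg4 p4]) simp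
  note pl = place[OF p2]
  have val: "X4 (11, place M2 a) = ends (\<lambda>a. M (K, a)) (\<lambda>a. X (0, a)) a" if a: "a < N" for a
  proof -
    define i where "i = place M2 a"
    have i: "i < 2 * N" "M2 (11, i) = a" using pl(1,2) a by (auto simp: i_def)
    let ?A = "{j. j \<le> i \<and> M2 (10, j) = M2 (10, i)}"
    have Mi: "M2 (10, j) = (if M2 (11, j) < N then M (K, M2 (11, j)) else n)" if "j < 2 * N" for j
      using key2(1)[OF that] pl(4)[OF that] by (simp add: M1_def put_apply)
    have Xi: "X2 (10, j) = 0" if "j < 2 * N" for j
      using key2(2)[OF that] pl(4)[OF that] by (simp add: X1_def put_apply)
    \<comment> \<open>Places up to that of \<open>a\<close> in its segment correspond to arcs with
      the same key and at most its number; surplus records are kept out by their key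
      \<open>n\<close>.\<close>
    have "bij_betw (\<lambda>j. M2 (11, j)) ?A {b. b \<le> a \<and> M (K, b) = M (K, a)}"
    proof (rule bij_betwI[where g = "place M2"])
      show "(\<lambda>j. M2 (11, j)) \<in> ?A \<rightarrow> {b. b \<le> a \<and> M (K, b) = M (K, a)}"
      proof
        fix j assume j: "j \<in> ?A"
        then have j2: "j < 2 * N" using i by simp
        have "M2 (11, j) < N \<and> M (K, M2 (11, j)) = M (K, a)"
          using j Mi[OF j2] Mi[OF i(1)] i(2) a key[OF a] by (auto split: if_splits)
        moreover have "M2 (11, j) \<le> a"
          using sorted_keys(3)[OF sorted, of j i] j i Xi j2 by (cases "j = i") auto
        ultimately show "M2 (11, j) \<in> {b. b \<le> a \<and> M (K, b) = M (K, a)}" by simp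
      qed
      show "place M2 \<in> {b. b \<le> a \<and> M (K, b) = M (K, a)} \<rightarrow> ?A"
      proof
        fix b assume b: "b \<in> {b. b \<le> a \<and> M (K, b) = M (K, a)}"
        then have b2: "b < N" "b < 2 * N" using a by auto
        have eq: "M2 (10, place M2 b) = M2 (10, i)"
          using Mi[OF pl(1)[OF b2(2)]] Mi[OF i(1)] pl(2)[OF b2(2)] i(2) a b b2 by simp
        have "\<not> i < place M2 b"
        proof
          assume "i < place M2 b"
          from sorted_keys(3)[OF sorted this pl(1)[OF b2(2)]] have "a < b"
            using eq Xi i pl(1,2)[OF b2(2)] by simp
          then show False using b by simp
        qed
        then show "place M2 b \<in> ?A" using eq by simp
      qed
      show "place M2 (M2 (11, j)) = j" if "j \<in> ?A" for j using that pl(3)[of j] i by simp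
      show "M2 (11, place M2 b) = b" if "b \<in> {b. b \<le> a \<and> M (K, b) = M (K, a)}" for b
        using that pl(2)[of b] a by simp
    qed
    then have "(\<Sum>j\<in>?A. X (0, M2 (11, j))) = ends (\<lambda>a. M (K, a)) (\<lambda>a. X (0, a)) a"
      unfolding ends_def by (rule sum.reindex_bij_betw)
    moreover have "X3 (11, j) = X (0, M2 (11, j))" if j: "j \<in> ?A" for j
    proof -
      have j2: "j < 2 * N" using j i by simp
      have "M2 (11, j) < N" using j Mi[OF j2] Mi[OF i(1)] i(2) a key[OF a] by (auto split: if_splits)
      then show ?thesis using j2 same_at[OF same2(2), of 0] by (simp add: X3_def put_apply X1_def)
    qed
    ultimately show ?thesis using sum[OF i(1)] by (simp add: i_def)
  qed
  show ?thesis
  proof (rule that[of u4 M4 X5])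
    have "42 + (tsort + (30 + ((lg * 105 + 21) + 24))) \<le> tsort + tscan + 96" by (simp add: tscan_def)
    then show "runs N W (ends_code K D) (u, M, X) (tsort + tscan + 96) (u4, M4, X5)"
      unfolding ends_code_def by (rule runs_mono[OF runs_Seq[OF 1 runs_Seq[OF 2 runs_Seq[OF 3 runs_Seq[OF 4(1) 5]]]]])
    show "u4 k = u k" if "k \<noteq> 5" "k \<noteq> 6" for k using that u2 4(2) by simp
    have "same {10, 11} M M1" by (auto simp: M1_def intro!: same_put same_refl)
    then show "same {10, 11, 12} M M4" using same2(1) 4(3) by (simp add: same_def)
    show "same {10, 11, 12, D} X X5"
      using same2(2) 4(4) by (auto simp: same_def X1_def X3_def X5_def put_apply)
    show "X5 (D, a) = ends (\<lambda>a. M (K, a)) (\<lambda>a. X (0, a)) a" if "a < N" for a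
      using val[OF that] that by (simp add: X5_def put_apply pl4)
  qed
qed

lemma runs_init_adv:
  assumes "cfg u" "K < 10" "E = 13 \<or> E = 14"
  shows "runs N W (Pass (init_adv K E)) (u, M, X) 60
    (u, put 10 (2 * N) (\<lambda>i. if i < N then M (17, i) else M (K, i - N)) (put 11 (2 * N) (\<lambda>i. i) M),
     put 10 (2 * N) (\<lambda>i. if i < N then X (15, i) else X (E, i - N)) X)"
    (is "runs _ _ _ _ _ (_, ?M, ?X)")
proof -
  let ?F = "\<lambda>v. {Cell (10, v), Cell (11, v), RCell (10, v)} \<union>
      (if v < N then {Cell (17, v), RCell (15, v)} else {Cell (K, v - N), RCell (E, v - N)})"
  show ?thesis
  proof (rule runs_pass[OF assms(1), where F = ?F])
    fix v w assume "v < 2 * N" "w < 2 * N" "v \<noteq> w"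
    then have "N \<le> v \<Longrightarrow> N \<le> w \<Longrightarrow> v - N \<noteq> w - N" by simp
    then show "?F v \<inter> ?F w = {}"
      using assms \<open>v \<noteq> w\<close> by auto
  next
    fix r :: "nat \<Rightarrow> nat" and q :: "nat \<Rightarrow> real"
    assume r: "r 10 < 2 * N" "r (Suc 0) = n" "r 2 = N"
    show "foot (init_adv K E) (r, q, M, X) \<subseteq> ?F (r 10) \<and>
      safe W (init_adv K E) (r, q, M, X) \<and>
      agree (?F (r 10)) (lrun (init_adv K E) (r, q, M, X)) ?M ?X"
      using r assms W_bound by (cases "r 10 < N") (auto simp: init_adv_def grd_simps put_apply agree_def)
  next
    fix A i
    show "?M (A, i) = M (A, i)"
      if "\<forall>v<2 * N. Cell (A, i) \<notin> ?F v"
      using that[rule_format, of i] by (cases "i < 2 * N") (auto simp: put_apply)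
    show "?X (A, i) = X (A, i)"
      if "\<forall>v<2 * N. RCell (A, i) \<notin> ?F v"
      using that[rule_format, of i] by (cases "i < 2 * N") (auto simp: put_apply)
  qed (auto simp: init_adv_def grd_simps length_grd)
qed

lemma runs_gather_adv:
  assumes "cfg u" "perm M" "K' < 10" "{E, E'} = {13, 14}"
  shows "runs N W (Pass (gather_adv E K' E')) (u, M, X) 90
    (u, put 13 (2 * N) (\<lambda>i. if M (11, i) < N then 0 else Suc (M (11, i) - N))
         (put 14 (2 * N) (\<lambda>i. if M (11, i) < N then 0 else M (K', M (11, i) - N)) M),
     put 11 (2 * N) (\<lambda>i. if M (11, i) < N then 0 else X (E', M (11, i) - N) - X (E, M (11, i) - N)) X)"
    (is "runs _ _ _ _ _ (_, ?M, ?X)")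
proof -
  let ?F = "\<lambda>v. {Cell (11, v), Cell (13, v), Cell (14, v), RCell (11, v)} \<union>
      (if M (11, v) < N then {} else {Cell (K', M (11, v) - N), RCell (E', M (11, v) - N), RCell (E, M (11, v) - N)})"
  show ?thesis
  proof (rule runs_pass[OF assms(1), where F = ?F])
    fix v w assume vw: "v < 2 * N" "w < 2 * N" "v \<noteq> w"
    then have "M (11, v) \<noteq> M (11, w)" using place(5)[OF assms(2)] by blast
    then have "N \<le> M (11, v) \<Longrightarrow> N \<le> M (11, w) \<Longrightarrow> M (11, v) - N \<noteq> M (11, w) - N" by simp
    then show "?F v \<inter> ?F w = {}"
      using assms(3,4) vw(3) by (auto simp: doubleton_eq_iff)
  next
    fix r :: "nat \<Rightarrow> nat" and q :: "nat \<Rightarrow> real"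
    assume r: "r 10 < 2 * N" "r (Suc 0) = n" "r 2 = N"
    have v: "M (11, r 10) < 2 * N" using place(4)[OF assms(2)] r by simp
    show "foot (gather_adv E K' E') (r, q, M, X) \<subseteq> ?F (r 10) \<and>
      safe W (gather_adv E K' E') (r, q, M, X) \<and>
      agree (?F (r 10)) (lrun (gather_adv E K' E') (r, q, M, X)) ?M ?X"
      using r assms(3,4) W_bound v
      by (cases "M (11, r 10) < N") (auto simp: gather_adv_def grd_simps put_apply agree_def doubleton_eq_iff)
  qed (auto simp: gather_adv_def grd_simps put_apply length_grd split: if_splits)
qed

lemma runs_scatter_adv:
  assumes "cfg u" "perm M"
  shows "runs N W (Pass scatter_adv) (u, M, X) 78
    (u, put 18 N (\<lambda>t. M (13, place M t))
         (put 17 N (\<lambda>t. if M (13, place M t) = 0 then M (17, t) else M (14, place M t)) M),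
     put 15 N (\<lambda>t. if M (13, place M t) = 0 then X (15, t) else X (15, t) + X (11, place M t)) X)"
    (is "runs _ _ _ _ _ (_, ?M, ?X)")
proof -
  let ?F = "\<lambda>v. {Cell (11, v), Cell (13, v), Cell (14, v), RCell (11, v),
      Cell (18, M (11, v)), Cell (17, M (11, v)), RCell (15, M (11, v))}"
  show ?thesis
  proof (rule runs_pass[OF assms(1), where F = ?F])
    fix r :: "nat \<Rightarrow> nat" and q :: "nat \<Rightarrow> real"
    assume r: "r 10 < 2 * N" "r (Suc 0) = n" "r 2 = N"
    have v: "M (11, r 10) < 2 * N" "place M (M (11, r 10)) = r 10" using place(3,4)[OF assms(2)] r by simp_all
    consider "N \<le> M (11, r 10)" | "M (11, r 10) < N" "M (13, r 10) = 0" | "M (11, r 10) < N" "0 < M (13, r 10)"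
      by linarith
    then show "foot scatter_adv (r, q, M, X) \<subseteq> ?F (r 10) \<and>
      safe W scatter_adv (r, q, M, X) \<and>
      agree (?F (r 10)) (lrun scatter_adv (r, q, M, X)) ?M ?X"
      using r W_bound v by cases (simp_all add: scatter_adv_def grd_simps put_apply agree_def)
  next
    fix A i
    show "?M (A, i) = M (A, i)"
      if "\<forall>v<2 * N. Cell (A, i) \<notin> ?F v"
      using that place(1,2)[OF assms(2), of i] by (force simp: put_apply)
    show "?X (A, i) = X (A, i)"
      if "\<forall>v<2 * N. RCell (A, i) \<notin> ?F v"
      using that place(1,2)[OF assms(2), of i] by (force simp: put_apply)
  qed (use place(5)[OF assms(2)] in \<open>auto simp: scatter_adv_def grd_simps length_grd\<close>)
qed

definition tadv :: nat where "tadv = tsort + tscan + 228"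

text \<open>\<open>nxt\<close> asks for the least arc number, whereas the scan finds the next arc
  record in sorted order. They agree because the ends at a vertex increase with the arc
  number.\<close>

lemma runs_adv:
  assumes u: "cfg u" and K: "K < 10" "K' < 10" and E: "{E, E'} = {13, 14}"
    and increasing: "\<forall>a b. a < b \<longrightarrow> b < N \<longrightarrow> M (K, a) = M (K, b) \<longrightarrow> X (E, a) < X (E, b)"
  obtains u' M' X' where "runs N W (adv_code K E K' E') (u, M, X) tadv (u', M', X')"
    "\<And>k. k \<noteq> 5 \<Longrightarrow> k \<noteq> 6 \<Longrightarrow> u' k = u k" "same {10..18} M M'" "same {10, 11, 12, 15} X X'"
    "\<And>t. t < N \<Longrightarrow> M' (18, t) = nxt N (\<lambda>a. M (K, a)) (\<lambda>a. X (E, a)) (M (17, t), X (15, t))"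
    "\<And>t. t < N \<Longrightarrow> (M' (17, t), X' (15, t)) = adv N (\<lambda>a. M (K, a)) (\<lambda>a. X (E, a)) (\<lambda>a. M (K', a))
       (\<lambda>a. X (E', a)) (M (17, t), X (15, t))"
proof -
  note mono = increasing[rule_format]
  have E': "E = 13 \<or> E = 14" "E' = 13 \<or> E' = 14" using E by (auto simp: doubleton_eq_iff)
  define M1 where "M1 = put 10 (2 * N) (\<lambda>i. if i < N then M (17, i) else M (K, i - N)) (put 11 (2 * N) (\<lambda>i. i) M)"
  define X1 where "X1 = put 10 (2 * N) (\<lambda>i. if i < N then X (15, i) else X (E, i - N)) X"
  have 1: "runs N W (Pass (init_adv K E)) (u, M, X) 60 (u, M1, X1)"
    unfolding M1_def X1_def by (rule runs_init_adv[OF u K(1) E'(1)])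
  have "M1 (11, i) = i" if "i < 2 * N" for i using that by (simp add: M1_def put_apply)
  from runs_sort[OF u this] obtain u2 M2 X2 where
    2: "runs N W sort_code (u, M1, X1) tsort (u2, M2, X2)"
    and u2: "\<And>k. k \<noteq> 5 \<Longrightarrow> k \<noteq> 6 \<Longrightarrow> u2 k = u k" and same2: "same {10, 11} M1 M2" "same {10} X1 X2"
    and p2: "perm M2" and key2: "\<And>i. i < 2 * N \<Longrightarrow> M2 (10, i) = M1 (10, M2 (11, i))"
      "\<And>i. i < 2 * N \<Longrightarrow> X2 (10, i) = X1 (10, M2 (11, i))"
    and sorted: "\<And>i j. i < j \<Longrightarrow> j < 2 * N \<Longrightarrow> keys M2 X2 i < keys M2 X2 j"
    unfolding perm_def by blast
  have cfg2: "cfg u2" using u u2 by (simp add: cfg_def)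
  note pl = place[OF p2]
  define M3 where "M3 = put 13 (2 * N) (\<lambda>i. if M2 (11, i) < N then 0 else Suc (M2 (11, i) - N))
         (put 14 (2 * N) (\<lambda>i. if M2 (11, i) < N then 0 else M2 (K', M2 (11, i) - N)) M2)"
  define X3 where "X3 = put 11 (2 * N) (\<lambda>i. if M2 (11, i) < N then 0 else X2 (E', M2 (11, i) - N) - X2 (E, M2 (11, i) - N)) X2"
  have 3: "runs N W (Pass (gather_adv E K' E')) (u2, M2, X2) 90 (u2, M3, X3)"
    unfolding M3_def X3_def by (rule runs_gather_adv[OF cfg2 p2 K(2) E])
  have M3: "M3 (10, i) = M2 (10, i)" "M3 (11, i) = M2 (11, i)" for i by (simp_all add: M3_def put_apply)
  have mono3: "M3 (10, i) \<le> M3 (10, j)" if "i \<le> j" "j < 2 * N" for i j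
    unfolding M3 by (rule sorted_keys(1)[OF sorted that])
  obtain u4 M4 X4 where
    4: "runs N W copy_scan (u2, M3, X3) (lg * 147 + 21) (u4, M4, X4)" "\<And>k. k \<noteq> 5 \<Longrightarrow> u4 k = u2 k"
      "same {12, 13, 14, 15, 16} M3 M4" "same {11, 12} X3 X4"
    and found: "\<And>i j. i \<le> j \<Longrightarrow> j < 2 * N \<Longrightarrow> M3 (10, j) = M3 (10, i) \<Longrightarrow> M3 (13, j) \<noteq> 0 \<Longrightarrow>
       (\<forall>k. i \<le> k \<and> k < j \<longrightarrow> M3 (13, k) = 0) \<Longrightarrow>
       M4 (13, i) = M3 (13, j) \<and> M4 (14, i) = M3 (14, j) \<and> X4 (11, i) = X3 (11, j)"
    and none: "\<And>i. i < 2 * N \<Longrightarrow> (\<forall>j. i \<le> j \<and> j < 2 * N \<and> M3 (10, j) = M3 (10, i) \<longrightarrow> M3 (13, j) = 0) \<Longrightarrow> M4 (13, i) = 0"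
    using runs_copy_scan[where M = M3 and X = X3, OF cfg2 mono3] by blast
  have cfg4: "cfg u4" using cfg2 4(2) by (simp add: cfg_def)
  have M4: "M4 (11, i) = M2 (11, i)" for i using 4(3) M3 by (simp add: same_def)
  then have p4: "perm M4" and pl4: "place M4 a = place M2 a" for a using p2 by (simp_all add: perm_def place_def)
  define M5 where "M5 = put 18 N (\<lambda>t. M4 (13, place M4 t))
         (put 17 N (\<lambda>t. if M4 (13, place M4 t) = 0 then M4 (17, t) else M4 (14, place M4 t)) M4)"
  define X5 where "X5 = put 15 N (\<lambda>t. if M4 (13, place M4 t) = 0 then X4 (15, t) else X4 (15, t) + X4 (11, place M4 t)) X4"
  have 5: "runs N W (Pass scatter_adv) (u4, M4, X4) 78 (u4, M5, X5)"
    unfolding M5_def X5_def by (rule runs_scatter_adv[OF cfg4 p4])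
  have MM: "M2 (B, i) = M (B, i)" "M4 (B, i) = M (B, i)" if "B \<notin> {10..16}" for B i
    using that same_at[OF same2(1), of B] same_at[OF 4(3), of B] by (auto simp: M1_def M3_def put_apply)
  have XX: "X2 (B, i) = X (B, i)" "X4 (B, i) = X (B, i)" if "B \<notin> {10, 11, 12}" for B i
    using that same_at[OF same2(2), of B] same_at[OF 4(4), of B] by (auto simp: X1_def X3_def put_apply)
  let ?key = "\<lambda>a. M (K, a)" and ?e = "\<lambda>a. X (E, a)"
  have Mi: "M2 (10, j) = (if M2 (11, j) < N then M (17, M2 (11, j)) else M (K, M2 (11, j) - N))"
    "X2 (10, j) = (if M2 (11, j) < N then X (15, M2 (11, j)) else X (E, M2 (11, j) - N))" if "j < 2 * N" for j
    using key2[OF that] pl(4)[OF that] by (simp_all add: M1_def X1_def put_apply)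
  have res: "M4 (13, place M2 t) = nxt N ?key ?e (M (17, t), X (15, t)) \<and>
      (\<forall>a. nxt N ?key ?e (M (17, t), X (15, t)) = Suc a \<longrightarrow>
         M4 (14, place M2 t) = M (K', a) \<and> X4 (11, place M2 t) = X (E', a) - X (E, a))" if t: "t < N" for t
  proof -
    define i where "i = place M2 t"
    define v where "v = M (17, t)"
    define x where "x = X (15, t)"
    have i: "i < 2 * N" "M2 (11, i) = t" using pl(1,2) t by (auto simp: i_def)
    have vx: "M2 (10, i) = v" "X2 (10, i) = x" using Mi[OF i(1)] i t by (auto simp: v_def x_def)
    have after: "x \<le> X (E, b)" "M (K, b) = v"
      if "i \<le> j" "j < 2 * N" "M2 (10, j) = v" "M2 (11, j) = N + b" for j b
      using sorted_keys(2)[OF sorted that(1,2)] vx that Mi[OF that(2)] by auto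
    have A3: "M3 (13, j) = (if M2 (11, j) < N then 0 else Suc (M2 (11, j) - N))" if "j < 2 * N" for j
      using that by (simp add: M3_def put_apply)
    have "M4 (13, i) = nxt N ?key ?e (v, x) \<and> (\<forall>a. nxt N ?key ?e (v, x) = Suc a \<longrightarrow>
         M4 (14, i) = M (K', a) \<and> X4 (11, i) = X (E', a) - X (E, a))"
    proof (cases "\<exists>a<N. M (K, a) = v \<and> x \<le> X (E, a)")
      case False
      have "M3 (13, j) = 0" if j: "i \<le> j" "j < 2 * N" "M3 (10, j) = M3 (10, i)" for j
      proof (rule ccontr)
        assume "M3 (13, j) \<noteq> 0"
        then have "N \<le> M2 (11, j)" using A3[OF j(2)] by (auto split: if_splits)
        then obtain b where b: "M2 (11, j) = N + b" using le_Suc_ex by blast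
        have "b < N" using pl(4)[OF j(2)] b by simp
        moreover have "M2 (10, j) = v" using j(3) vx by (simp add: M3)
        ultimately show False using after[OF j(1,2) _ b] False by blast
      qed
      then have "M4 (13, i) = 0" using none[OF i(1)] by blast
      moreover have "nxt N ?key ?e (v, x) = 0" using False by (auto simp: nxt_def)
      ultimately show ?thesis by simp
    next
      case True
      define a where "a = (LEAST a. a < N \<and> M (K, a) = v \<and> x \<le> X (E, a))"
      have a: "a < N" "M (K, a) = v" "x \<le> X (E, a)"
        using LeastI_ex[OF True] by (auto simp: a_def)
      have least: "a \<le> b" if "b < N" "M (K, b) = v" "x \<le> X (E, b)" for b
        unfolding a_def by (rule Least_le) (use that in auto)
      have nx: "nxt N ?key ?e (v, x) = Suc a" using True by (auto simp: nxt_def a_def)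
      define j where "j = place M2 (N + a)"
      have j: "j < 2 * N" "M2 (11, j) = N + a" using pl(1,2)[of "N + a"] a by (auto simp: j_def)
      have jv: "M2 (10, j) = v" "X2 (10, j) = X (E, a)" using Mi[OF j(1)] j a by auto
      \<comment> \<open>At equal positions the point, numbered below \<open>N\<close>, precedes the
        arc.\<close>
      have "\<not> j < i"
      proof
        assume ji: "j < i"
        then have "X (E, a) \<le> x" using sorted_keys(2)[OF sorted, of j i] i jv vx by simp
        then have "M2 (11, j) < M2 (11, i)" using sorted_keys(3)[OF sorted ji i(1)] jv vx a by simp
        then show False using i j t by simp
      qed
      then have ij: "i \<le> j" by simp
      \<comment> \<open>An arc record in between would qualify too, with a larger number by
        minimality but no larger end, against the strict increase.\<close>
      have zero: "M3 (13, k) = 0" if k: "i \<le> k" "k < j" for k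
      proof (rule ccontr)
        assume nz: "M3 (13, k) \<noteq> 0"
        have k2: "k < 2 * N" using k j by simp
        have "N \<le> M2 (11, k)" using A3[OF k2] nz by (auto split: if_splits)
        then obtain b where b: "M2 (11, k) = N + b" using le_Suc_ex by blast
        have bN: "b < N" using pl(4)[OF k2] b by simp
        have kv: "M2 (10, k) = v"
          using sorted_keys(1)[OF sorted k(1) k2] sorted_keys(1)[OF sorted less_imp_le[OF k(2)] j(1)] vx jv by simp
        note b' = after[OF k(1) k2 kv b]
        have ab: "a \<le> b" by (rule least[OF bN b'(2,1)])
        have le: "X (E, b) \<le> X (E, a)"
          using sorted_keys(2)[OF sorted less_imp_le[OF k(2)] j(1)] kv jv Mi[OF k2] b by simp
        have "b \<noteq> a" using pl(3)[OF k2] b k(2) by (auto simp: j_def)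
        then have "X (E, a) < X (E, b)" using mono[of a b] ab bN a b' by simp
        then show False using le by simp
      qed
      have "M4 (13, i) = M3 (13, j) \<and> M4 (14, i) = M3 (14, j) \<and> X4 (11, i) = X3 (11, j)"
        using zero j ij jv vx A3[OF j(1)] by (intro found) (auto simp: M3)
      moreover have "M3 (13, j) = Suc a" "M3 (14, j) = M (K', a)" "X3 (11, j) = X (E', a) - X (E, a)"
        using j MM(1)[of K'] XX(1)[of E] XX(1)[of E'] K E' by (auto simp: M3_def X3_def put_apply)
      ultimately show ?thesis using nx by simp
    qed
    then show ?thesis by (simp add: i_def v_def x_def)
  qed
  show ?thesis
  proof (rule that[of u4 M5 X5])
    have "60 + (tsort + (90 + ((lg * 147 + 21) + 78))) \<le> tadv" by (simp add: tadv_def tscan_def)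
    then show "runs N W (adv_code K E K' E') (u, M, X) tadv (u4, M5, X5)"
      unfolding adv_code_def by (rule runs_mono[OF runs_Seq[OF 1 runs_Seq[OF 2 runs_Seq[OF 3 runs_Seq[OF 4(1) 5]]]]])
    show "u4 k = u k" if "k \<noteq> 5" "k \<noteq> 6" for k using that u2 4(2) by simp
    show "same {10..18} M M5" using MM(2) by (auto simp: same_def M5_def put_apply)
    show "same {10, 11, 12, 15} X X5" using XX(2) by (auto simp: same_def X5_def put_apply)
    fix t assume t: "t < N"
    show "M5 (18, t) = nxt N ?key ?e (M (17, t), X (15, t))"
      using res[OF t] t by (simp add: M5_def put_apply pl4)
    show "(M5 (17, t), X5 (15, t)) = adv N ?key ?e (\<lambda>a. M (K', a)) (\<lambda>a. X (E', a)) (M (17, t), X (15, t))"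
      using res[OF t] t MM(2)[of 17] XX(2)[of 15]
      by (cases "nxt N ?key ?e (M (17, t), X (15, t))") (auto simp: M5_def X5_def put_apply pl4 adv_def)
  qed
qed

end

section \<open>Removing duplicate points\<close>

definition init_dedup :: "ginstr list" where
  "init_dedup = grd always [Arith Sub 11 (Reg 1) (Imm 0), RSub 0 0 0] @
     grd (GLess (Reg 10) (Reg 2)) [Load 11 17 (Reg 10), RLoad 0 15 (Reg 10)] @
     grd always [Store 10 (Reg 10) (Reg 11), RStore 10 (Reg 10) 0, Store 11 (Reg 10) (Reg 10)]"

text \<open>The distance to the preceding record of the same vertex is 0 for a repeated point; its
  key becomes \<open>n\<close>, so that the second sort moves it behind the survivors.\<close>

definition differences :: "ginstr list" where
  "differences =
     grd always [Load 11 10 (Reg 10), Arith Sub 13 (Reg 10) (Imm 1), Arith Sub 16 (Reg 1) (Imm 0),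
       RLoad 0 10 (Reg 10), RSub 2 2 2] @
     grd (pos 10) [Load 14 12 (Reg 13), RLoad 1 12 (Reg 13)] @
     equal_test 11 14 15 @
     [(GLess (Reg 10) (Imm 1), Arith Sub 15 (Imm 0) (Imm 0))] @
     grd (pos 15) [RSub 0 0 1] @
     grd always [RStore 16 (Reg 10) 0, Store 11 (Reg 10) (Reg 10)] @
     [(GRLess 2 0, Arith Sub 16 (Reg 11) (Imm 0)), (always, Store 10 (Reg 10) (Reg 16))]"

text \<open>Counting without a sum: only the last survivor is followed by a record with key
  \<open>n\<close>, and it writes its index plus one. A following record exists, as at most half of
  the records survive.\<close>

definition finish_dedup :: "ginstr list" where
  "finish_dedup =
     grd always [Load 11 10 (Reg 10), Load 12 11 (Reg 10), RLoad 0 10 (Reg 10), RLoad 1 16 (Reg 12),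
       Arith Add 13 (Reg 10) (Imm 1), Arith Sub 14 (Imm 0) (Imm 0), Arith Sub 15 (Imm 0) (Imm 0),
       Arith Sub 16 (Reg 1) (Reg 11)] @
     grd (GLess (Reg 10) (Reg 2)) [Store 17 (Reg 10) (Reg 11), RStore 15 (Reg 10) 0, RStore 1 (Reg 10) 1] @
     grd (GLess (Reg 13) (Reg 4)) [Load 14 12 (Reg 13), Arith Add 15 (Imm 1) (Imm 0)] @
     [(GLess (Reg 14) (Reg 1), Arith Sub 15 (Imm 0) (Imm 0)),
      (GLess (Reg 16) (Imm 1), Arith Sub 15 (Imm 0) (Imm 0)),
      (pos 15, Store 4 (Imm 0) (Reg 13))]"

definition dedup_code :: com where
  "dedup_code = Pass init_dedup ;; sort_code ;; Pass (copy_nat 10 12 @ copy_real 10 12) ;; Pass differences ;;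
     sort_code ;; Pass (copy_nat 10 12) ;; Pass finish_dedup"

lemma initial_segment:
  fixes S :: "nat set"
  assumes "finite S" "\<And>i j. i < j \<Longrightarrow> j \<in> S \<Longrightarrow> i \<in> S"
  shows "S = {..<card S}"
proof (cases "S = {}")
  case False
  have "S = {..Max S}"
  proof (rule set_eqI)
    fix i
    show "i \<in> S \<longleftrightarrow> i \<in> {..Max S}"
      using assms(2)[of i "Max S"] Max_in[OF assms(1) False] Max_ge[OF assms(1), of i]
      by (cases "i = Max S") auto
  qed
  then have "card S = Suc (Max S)" by (metis card_atMost)
  then show ?thesis using \<open>S = {..Max S}\<close> by (simp add: lessThan_Suc_atMost)
qed simp

context pram
begin

section \<open>The passes that remove duplicates\<close>

lemma runs_init_dedup:
  assumes "cfg u"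
  shows "runs N W (Pass init_dedup) (u, M, X) 48
    (u, put 10 (2 * N) (\<lambda>i. if i < N then M (17, i) else n) (put 11 (2 * N) (\<lambda>i. i) M),
     put 10 (2 * N) (\<lambda>i. if i < N then X (15, i) else 0) X)"
    (is "runs _ _ _ _ _ (_, ?M, ?X)")
proof -
  let ?F = "\<lambda>v. {Cell (10, v), Cell (11, v), RCell (10, v), Cell (17, v), RCell (15, v)}"
  show ?thesis
  proof (rule runs_pass[OF assms, where F = ?F])
    fix A i
    show "?M (A, i) = M (A, i)"
      if "\<forall>v<2 * N. Cell (A, i) \<notin> ?F v"
      using that by (cases "i < 2 * N") (auto simp: put_apply)
    show "?X (A, i) = X (A, i)"
      if "\<forall>v<2 * N. RCell (A, i) \<notin> ?F v"
      using that by (cases "i < 2 * N") (auto simp: put_apply)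
  qed (auto simp: init_dedup_def grd_simps put_apply agree_def length_grd)
qed

lemma runs_copy_point:
  assumes "cfg u"
  shows "runs N W (Pass (copy_nat 10 12 @ copy_real 10 12)) (u, M, X) 30
    (u, put 12 (2 * N) (\<lambda>i. M (10, i)) M, put 12 (2 * N) (\<lambda>i. X (10, i)) X)"
  by (rule runs_pass[OF assms, where F = "\<lambda>v. {Cell (10, v), Cell (12, v), RCell (10, v), RCell (12, v)}"])
    (auto simp: copy_real_def copy_nat_def grd_simps put_apply agree_def)

lemma runs_differences:
  fixes M :: "nat \<times> nat \<Rightarrow> nat" and X :: "nat \<times> nat \<Rightarrow> real"
  assumes "cfg u"
  defines "w \<equiv> \<lambda>i. X (10, i) - (if 0 < i \<and> M (12, i - 1) = M (10, i) then X (12, i - 1) else 0)"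
  shows "runs N W (Pass differences) (u, M, X) 102
    (u, put 10 (2 * N) (\<lambda>i. if 0 < w i then M (10, i) else n) (put 11 (2 * N) (\<lambda>i. i) M), put 16 (2 * N) w X)"
    (is "runs _ _ _ _ _ (_, ?M, ?X)")
proof -
  let ?F = "\<lambda>v. {Cell (10, v), Cell (11, v), RCell (10, v), RCell (16, v)} \<union>
     (if 0 < v then {Cell (12, v - 1), RCell (12, v - 1)} else {})"
  show ?thesis
  proof (rule runs_pass[OF assms(1), where F = ?F])
    fix r :: "nat \<Rightarrow> nat" and q :: "nat \<Rightarrow> real"
    assume r: "r 10 < 2 * N" "r (Suc 0) = n" "r 2 = N"
    consider "r 10 = 0" | "0 < r 10" "M (12, r 10 - 1) = M (10, r 10)" | "0 < r 10" "M (12, r 10 - 1) < M (10, r 10)"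
      | "0 < r 10" "M (10, r 10) < M (12, r 10 - 1)" by linarith
    then show "foot differences (r, q, M, X) \<subseteq> ?F (r 10) \<and>
      safe W differences (r, q, M, X) \<and>
      agree (?F (r 10)) (lrun differences (r, q, M, X)) ?M ?X"
      using r W_bound unfolding w_def
      by cases (simp_all add: differences_def equal_test_def grd_simps put_apply agree_def lstep_push del: lstep.simps)
  qed (auto simp: differences_def equal_test_def grd_simps put_apply length_grd split: if_splits)
qed

text \<open>The cell for the count has to be 0 beforehand because nobody writes to it if
  \<open>c = 0\<close>.\<close>

lemma runs_finish_dedup:
  assumes "cfg u" "perm M" and M4: "M (4, 0) = 0"
    and seg: "\<And>i. i < 2 * N \<Longrightarrow> M (10, i) < n \<longleftrightarrow> i < c" and copy: "\<And>i. i < 2 * N \<Longrightarrow> M (12, i) = M (10, i)"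
    and c: "c \<le> N"
  shows "runs N W (Pass finish_dedup) (u, M, X) 102
    (u, put 17 N (\<lambda>i. M (10, i)) (put 4 1 (\<lambda>_. c) M), put 15 N (\<lambda>i. X (10, i)) (put 1 N (\<lambda>i. X (16, M (11, i))) X))"
    (is "runs _ _ _ _ _ (_, ?M, ?X)")
proof -
  let ?F = "\<lambda>v. {Cell (10, v), Cell (11, v), RCell (10, v), RCell (16, M (11, v)),
      Cell (17, v), RCell (15, v), RCell (1, v)} \<union> (if v + 1 < 2 * N then {Cell (12, v + 1)} else {}) \<union>
      (if v + 1 = c then {Cell (4, 0)} else {})"
  show ?thesis
  proof (rule runs_pass[OF assms(1), where F = ?F])
    fix v w assume vw: "v < 2 * N" "w < 2 * N" "v \<noteq> w"
    then have "M (11, v) \<noteq> M (11, w)" using place(5)[OF assms(2)] by blast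
    then show "?F v \<inter> ?F w = {}"
      using vw(3) by auto
  next
    fix r :: "nat \<Rightarrow> nat" and q :: "nat \<Rightarrow> real"
    assume r: "r 10 < 2 * N" "r (Suc 0) = n" "r 2 = N" "r 4 = 2 * N"
    have s: "M (10, r 10) < n \<longleftrightarrow> r 10 < c" using seg r(1) by simp
    have s': "M (12, Suc (r 10)) < n \<longleftrightarrow> Suc (r 10) < c" if "Suc (r 10) < 2 * N" using seg[OF that] copy[OF that] by simp
    consider "Suc (r 10) = c" "r 10 < c" "Suc (r 10) < 2 * N" "r 10 < N"
      | "Suc (r 10) < c" "r 10 < c" "Suc (r 10) < 2 * N" "r 10 < N"
      | "c \<le> r 10" "\<not> r 10 < c" "Suc (r 10) < 2 * N" "r 10 < N"
      | "c \<le> r 10" "\<not> r 10 < c" "Suc (r 10) < 2 * N" "N \<le> r 10"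
      | "c \<le> r 10" "\<not> r 10 < c" "\<not> Suc (r 10) < 2 * N" "N \<le> r 10"
      using c N_pos by linarith
    then show "foot finish_dedup (r, q, M, X) \<subseteq> ?F (r 10) \<and>
      safe W finish_dedup (r, q, M, X) \<and>
      agree (?F (r 10)) (lrun finish_dedup (r, q, M, X)) ?M ?X"
      using r W_bound s s' by cases (simp_all add: finish_dedup_def grd_simps put_apply agree_def)
  next
    fix A i
    assume out: "\<forall>v<2 * N. Cell (A, i) \<notin> ?F v"
    have "c = 0" if "A = 4" "i = 0" using out[rule_format, of "c - 1"] that c N_pos by (cases c) auto
    then show "?M (A, i) = M (A, i)"
      using out[rule_format, of i] M4 by (auto simp: put_apply)
  next
    fix A i
    assume out: "\<forall>v<2 * N. RCell (A, i) \<notin> ?F v"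
    then show "?X (A, i) = X (A, i)"
      using out[rule_format, of i] by (auto simp: put_apply)
  qed (auto simp: finish_dedup_def grd_simps length_grd)
qed

definition tdedup :: nat where "tdedup = 2 * tsort + 300"

text \<open>After the first sort equal points are adjacent. The difference to the predecessor then
  serves twice: it is positive exactly at the first copy of each point, and there it is the amount
  of the point. The record numbers of the second sort lead from a survivor back to its
  difference.\<close>

lemma runs_dedup:
  fixes M X
  assumes u: "cfg u" and M4: "M (4, 0) = 0"
    and valid: "\<forall>t<N. M (17, t) < n \<and> 0 < X (15, t)"
  defines "P \<equiv> (\<lambda>t. (M (17, t), X (15, t))) ` {..<N}"
  obtains u' M' X' where "runs N W dedup_code (u, M, X) tdedup (u', M', X')"
    "\<And>k. k \<noteq> 5 \<Longrightarrow> k \<noteq> 6 \<Longrightarrow> u' k = u k" "same {4, 10, 11, 12, 17} M M'" "same {1, 10, 12, 15, 16} X X'"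
    "M' (4, 0) = card P" "bij_betw (\<lambda>i. (M' (17, i), X' (15, i))) {..<card P} P"
    "\<And>i. card P \<le> i \<Longrightarrow> i < N \<Longrightarrow> M' (17, i) = n"
    "\<And>i. i < card P \<Longrightarrow> X' (1, i) = X' (15, i) - Max (insert 0 {y. (M' (17, i), y) \<in> P \<and> y < X' (15, i)})"
proof -
  note pts = valid[rule_format]
  define M1 where "M1 = put 10 (2 * N) (\<lambda>i. if i < N then M (17, i) else n) (put 11 (2 * N) (\<lambda>i. i) M)"
  define X1 where "X1 = put 10 (2 * N) (\<lambda>i. if i < N then X (15, i) else 0) X"
  have 1: "runs N W (Pass init_dedup) (u, M, X) 48 (u, M1, X1)"
    unfolding M1_def X1_def by (rule runs_init_dedup[OF u])
  have "M1 (11, i) = i" if "i < 2 * N" for i using that by (simp add: M1_def put_apply)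
  from runs_sort[OF u this] obtain u2 M2 X2 where
    2: "runs N W sort_code (u, M1, X1) tsort (u2, M2, X2)"
    and u2: "\<And>k. k \<noteq> 5 \<Longrightarrow> k \<noteq> 6 \<Longrightarrow> u2 k = u k" and same2: "same {10, 11} M1 M2" "same {10} X1 X2"
    and p2: "perm M2" and key2: "\<And>i. i < 2 * N \<Longrightarrow> M2 (10, i) = M1 (10, M2 (11, i))"
      "\<And>i. i < 2 * N \<Longrightarrow> X2 (10, i) = X1 (10, M2 (11, i))"
    and sorted: "\<And>i j. i < j \<Longrightarrow> j < 2 * N \<Longrightarrow> keys M2 X2 i < keys M2 X2 j"
    unfolding perm_def by blast
  have cfg2: "cfg u2" using u u2 by (simp add: cfg_def)
  note pl = place[OF p2]
  define M3 where "M3 = put 12 (2 * N) (\<lambda>i. M2 (10, i)) M2"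
  define X3 where "X3 = put 12 (2 * N) (\<lambda>i. X2 (10, i)) X2"
  have 3: "runs N W (Pass (copy_nat 10 12 @ copy_real 10 12)) (u2, M2, X2) 30 (u2, M3, X3)"
    unfolding M3_def X3_def by (rule runs_copy_point[OF cfg2])
  define w where "w i = X3 (10, i) - (if 0 < i \<and> M3 (12, i - 1) = M3 (10, i) then X3 (12, i - 1) else 0)" for i
  define M4 where "M4 = put 10 (2 * N) (\<lambda>i. if 0 < w i then M3 (10, i) else n) (put 11 (2 * N) (\<lambda>i. i) M3)"
  define X4 where "X4 = put 16 (2 * N) w X3"
  have 4: "runs N W (Pass differences) (u2, M3, X3) 102 (u2, M4, X4)"
    unfolding M4_def X4_def w_def by (rule runs_differences[OF cfg2])
  have "M4 (11, i) = i" if "i < 2 * N" for i using that by (simp add: M4_def put_apply)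
  from runs_sort[OF cfg2 this] obtain u5 M5 X5 where
    5: "runs N W sort_code (u2, M4, X4) tsort (u5, M5, X5)"
    and u5: "\<And>k. k \<noteq> 5 \<Longrightarrow> k \<noteq> 6 \<Longrightarrow> u5 k = u2 k" and same5: "same {10, 11} M4 M5" "same {10} X4 X5"
    and p5: "perm M5" and key5: "\<And>i. i < 2 * N \<Longrightarrow> M5 (10, i) = M4 (10, M5 (11, i))"
      "\<And>i. i < 2 * N \<Longrightarrow> X5 (10, i) = X4 (10, M5 (11, i))"
    and sorted5: "\<And>i j. i < j \<Longrightarrow> j < 2 * N \<Longrightarrow> keys M5 X5 i < keys M5 X5 j"
    unfolding perm_def by blast
  have cfg5: "cfg u5" using cfg2 u5 by (simp add: cfg_def)
  define v where "v i = M2 (10, i)" for i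
  define x where "x i = X2 (10, i)" for i
  \<comment> \<open>\<open>A\<close> contains the places of genuine points, as opposed to surplus
    records, and \<open>Fl\<close> those of first copies.\<close>
  define A where "A = {i. i < 2 * N \<and> v i < n}"
  define Fl where "Fl = {i \<in> A. 0 < w i}"
  have vi: "v i = (if M2 (11, i) < N then M (17, M2 (11, i)) else n)" "x i = (if M2 (11, i) < N then X (15, M2 (11, i)) else 0)"
    if "i < 2 * N" for i
    using key2[OF that] pl(4)[OF that] by (simp_all add: M1_def X1_def put_apply v_def x_def)
  have A: "i \<in> A \<longleftrightarrow> i < 2 * N \<and> M2 (11, i) < N" for i
    using vi(1)[of i] pts[of "M2 (11, i)"] by (auto simp: A_def split: if_splits)
  have w: "w i = x i - (if 0 < i \<and> v (i - 1) = v i then x (i - 1) else 0)" if "i < 2 * N" for i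
    using that less_imp_diff_less[OF that, of 1] by (simp add: w_def M3_def X3_def put_apply v_def x_def)
  have vmono: "v i \<le> v j" and xmono: "v i = v j \<Longrightarrow> x i \<le> x j" if "i \<le> j" "j < 2 * N" for i j
    using sorted_keys(1,2)[OF sorted that] by (auto simp: v_def x_def)
  have xpos: "0 < x i" if "i \<in> A" for i using that vi(2)[of i] pts[of "M2 (11, i)"] by (auto simp: A)
  have inP: "(v i, x i) \<in> P" if "i \<in> A" for i using that vi[of i] by (auto simp: A P_def)
  have exA: "\<exists>i\<in>A. v i = a \<and> x i = b" if ab: "(a, b) \<in> P" for a b
  proof -
    obtain t where t: "t < N" "a = M (17, t)" "b = X (15, t)" using ab by (auto simp: P_def)
    then have "place M2 t \<in> A" "v (place M2 t) = a" "x (place M2 t) = b"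
      using pl(1,2)[of t] vi[of "place M2 t"] by (auto simp: A)
    then show ?thesis by blast
  qed
  have w0: "0 < w i \<longleftrightarrow> \<not> (0 < i \<and> v (i - 1) = v i \<and> x (i - 1) = x i)" if "i \<in> A" for i
  proof -
    have i: "i < 2 * N" using that by (simp add: A)
    show ?thesis using w[OF i] xpos[OF that] xmono[of "i - 1" i] i by auto
  qed
  have bijF: "bij_betw (\<lambda>i. (v i, x i)) Fl P"
  proof (rule bij_betw_imageI)
    have "(v i, x i) \<noteq> (v j, x j)" if ij: "i < j" "j \<in> Fl" for i j
    proof
      assume eq: "(v i, x i) = (v j, x j)"
      have j: "j \<in> A" "0 < w j" "j < 2 * N" using ij by (auto simp: Fl_def A)
      have le: "i \<le> j - 1" "j - 1 < 2 * N" "j - 1 \<le> j" using ij(1) j by auto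
      have "v (j - 1) = v j" using vmono[OF le(1,2)] vmono[OF le(3) j(3)] eq by simp
      moreover have "x (j - 1) = x j" using xmono[OF le(1,2)] xmono[OF le(3) j(3)] calculation eq by simp
      ultimately show False using w0[OF j(1)] j(2) ij(1) by simp
    qed
    then show "inj_on (\<lambda>i. (v i, x i)) Fl" by (intro inj_onI) (metis nat_neq_iff)
    have "(a, b) \<in> (\<lambda>i. (v i, x i)) ` Fl" if ab: "(a, b) \<in> P" for a b
    proof -
      define i where "i = (LEAST i. i \<in> A \<and> v i = a \<and> x i = b)"
      have i: "i \<in> A" "v i = a" "x i = b"
        using LeastI_ex[of "\<lambda>i. i \<in> A \<and> v i = a \<and> x i = b"] exA[OF ab] by (auto simp: i_def)
      have "\<not> (0 < i \<and> v (i - 1) = v i \<and> x (i - 1) = x i)"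
      proof
        assume h: "0 < i \<and> v (i - 1) = v i \<and> x (i - 1) = x i"
        then have "i - 1 \<in> A" using i(1) by (auto simp: A_def)
        then have "i \<le> i - 1" unfolding i_def by (intro Least_le) (use h i in \<open>auto simp: i_def\<close>)
        moreover have "0 < i" using h by simp
        ultimately show False by linarith
      qed
      then have "i \<in> Fl" using w0[OF i(1)] i(1) by (simp add: Fl_def)
      then show ?thesis using i by force
    qed
    then show "(\<lambda>i. (v i, x i)) ` Fl = P" using inP by (auto simp: Fl_def)
  qed
  have amount: "w i = x i - Max (insert 0 {y. (v i, y) \<in> P \<and> y < x i})" if i: "i \<in> Fl" for i
  proof -
    have iA: "i \<in> A" "i < 2 * N" "0 < w i" using i by (auto simp: Fl_def A)
    have before: "\<exists>k<i. v k = v i \<and> x k = y \<and> k \<in> A" if y: "(v i, y) \<in> P" "y < x i" for y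
    proof -
      obtain k where k: "k \<in> A" "v k = v i" "x k = y" using exA[OF y(1)] by blast
      have "\<not> i \<le> k" using xmono[of i k] k y by (auto simp: A)
      then show ?thesis using k by (intro exI[of _ k]) auto
    qed
    show ?thesis
    proof (cases "0 < i \<and> v (i - 1) = v i")
      case True
      have pA: "i - 1 \<in> A" using True iA by (auto simp: A_def)
      have "x (i - 1) < x i" using w0[OF iA(1)] iA True xmono[of "i - 1" i] by simp
      have in1: "(v i, x (i - 1)) \<in> P" using inP[OF pA] True by simp
      have bound: "y \<le> x (i - 1)" if y: "(v i, y) \<in> P" "y < x i" for y
      proof -
        obtain k where k: "k < i" "v k = v i" "x k = y" using before[OF y] by blast
        have "k \<le> i - 1" "i - 1 < 2 * N" using k(1) iA(2) by auto
        from xmono[OF this] show ?thesis using k True by simp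
      qed
      have "Max (insert 0 {y. (v i, y) \<in> P \<and> y < x i}) = x (i - 1)"
      proof (rule Max_eqI)
        have "{y. (v i, y) \<in> P \<and> y < x i} \<subseteq> snd ` P" by force
        then have "finite {y. (v i, y) \<in> P \<and> y < x i}" by (rule finite_subset) (simp add: P_def)
        then show "finite (insert 0 {y. (v i, y) \<in> P \<and> y < x i})" by simp
      qed (use bound in1 \<open>x (i - 1) < x i\<close> xpos[OF pA] in auto)
      then show ?thesis using w[OF iA(2)] True by simp
    next
      case False
      have empty: "{y. (v i, y) \<in> P \<and> y < x i} = {}"
      proof (rule ccontr)
        assume "{y. (v i, y) \<in> P \<and> y < x i} \<noteq> {}"
        then obtain y where "(v i, y) \<in> P" "y < x i" by blast
        then obtain k where k: "k < i" "v k = v i" using before by blast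
        have "k \<le> i - 1" "i - 1 < 2 * N" "i - 1 \<le> i" using k iA by auto
        then have "v (i - 1) = v i" using vmono[of k "i - 1"] vmono[of "i - 1" i] k iA(2) by simp
        then show False using False k by simp
      qed
      show ?thesis unfolding empty w[OF iA(2)] using False by auto
    qed
  qed
  let ?c = "card P"
  let ?\<tau> = "\<lambda>i. M5 (11, i)"
  note pl5 = place[OF p5]
  have M5: "M5 (10, i) = (if ?\<tau> i \<in> Fl then v (?\<tau> i) else n)" "X5 (10, i) = x (?\<tau> i)" if "i < 2 * N" for i
  proof -
    have t: "?\<tau> i < 2 * N" using pl5(4)[OF that] .
    have "M4 (10, ?\<tau> i) = (if 0 < w (?\<tau> i) then v (?\<tau> i) else n)" "X4 (10, ?\<tau> i) = x (?\<tau> i)"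
      using t by (simp_all add: M4_def M3_def X4_def X3_def put_apply v_def x_def)
    moreover have "v (?\<tau> i) = n" if "?\<tau> i \<notin> A" using vi(1)[OF t] that t by (auto simp: A)
    ultimately show "M5 (10, i) = (if ?\<tau> i \<in> Fl then v (?\<tau> i) else n)" "X5 (10, i) = x (?\<tau> i)"
      using key5[OF that] by (auto simp: Fl_def)
  qed
  have vn: "v i < n" if "i \<in> Fl" for i using that by (simp add: Fl_def A_def)
  define S where "S = {i. i < 2 * N \<and> ?\<tau> i \<in> Fl}"
  have S: "i \<in> S \<longleftrightarrow> M5 (10, i) < n" if "i < 2 * N" for i using M5(1)[OF that] vn that by (auto simp: S_def)
  have Fl2: "i < 2 * N" if "i \<in> Fl" for i using that by (simp add: Fl_def A)
  have bijS: "bij_betw ?\<tau> S Fl"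
  proof (rule bij_betwI[where g = "place M5"])
    show "?\<tau> \<in> S \<rightarrow> Fl" by (auto simp: S_def)
    show "place M5 \<in> Fl \<rightarrow> S"
    proof
      fix j assume "j \<in> Fl"
      then show "place M5 j \<in> S" using pl5(1,2)[OF Fl2] by (simp add: S_def)
    qed
    show "place M5 (?\<tau> i) = i" if "i \<in> S" for i using that pl5(3)[of i] by (simp add: S_def)
    show "?\<tau> (place M5 j) = j" if "j \<in> Fl" for j by (rule pl5(2)[OF Fl2[OF that]])
  qed
  have finS: "finite S" by (simp add: S_def)
  have cS: "card S = ?c" using bij_betw_same_card[OF bijS] bij_betw_same_card[OF bijF] by simp
  have "S = {..<card S}"
  proof (rule initial_segment[OF finS])
    fix i j assume ij: "i < j" "j \<in> S"
    then have j: "j < 2 * N" by (simp add: S_def)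
    then have "M5 (10, i) \<le> M5 (10, j)" using sorted_keys(1)[OF sorted5, of i j] ij by simp
    then show "i \<in> S" using S[of i] S[OF j] ij j by simp
  qed
  then have Sc: "S = {..<?c}" using cS by simp
  have cN: "?c \<le> N" using card_image_le[of "{..<N}" "\<lambda>t. (M (17, t), X (15, t))"] by (simp add: P_def)
  have seg: "M5 (10, i) < n \<longleftrightarrow> i < ?c" if "i < 2 * N" for i using S[OF that] Sc by auto
  define M6 where "M6 = put 12 (2 * N) (\<lambda>i. M5 (10, i)) M5"
  have 6: "runs N W (Pass (copy_nat 10 12)) (u5, M5, X5) 18 (u5, M6, X5)"
    unfolding M6_def by (rule runs_copy_key[OF cfg5])
  have M6: "M6 (10, i) = M5 (10, i)" "M6 (11, i) = M5 (11, i)" for i by (simp_all add: M6_def put_apply)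
  have p6: "perm M6" using p5 by (simp add: perm_def M6)
  have MM: "M6 (B, i) = M (B, i)" if "B \<notin> {10, 11, 12}" for B i
    using that same_at[OF same2(1), of B] same_at[OF same5(1), of B]
    by (auto simp: M6_def M4_def M3_def M1_def put_apply)
  have XX: "X5 (B, i) = X (B, i)" if "B \<notin> {10, 12, 16}" for B i
    using that same_at[OF same2(2), of B] same_at[OF same5(2), of B]
    by (auto simp: X4_def X3_def X1_def put_apply)
  have X16: "X5 (16, i) = w i" if "i < 2 * N" for i
    using that same_at[OF same5(2), of 16] by (simp add: X4_def put_apply)
  define M7 where "M7 = put 17 N (\<lambda>i. M6 (10, i)) (put 4 1 (\<lambda>_. ?c) M6)"
  define X7 where "X7 = put 15 N (\<lambda>i. X5 (10, i)) (put 1 N (\<lambda>i. X5 (16, M6 (11, i))) X5)"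
  have 7: "runs N W (Pass finish_dedup) (u5, M6, X5) 102 (u5, M7, X7)"
    unfolding M7_def X7_def using MM[of 4 0] M4 seg cN
    by (intro runs_finish_dedup[OF cfg5 p6]) (auto simp: M6 M6_def put_apply)
  have pt: "(M7 (17, i), X7 (15, i)) = (v (?\<tau> i), x (?\<tau> i)) \<and> ?\<tau> i \<in> Fl" if "i < ?c" for i
  proof -
    have i: "i < 2 * N" "i < N" "i \<in> S" using that cN Sc by auto
    then show ?thesis using M5[OF i(1)] M6 by (auto simp: M7_def X7_def put_apply S_def)
  qed
  have ct: "48 + (tsort + (30 + (102 + (tsort + (18 + 102))))) = tdedup" by (simp add: tdedup_def)
  have run: "runs N W dedup_code (u, M, X) tdedup (u5, M7, X7)"
    using runs_Seq[OF 1 runs_Seq[OF 2 runs_Seq[OF 3 runs_Seq[OF 4 runs_Seq[OF 5 runs_Seq[OF 6 7]]]]]]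
    unfolding ct by (simp only: dedup_code_def)
  have "bij_betw (\<lambda>i. (v (?\<tau> i), x (?\<tau> i))) {..<?c} P"
    using bij_betw_trans[OF bijS[unfolded Sc] bijF] by (simp add: o_def)
  then have bij7: "bij_betw (\<lambda>i. (M7 (17, i), X7 (15, i))) {..<?c} P"
    by (rule iffD1[OF bij_betw_cong, rotated]) (use pt in auto)
  show ?thesis
  proof (rule that[OF run])
    show "u5 k = u k" if "k \<noteq> 5" "k \<noteq> 6" for k using that u2 u5 by simp
    show "same {4, 10, 11, 12, 17} M M7" using MM by (auto simp: same_def M7_def put_apply)
    show "same {1, 10, 12, 15, 16} X X7" using XX by (auto simp: same_def X7_def put_apply)
    show "M7 (4, 0) = ?c" by (simp add: M7_def put_apply)
    show "bij_betw (\<lambda>i. (M7 (17, i), X7 (15, i))) {..<?c} P" by (rule bij7)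
    show "M7 (17, i) = n" if i: "?c \<le> i" "i < N" for i
      using i M5(1)[of i] seg[of i] vn[of "?\<tau> i"] by (auto simp: M7_def put_apply M6 split: if_splits)
    show "X7 (1, i) = X7 (15, i) - Max (insert 0 {y. (M7 (17, i), y) \<in> P \<and> y < X7 (15, i)})"
      if i: "i < ?c" for i
    proof -
      have "X7 (1, i) = w (?\<tau> i)"
        using i cN pl5(4)[of i] X16[of "?\<tau> i"] by (simp add: X7_def put_apply M6)
      then show ?thesis using pt[OF i] amount[of "?\<tau> i"] by simp
    qed
  qed
qed

end

section \<open>The algorithm\<close>

definition token_code :: "ginstr list" where
  "token_code = grd (GLess (Reg 10) (Reg 2))
     [Load 11 0 (Reg 10), Store 17 (Reg 10) (Reg 11), RLoad 0 13 (Reg 10), RStore 15 (Reg 10) 0]"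

text \<open>Register 7 is the current round. Overwriting the length in every successful round
  suffices, since a path never resumes once it has ended.\<close>

definition record_code :: "ginstr list" where
  "record_code = grd always [Arith Sub 11 (Imm 0) (Imm 0)] @
     grd (GLess (Reg 10) (Reg 2)) [Load 11 18 (Reg 10)] @
     grd (pos 11) [Arith Mul 12 (Reg 10) (Reg 3), Arith Add 12 (Reg 12) (Reg 7), Arith Sub 13 (Reg 11) (Imm 1),
       Store 6 (Reg 12) (Reg 13), Arith Add 14 (Reg 7) (Imm 1), Store 5 (Reg 10) (Reg 14)]"

text \<open>The counter is register 7 because sorts and scans occupy registers 5 and 6.\<close>

definition loop :: "com \<Rightarrow> com" where
  "loop c = Upd Add 7 (Imm 0) (Imm 0) ;; While (Reg 7) (Reg 3) (c ;; Upd Add 7 (Reg 7) (Imm 1))"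

definition main_code :: com where
  "main_code =
     Upd Add 4 (Reg 2) (Reg 2) ;;
     ends_code 0 13 ;; ends_code 1 14 ;; Pass token_code ;;
     loop (adv_code 1 14 0 13) ;;
     dedup_code ;;
     loop (adv_code 0 13 1 14 ;; Pass record_code)"

lemma nxt_cong:
  assumes "\<And>a. a < m \<Longrightarrow> e a = f a"
  shows "nxt m key e p = nxt m key f p"
proof -
  have "(\<lambda>a. a < m \<and> key a = fst p \<and> snd p \<le> e a) = (\<lambda>a. a < m \<and> key a = fst p \<and> snd p \<le> f a)"
    using assms by auto
  then show ?thesis unfolding nxt_def by metis
qed

lemma nxt_less: "nxt m key e p = Suc a \<Longrightarrow> a < m \<and> key a = fst p"
  using LeastI_ex[of "\<lambda>a. a < m \<and> key a = fst p \<and> snd p \<le> e a"] by (auto simp: nxt_def split: if_splits)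

text \<open>The arrays hold the ends only for arc numbers below \<open>m\<close>, and no other
  entries are consulted.\<close>

lemma adv_cong:
  assumes "\<And>a. a < m \<Longrightarrow> e a = f a" "\<And>a. a < m \<Longrightarrow> e' a = f' a"
  shows "adv m key e key' e' p = adv m key f key' f' p"
  using nxt_less[of m key f p] assms
  by (cases "nxt m key f p") (auto simp: adv_def nxt_cong[of m e f, OF assms(1)])

context pram
begin

section \<open>Placing points, recording arcs, and the outer loop\<close>

lemma runs_token:
  assumes "cfg u"
  shows "runs N W (Pass token_code) (u, M, X) 30
    (u, put 17 N (\<lambda>i. M (0, i)) M, put 15 N (\<lambda>i. X (13, i)) X)"
    (is "runs _ _ _ _ _ (_, ?M, ?X)")
proof -
  let ?F = "\<lambda>v. {Cell (0, v), Cell (17, v), RCell (13, v), RCell (15, v)}"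
  show ?thesis
  proof (rule runs_pass[OF assms, where F = ?F])
    fix A i
    show "?M (A, i) = M (A, i)"
      if "\<forall>v<2 * N. Cell (A, i) \<notin> ?F v"
      using that[rule_format, of i] by (auto simp: put_apply)
    show "?X (A, i) = X (A, i)"
      if "\<forall>v<2 * N. RCell (A, i) \<notin> ?F v"
      using that[rule_format, of i] by (auto simp: put_apply)
  next
    fix r :: "nat \<Rightarrow> nat" and q :: "nat \<Rightarrow> real"
    assume r: "r 10 < 2 * N" "r 2 = N"
    show "foot token_code (r, q, M, X) \<subseteq> ?F (r 10) \<and>
      safe W token_code (r, q, M, X) \<and>
      agree (?F (r 10)) (lrun token_code (r, q, M, X)) ?M ?X"
      using r by (cases "r 10 < N") (auto simp: token_code_def grd_simps put_apply agree_def)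
  qed (auto simp: token_code_def grd_simps length_grd)
qed

text \<open>Quotient and remainder decode the place \<open>v * h + k\<close> in the path
  array.\<close>

definition recorded :: "nat \<Rightarrow> (nat \<times> nat \<Rightarrow> nat) \<Rightarrow> nat \<times> nat \<Rightarrow> nat" where
  "recorded k M x =
     (if fst x = 5 \<and> snd x < N \<and> 0 < M (18, snd x) then Suc k
      else if fst x = 6 \<and> snd x div h < N \<and> snd x mod h = k \<and> 0 < M (18, snd x div h) then M (18, snd x div h) - 1
      else M x)"

lemma runs_record:
  assumes u: "cfg u" "u 7 = k" "k < h"
  shows "runs N W (Pass record_code) (u, M, X) 54 (u, recorded k M, X)"
proof (rule runs_pass[OF u(1), where F = "\<lambda>v. if v < N then {Cell (18, v), Cell (5, v), Cell (6, v * h + k)} else {}"])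
  fix v w :: nat assume vw: "v \<noteq> w"
  have "v * h + k \<noteq> w * h + k" using vw u(3) by auto
  then show "(if v < N then {Cell (18, v), Cell (5, v), Cell (6, v * h + k)} else {}) \<inter>
    (if w < N then {Cell (18, w), Cell (5, w), Cell (6, w * h + k)} else {}) = {}"
    using vw by auto
next
  fix r :: "nat \<Rightarrow> nat" and q :: "nat \<Rightarrow> real"
  assume r: "r 10 < 2 * N" "r 2 = N" "r 3 = h" "r 7 = u 7"
  let ?v = "r 10"
  have idx: "(?v * h + k) div h = ?v" "(?v * h + k) mod h = k" using u(3) by auto
  consider "N \<le> ?v" | "?v < N" "M (18, ?v) = 0" | "?v < N" "0 < M (18, ?v)" by linarith
  then show "foot record_code (r, q, M, X) \<subseteq> (if ?v < N then {Cell (18, ?v), Cell (5, ?v), Cell (6, ?v * h + k)} else {}) \<and>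
    safe W record_code (r, q, M, X) \<and>
    agree (if ?v < N then {Cell (18, ?v), Cell (5, ?v), Cell (6, ?v * h + k)} else {})
     (lrun record_code (r, q, M, X)) (recorded k M) X"
  proof cases
    case 3
    have "?v * h + k < N * h"
    proof -
      have "?v * h + k < Suc ?v * h" using u(3) by simp
      also have "\<dots> \<le> N * h" using 3(1) by (intro mult_le_mono1) simp
      finally show ?thesis .
    qed
    then have "?v * h \<le> W" "?v * h + k \<le> W" "Suc k \<le> W" using W_bound u(3) by linarith+
    then show ?thesis
      using r u 3 W_bound idx by (simp add: record_code_def grd_simps agree_def recorded_def)
  qed (use r u idx W_bound in \<open>simp_all add: record_code_def grd_simps agree_def recorded_def\<close>)
next
  fix A i
  assume out: "\<forall>v<2 * N. Cell (A, i) \<notin> (if v < N then {Cell (18, v), Cell (5, v), Cell (6, v * h + k)} else {})"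
  have "i mod h \<noteq> k" if "A = 6" "i div h < N"
    using out[rule_format, of "i div h"] that div_mult_mod_eq[of i h] by auto
  then show "recorded k M (A, i) = M (A, i)"
    using out[rule_format, of i] by (auto simp: recorded_def)
qed (auto simp: record_code_def grd_simps length_grd)

lemma runs_loop:
  assumes u: "cfg u"
    and body: "\<And>s u1 M1 X1. s < h \<Longrightarrow> cfg u1 \<Longrightarrow> u1 7 = s \<Longrightarrow> I s M1 X1 \<Longrightarrow>
      \<exists>u' M' X'. runs N W c (u1, M1, X1) t (u', M', X') \<and> (\<forall>k. k \<noteq> 5 \<and> k \<noteq> 6 \<longrightarrow> u' k = u1 k) \<and> I (Suc s) M' X'"
    and init: "I 0 M X"
  obtains u' M' X' where "runs N W (loop c) (u, M, X) (h * (t + 3) + 3) (u', M', X')"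
    "cfg u'" "I h M' X'"
proof -
  define J where "J s g \<longleftrightarrow> (case g of (u', M', X') \<Rightarrow> cfg u' \<and> u' 7 = s \<and> I s M' X')" for s g
  define u1 where "u1 = u(7 := arith_val Add (opv u (Imm 0)) (opv u (Imm 0)))"
  have 1: "runs N W (Upd Add 7 (Imm 0) (Imm 0)) (u, M, X) 1 (u1, M, X)"
    unfolding u1_def using W_bound by (intro runs_Upd) auto
  have "\<exists>g'. runs N W (While (Reg 7) (Reg 3) (c ;; Upd Add 7 (Reg 7) (Imm 1))) (u1, M, X)
      (h * ((t + 1) + 2) + 2) g' \<and> J h g'"
  proof (rule runs_While)
    show "J 0 (u1, M, X)" using init u by (simp add: J_def u1_def cfg_def)
    fix s g assume s: "s < h" and J: "J s g"
    obtain u2 M2 X2 where g: "g = (u2, M2, X2)" by (cases g)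
    have c2: "cfg u2" and u2: "u2 7 = s" "I s M2 X2" using J by (auto simp: J_def g)
    obtain u3 M3 X3 where 3: "runs N W c (u2, M2, X2) t (u3, M3, X3)" "\<And>k. k \<noteq> 5 \<Longrightarrow> k \<noteq> 6 \<Longrightarrow> u3 k = u2 k"
      "I (Suc s) M3 X3"
      using body[OF s c2 u2] by blast
    define u4 where "u4 = u3(7 := arith_val Add (opv u3 (Reg 7)) (opv u3 (Imm 1)))"
    have 4: "runs N W (Upd Add 7 (Reg 7) (Imm 1)) (u3, M3, X3) 1 (u4, M3, X3)"
      unfolding u4_def using u2 s W_bound 3(2) by (intro runs_Upd) auto
    have "J (Suc s) (u4, M3, X3)" using c2 u2 3(2,3) by (auto simp: J_def u4_def cfg_def)
    then show "opv (ureg g) (Reg 7) < opv (ureg g) (Reg 3) \<and>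
      (\<exists>g'. runs N W (c ;; Upd Add 7 (Reg 7) (Imm 1)) g (t + 1) g' \<and> J (Suc s) g')"
      using runs_Seq[OF 3(1) 4] c2 u2 s by (auto simp: g cfg_def)
  next
    fix g assume "J h g"
    then show "\<not> opv (ureg g) (Reg 7) < opv (ureg g) (Reg 3)"
      by (cases g) (auto simp: J_def cfg_def)
  qed simp_all
  then obtain u' M' X' where 2: "runs N W (While (Reg 7) (Reg 3) (c ;; Upd Add 7 (Reg 7) (Imm 1))) (u1, M, X)
      (h * ((t + 1) + 2) + 2) (u', M', X')" and J: "J h (u', M', X')" by (metis prod_cases3)
  have "1 + (h * ((t + 1) + 2) + 2) = h * (t + 3) + 3" by (simp add: algebra_simps)
  then have "runs N W (loop c) (u, M, X) (h * (t + 3) + 3) (u', M', X')"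
    using runs_Seq[OF 1 2] by (simp only: loop_def)
  then show ?thesis using that J by (auto simp: J_def)
qed

end

text \<open>Joins the machine with the abstract flow read off its initial memory. Array 4 starts at
  0 as \<open>runs_finish_dedup\<close> demands, array 5 because no arc has been recorded
  yet.\<close>

locale traced = pram +
  fixes M0 :: "nat \<times> nat \<Rightarrow> nat" and X0 :: "nat \<times> nat \<Rightarrow> real" and lay :: "nat \<Rightarrow> nat"
  assumes flow: "layered_flow N h (\<lambda>a. M0 (0, a)) (\<lambda>a. M0 (Suc 0, a)) (\<lambda>a. X0 (0, a)) lay"
    and tails: "\<And>a. a < N \<Longrightarrow> M0 (0, a) < n" and heads: "\<And>a. a < N \<Longrightarrow> M0 (Suc 0, a) < n"
    and zero: "M0 (4, 0) = 0" "\<And>i. M0 (5, i) = 0"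
begin

sublocale layered_flow N h "\<lambda>a. M0 (0, a)" "\<lambda>a. M0 (Suc 0, a)" "\<lambda>a. X0 (0, a)" lay
  by (rule flow)

definition ready :: "(nat \<times> nat \<Rightarrow> nat) \<Rightarrow> (nat \<times> nat \<Rightarrow> real) \<Rightarrow> bool" where
  "ready M X \<longleftrightarrow> (\<forall>a. M (0, a) = M0 (0, a) \<and> M (1, a) = M0 (Suc 0, a)) \<and> (\<forall>a<N. X (13, a) = eo a \<and> X (14, a) = ei a)"

lemma ends_strict: "a < b \<Longrightarrow> b < N \<Longrightarrow> key a = key b \<Longrightarrow> ends key (\<lambda>a. X0 (0, a)) a < ends key (\<lambda>a. X0 (0, a)) b"
  using ends_less[of N "\<lambda>a. X0 (0, a)" a b key] pos by fastforce

lemma runs_bw: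
  assumes u: "cfg u" and M: "ready M X"
  obtains u' M' X' where "runs N W (adv_code 1 14 0 13) (u, M, X) tadv (u', M', X')"
    "\<And>k. k \<noteq> 5 \<Longrightarrow> k \<noteq> 6 \<Longrightarrow> u' k = u k" "same {10..18} M M'" "same {10, 11, 12, 15} X X'" "ready M' X'"
    "\<And>t. t < N \<Longrightarrow> (M' (17, t), X' (15, t)) = bw (M (17, t), X (15, t))"
proof -
  have mono: "\<forall>a b. a < b \<longrightarrow> b < N \<longrightarrow> M (1, a) = M (1, b) \<longrightarrow> X (14, a) < X (14, b)"
    using M ends_strict[where key = "\<lambda>a. M0 (Suc 0, a)"] by (auto simp: ready_def)
  have k: "(1::nat) < 10" "(0::nat) < 10" "{14, 13} = {13, 14 :: nat}" by auto
  have keys: "(\<lambda>a. M (1, a)) = (\<lambda>a. M0 (Suc 0, a))" "(\<lambda>a. M (0, a)) = (\<lambda>a. M0 (0, a))"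
    using M by (auto simp: ready_def)
  show ?thesis
  proof (rule runs_adv[where M = M and X = X and K = 1 and K' = 0 and E = 14 and E' = 13, OF u k mono])
    fix u' M' X' assume *: "runs N W (adv_code 1 14 0 13) (u, M, X) tadv (u', M', X')"
      "\<And>k. k \<noteq> 5 \<Longrightarrow> k \<noteq> 6 \<Longrightarrow> u' k = u k" "same {10..18} M M'" "same {10, 11, 12, 15} X X'"
      "\<And>t. t < N \<Longrightarrow> M' (18, t) = nxt N (\<lambda>a. M (1, a)) (\<lambda>a. X (14, a)) (M (17, t), X (15, t))"
      "\<And>t. t < N \<Longrightarrow> (M' (17, t), X' (15, t)) = adv N (\<lambda>a. M (1, a)) (\<lambda>a. X (14, a)) (\<lambda>a. M (0, a))
         (\<lambda>a. X (13, a)) (M (17, t), X (15, t))"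
    have bw: "(M' (17, t), X' (15, t)) = bw (M (17, t), X (15, t))" if "t < N" for t
      unfolding *(6)[OF that] keys by (rule adv_cong) (use M in \<open>auto simp: ready_def\<close>)
    have r: "ready M' X'" using M *(3,4) by (auto simp: ready_def same_def)
    show thesis
      by (rule that[OF *(1) _ *(3,4) r]) (rule *(2) bw; assumption)+
  qed
qed

lemma runs_fw:
  assumes u: "cfg u" and M: "ready M X"
  obtains u' M' X' where "runs N W (adv_code 0 13 1 14) (u, M, X) tadv (u', M', X')"
    "\<And>k. k \<noteq> 5 \<Longrightarrow> k \<noteq> 6 \<Longrightarrow> u' k = u k" "same {10..18} M M'" "same {10, 11, 12, 15} X X'" "ready M' X'"
    "\<And>t. t < N \<Longrightarrow> M' (18, t) = nx (M (17, t), X (15, t))"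
    "\<And>t. t < N \<Longrightarrow> (M' (17, t), X' (15, t)) = fw (M (17, t), X (15, t))"
proof -
  have mono: "\<forall>a b. a < b \<longrightarrow> b < N \<longrightarrow> M (0, a) = M (0, b) \<longrightarrow> X (13, a) < X (13, b)"
    using M ends_strict[where key = "\<lambda>a. M0 (0, a)"] by (auto simp: ready_def)
  have k: "(0::nat) < 10" "(1::nat) < 10" "{13, 14} = {13, 14 :: nat}" by auto
  have keys: "(\<lambda>a. M (1, a)) = (\<lambda>a. M0 (Suc 0, a))" "(\<lambda>a. M (0, a)) = (\<lambda>a. M0 (0, a))"
    using M by (auto simp: ready_def)
  show ?thesis
  proof (rule runs_adv[where M = M and X = X and K = 0 and K' = 1 and E = 13 and E' = 14, OF u k mono])
    fix u' M' X' assume *: "runs N W (adv_code 0 13 1 14) (u, M, X) tadv (u', M', X')"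
      "\<And>k. k \<noteq> 5 \<Longrightarrow> k \<noteq> 6 \<Longrightarrow> u' k = u k" "same {10..18} M M'" "same {10, 11, 12, 15} X X'"
      "\<And>t. t < N \<Longrightarrow> M' (18, t) = nxt N (\<lambda>a. M (0, a)) (\<lambda>a. X (13, a)) (M (17, t), X (15, t))"
      "\<And>t. t < N \<Longrightarrow> (M' (17, t), X' (15, t)) = adv N (\<lambda>a. M (0, a)) (\<lambda>a. X (13, a)) (\<lambda>a. M (1, a))
         (\<lambda>a. X (14, a)) (M (17, t), X (15, t))"
    have fw: "(M' (17, t), X' (15, t)) = fw (M (17, t), X (15, t))" if "t < N" for t
      unfolding *(6)[OF that] keys by (rule adv_cong) (use M in \<open>auto simp: ready_def\<close>)
    have nx: "M' (18, t) = nx (M (17, t), X (15, t))" if "t < N" for t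
      unfolding *(5)[OF that] keys by (rule nxt_cong) (use M in \<open>auto simp: ready_def\<close>)
    have r: "ready M' X'" using M *(3,4) by (auto simp: ready_def same_def)
    show thesis
      by (rule that[OF *(1) _ *(3,4) r]) (rule *(2) nx fw; assumption)+
  qed
qed

definition tmain :: nat where
  "tmain = 2 * (tsort + tscan + 96) + 37 + tdedup + h * (2 * tadv + 60)"

text \<open>The invariant \<open>B\<close> of the first loop equates the stored points with backward
  iterates; \<open>F\<close>, that of the second, equates them with forward iterates and the output
  arrays with initial parts of the paths.\<close>

lemma runs_main:
  assumes u: "u 1 = n" "u 2 = N" "u 3 = h"
  obtains u' M' X' p where "runs N W main_code (u, M0, X0) tmain (u', M', X')"
    "M' (4, 0) = card points" "bij_betw p {..<card points} points"
    "\<And>j. j < card points \<Longrightarrow> X' (1, j) = amount (p j) \<and> M' (5, j) = plen (p j)"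
    "\<And>j k. j < card points \<Longrightarrow> k < plen (p j) \<Longrightarrow> M' (6, j * h + k) = path (p j) ! k"
proof -
  define u0 where "u0 = u(4 := arith_val Add (opv u (Reg 2)) (opv u (Reg 2)))"
  have 0: "runs N W (Upd Add 4 (Reg 2) (Reg 2)) (u, M0, X0) 1 (u0, M0, X0)"
    unfolding u0_def using W_bound u by (intro runs_Upd) auto
  have c0: "cfg u0" using u by (simp add: cfg_def u0_def)
  have k: "(0::nat) < 10" "(1::nat) < 10" "12 < (13::nat)" "12 < (14::nat)" by auto
  have tails0: "\<forall>a<N. M0 (0, a) < n" using tails by simp
  obtain u1 M1 X1 where 1: "runs N W (ends_code 0 13) (u0, M0, X0) (tsort + tscan + 96) (u1, M1, X1)"
    "\<And>k. k \<noteq> 5 \<Longrightarrow> k \<noteq> 6 \<Longrightarrow> u1 k = u0 k" "same {10, 11, 12} M0 M1" "same {10, 11, 12, 13} X0 X1"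
    "\<And>a. a < N \<Longrightarrow> X1 (13, a) = eo a"
    using runs_ends[where M = M0 and X = X0 and K = 0 and D = 13, OF c0 k(1,3) tails0] by blast
  have c1: "cfg u1" using c0 1(2) by (simp add: cfg_def)
  have M1: "M1 (A, i) = M0 (A, i)" if "A < 10" for A i using that same_at[OF 1(3), of A] by auto
  have heads1: "\<forall>a<N. M1 (1, a) < n" using heads M1 by simp
  obtain u2 M2 X2 where 2: "runs N W (ends_code 1 14) (u1, M1, X1) (tsort + tscan + 96) (u2, M2, X2)"
    "\<And>k. k \<noteq> 5 \<Longrightarrow> k \<noteq> 6 \<Longrightarrow> u2 k = u1 k" "same {10, 11, 12} M1 M2" "same {10, 11, 12, 14} X1 X2"
    "\<And>a. a < N \<Longrightarrow> X2 (14, a) = ends (\<lambda>a. M1 (1, a)) (\<lambda>a. X1 (0, a)) a"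
    using runs_ends[where M = M1 and X = X1 and K = 1 and D = 14, OF c1 k(2,4) heads1] by blast
  have c2: "cfg u2" using c1 2(2) by (simp add: cfg_def)
  have M2: "M2 (A, i) = M0 (A, i)" if "A < 10" for A i using that same_at[OF 2(3), of A] M1 by auto
  have X1': "X1 (0, a) = X0 (0, a)" for a using same_at[OF 1(4), of 0] by auto
  have ready2: "ready M2 X2"
    using M2 same_at[OF 2(4), of 13] 1(5) 2(5) by (auto simp: ready_def M1 X1')
  define M3 where "M3 = put 17 N (\<lambda>i. M2 (0, i)) M2"
  define X3 where "X3 = put 15 N (\<lambda>i. X2 (13, i)) X2"
  have 3: "runs N W (Pass token_code) (u2, M2, X2) 30 (u2, M3, X3)"
    unfolding M3_def X3_def by (rule runs_token[OF c2])
  define B where "B s M X \<longleftrightarrow> (\<forall>A i. A < 10 \<longrightarrow> M (A, i) = M0 (A, i)) \<and> ready M X \<and>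
    (\<forall>t<N. (M (17, t), X (15, t)) = (bw ^^ s) (M0 (0, t), eo t))" for s M X
  have B0: "B 0 M3 X3"
    using M2 ready2 by (auto simp: B_def ready_def M3_def X3_def put_apply)
  have body: "\<exists>u' M' X'. runs N W (adv_code 1 14 0 13) (v, M, X) tadv (u', M', X') \<and>
      (\<forall>k. k \<noteq> 5 \<and> k \<noteq> 6 \<longrightarrow> u' k = v k) \<and> B (Suc s) M' X'" if "cfg v" "B s M X" for s v M X
  proof -
    have "ready M X" using that by (simp add: B_def)
    then show ?thesis
    proof (rule runs_bw[OF that(1)])
      fix u' M' X' assume *: "runs N W (adv_code 1 14 0 13) (v, M, X) tadv (u', M', X')"
        "\<And>k. k \<noteq> 5 \<Longrightarrow> k \<noteq> 6 \<Longrightarrow> u' k = v k" "same {10..18} M M'" "same {10, 11, 12, 15} X X'" "ready M' X'"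
        "\<And>t. t < N \<Longrightarrow> (M' (17, t), X' (15, t)) = bw (M (17, t), X (15, t))"
      have "(M' (17, t), X' (15, t)) = (bw ^^ Suc s) (M0 (0, t), eo t)" if "t < N" for t
        using *(6)[OF that] \<open>B s M X\<close> that by (simp add: B_def)
      moreover have "M' (A, i) = M0 (A, i)" if "A < 10" for A i
        using same_at[OF *(3), of A] \<open>B s M X\<close> that by (simp add: B_def)
      ultimately have "B (Suc s) M' X'" using *(5) unfolding B_def by blast
      then show ?thesis using *(1,2) by blast
    qed
  qed
  obtain u4 M4 X4 where 4: "runs N W (loop (adv_code 1 14 0 13)) (u2, M3, X3) (h * (tadv + 3) + 3) (u4, M4, X4)"
    "cfg u4" "B h M4 X4"
    using runs_loop[where I = B, OF c2 body B0] by blast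
  have tok4: "(M4 (17, t), X4 (15, t)) = (bw ^^ h) (M0 (0, t), eo t)" if "t < N" for t
    using 4(3) that by (simp add: B_def)
  have M4: "M4 (A, i) = M0 (A, i)" if "A < 10" for A i using 4(3) that by (simp add: B_def)
  have ready4: "ready M4 X4" using 4(3) by (simp add: B_def)
  have P: "(\<lambda>t. (M4 (17, t), X4 (15, t))) ` {..<N} = points"
    unfolding points_def using tok4 by (intro image_cong) auto
  have pts: "M4 (17, t) < n \<and> 0 < X4 (15, t)" if t: "t < N" for t
  proof -
    have "(M4 (17, t), X4 (15, t)) \<in> points" using t P by blast
    from points(1)[OF this] obtain a where "a < N" "M0 (0, a) = M4 (17, t)" "0 < X4 (15, t)"
      by (auto simp: on_out_def)
    then show ?thesis using tails[of a] by simp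
  qed
  then have valid: "\<forall>t<N. M4 (17, t) < n \<and> 0 < X4 (15, t)" by blast
  have "M4 (4, 0) = 0" using M4 zero by simp
  from runs_dedup[where M = M4 and X = X4, OF 4(2) this valid, unfolded P] obtain u5 M5 X5 where
    5: "runs N W dedup_code (u4, M4, X4) tdedup (u5, M5, X5)"
    "\<And>k. k \<noteq> 5 \<Longrightarrow> k \<noteq> 6 \<Longrightarrow> u5 k = u4 k" "same {4, 10, 11, 12, 17} M4 M5" "same {1, 10, 12, 15, 16} X4 X5"
    and card5: "M5 (4, 0) = card points" and bij5: "bij_betw (\<lambda>i. (M5 (17, i), X5 (15, i))) {..<card points} points"
    and rest5: "\<And>i. card points \<le> i \<Longrightarrow> i < N \<Longrightarrow> M5 (17, i) = n"
    and val5: "\<And>i. i < card points \<Longrightarrow>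
      X5 (1, i) = X5 (15, i) - Max (insert 0 {y. (M5 (17, i), y) \<in> points \<and> y < X5 (15, i)})"
    by blast
  have c5: "cfg u5" using 4(2) 5(2) by (simp add: cfg_def)
  define p where "p i = (M5 (17, i), X5 (15, i))" for i
  let ?c = "card points"
  have bij: "bij_betw p {..<?c} points" using bij5 by (simp add: p_def[abs_def])
  have cN: "?c \<le> N" by (rule card_points)
  have pP: "p j \<in> points" if "j < ?c" for j using bij_betwE[OF bij] that by simp
  have amt: "X5 (1, j) = amount (p j)" if "j < ?c" for j
    using val5[OF that] by (simp add: amount_def p_def)
  define F where "F s M X \<longleftrightarrow> ready M X \<and> M (4, 0) = ?c \<and> (\<forall>j<?c. X (1, j) = amount (p j)) \<and>
    (\<forall>j<?c. (M (17, j), X (15, j)) = (fw ^^ s) (p j)) \<and> (\<forall>j. ?c \<le> j \<and> j < N \<longrightarrow> M (17, j) = n) \<and>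
    (\<forall>j<?c. M (5, j) = min s (plen (p j)) \<and> (\<forall>k<min s (plen (p j)). M (6, j * h + k) = path (p j) ! k))"
    for s and M :: "nat \<times> nat \<Rightarrow> nat" and X :: "nat \<times> nat \<Rightarrow> real"
  have F0: "F 0 M5 X5"
    using ready4 card5 amt rest5 same_at[OF 5(3)] same_at[OF 5(4)] M4[of 5] zero
    by (auto simp: F_def ready_def p_def)
  have fbody: "\<exists>u' M' X'. runs N W (adv_code 0 13 1 14 ;; Pass record_code) (v, M, X) (tadv + 54) (u', M', X') \<and>
      (\<forall>k. k \<noteq> 5 \<and> k \<noteq> 6 \<longrightarrow> u' k = v k) \<and> F (Suc s) M' X'"
    if s: "s < h" and v: "cfg v" "v 7 = s" and F: "F s M X" for s v M X
  proof -
    have "ready M X" using F by (simp add: F_def)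
    then show ?thesis
    proof (rule runs_fw[OF v(1)])
    fix u' M' X' assume *: "runs N W (adv_code 0 13 1 14) (v, M, X) tadv (u', M', X')"
      "\<And>k. k \<noteq> 5 \<Longrightarrow> k \<noteq> 6 \<Longrightarrow> u' k = v k" "same {10..18} M M'" "same {10, 11, 12, 15} X X'" "ready M' X'"
      "\<And>t. t < N \<Longrightarrow> M' (18, t) = nx (M (17, t), X (15, t))"
      "\<And>t. t < N \<Longrightarrow> (M' (17, t), X' (15, t)) = fw (M (17, t), X (15, t))"
    have v': "cfg u'" "u' 7 = s" using v *(2) by (simp_all add: cfg_def)
    have run: "runs N W (adv_code 0 13 1 14 ;; Pass record_code) (v, M, X) (tadv + 54) (u', recorded s M', X')"
      by (rule runs_Seq[OF *(1) runs_record[OF v' s]])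
    have other: "recorded s M' (A, i) = M' (A, i)" if "A \<noteq> 5" "A \<noteq> 6" for A i
      using that by (simp add: recorded_def)
    have old: "M' (A, i) = M (A, i)" "X' (1, i) = X (1, i)" if "A < 10" for A i
      using same_at[OF *(3), of A] same_at[OF *(4), of 1] that by auto
    have "F (Suc s) (recorded s M') X'"
      unfolding F_def
    proof (intro conjI allI impI)
      show "ready (recorded s M') X'" using *(5) by (simp add: ready_def other)
      show "recorded s M' (4, 0) = ?c" using F old by (simp add: other F_def)
      fix j
      show "X' (1, j) = amount (p j)" if "j < ?c" using F old(2)[of 0] that by (simp add: F_def)
      show "(recorded s M' (17, j), X' (15, j)) = (fw ^^ Suc s) (p j)" if "j < ?c"
        using F *(7)[of j] that cN by (simp add: other F_def)
      \<comment> \<open>Entries left over after the removal of duplicates rest at \<open>n\<close>,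
        which is the tail of no arc; they never move and record nothing.\<close>
      show "recorded s M' (17, j) = n" if j: "?c \<le> j \<and> j < N"
      proof -
        have n: "M (17, j) = n" using F j by (simp add: F_def)
        have "nx (M (17, j), X (15, j)) = 0"
        proof (cases "nx (M (17, j), X (15, j))")
          case (Suc a)
          then show ?thesis using nxt_less[OF Suc] tails[of a] n by simp
        qed
        then have "fw (M (17, j), X (15, j)) = (M (17, j), X (15, j))" by (simp add: adv_def)
        then show ?thesis using *(7)[of j] j n by (simp add: other)
      qed
      assume j: "j < ?c"
      then have jN: "j < N" using cN by simp
      have M18: "M' (18, j) = nx ((fw ^^ s) (p j))" using *(6)[OF jN] F j by (simp add: F_def)
      then have iff: "0 < M' (18, j) \<longleftrightarrow> s < plen (p j)" using plen(2)[OF pP[OF j], of s] by auto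
      have M5: "M' (5, j) = min s (plen (p j))"
        and M6: "\<And>k. k < min s (plen (p j)) \<Longrightarrow> M' (6, j * h + k) = path (p j) ! k"
        using F j old by (auto simp: F_def)
      show "recorded s M' (5, j) = min (Suc s) (plen (p j))"
        using iff M5 jN by (auto simp: recorded_def)
      fix k assume k: "k < min (Suc s) (plen (p j))"
      then have kh: "k < h" using s by simp
      then have idx: "(j * h + k) div h = j" "(j * h + k) mod h = k" by auto
      show "recorded s M' (6, j * h + k) = path (p j) ! k"
      proof (cases "k = s")
        case True
        then show ?thesis using iff k idx jN M18 by (simp add: recorded_def path_def)
      next
        case False
        then show ?thesis using M6[of k] k idx by (simp add: recorded_def)
      qed
    qed
    then show ?thesis using run *(2) by blast
    qed
  qed
  obtain u6 M6 X6 where 6: "runs N W (loop (adv_code 0 13 1 14 ;; Pass record_code)) (u5, M5, X5)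
      (h * ((tadv + 54) + 3) + 3) (u6, M6, X6)" "F h M6 X6"
    using runs_loop[where I = F, OF c5 fbody F0] by blast
  have t: "1 + ((tsort + tscan + 96) + ((tsort + tscan + 96) + (30 + ((h * (tadv + 3) + 3) + (tdedup + (h * ((tadv + 54) + 3) + 3)))))) = tmain"
    by (simp add: tmain_def algebra_simps)
  have run: "runs N W main_code (u, M0, X0) tmain (u6, M6, X6)"
    using runs_Seq[OF 0 runs_Seq[OF 1(1) runs_Seq[OF 2(1) runs_Seq[OF 3 runs_Seq[OF 4(1) runs_Seq[OF 5(1) 6(1)]]]]]]
    unfolding t by (simp only: main_code_def)
  have le: "min h (plen (p j)) = plen (p j)" if "j < ?c" for j using plen(1)[OF pP[OF that]] by simp
  show ?thesis
    by (rule that[OF run _ bij]) (use 6(2) le in \<open>auto simp: F_def\<close>)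
qed

end

section \<open>Correctness on digraphs\<close>

lemma pcas_chain:
  assumes "\<And>k. k < length Q \<Longrightarrow> fst (Q ! k) = V k \<and> snd (Q ! k) = V (Suc k)"
  shows "pcas (V 0) Q (V (length Q))"
  using assms
proof (induction Q arbitrary: V)
  case (Cons e Q)
  have "pcas (V (Suc 0)) Q (V (Suc (length Q)))"
    using Cons.IH[of "\<lambda>k. V (Suc k)"] Cons.prems by force
  then show ?case using Cons.prems[of 0] by simp
qed simp

text \<open>Turns walks into paths. The bound on the ranks of all vertices is there for the
  induction: it excludes the new first vertex from the rest.\<close>

lemma distinct_pawalk_verts:
  fixes rank :: "'v \<Rightarrow> nat"
  assumes "pcas u Q v" "\<And>e. e \<in> set Q \<Longrightarrow> rank (fst e) < rank (snd e)"
  shows "distinct (pawalk_verts u Q) \<and> (\<forall>w\<in>set (pawalk_verts u Q). rank u \<le> rank w)"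
  using assms
proof (induction Q arbitrary: u)
  case (Cons e Q)
  then have "distinct (pawalk_verts (snd e) Q) \<and> (\<forall>w\<in>set (pawalk_verts (snd e) Q). rank (snd e) \<le> rank w)"
    by (intro Cons.IH) auto
  moreover have "rank (fst e) < rank (snd e)" "fst e = u" using Cons.prems by auto
  ultimately show ?case by fastforce
qed simp

text \<open>Without finiteness the sum in \<open>arc_flow\<close> could take its default value
  0.\<close>

lemma finite_S_T_paths:
  assumes "finite (parcs D)"
  shows "finite (S_T_paths D S T h)"
proof (rule finite_subset)
  show "S_T_paths D S T h \<subseteq> {Q. set Q \<subseteq> parcs D \<and> length Q \<le> h}"
    by (auto simp: S_T_paths_def pre_digraph.apath_def pre_digraph.awalk_def)
  show "finite {Q. set Q \<subseteq> parcs D \<and> length Q \<le> h}"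
    using assms by (rule finite_lists_length_le)
qed

locale instance_data =
  fixes D :: "nat pair_pre_digraph" and U :: "nat \<times> nat \<Rightarrow> real" and S T :: "nat set" and h :: nat
    and fh :: "nat \<times> nat \<Rightarrow> real" and \<nu> :: "nat \<Rightarrow> nat" and \<alpha> :: "nat \<Rightarrow> nat \<times> nat"
    and L :: "nat \<Rightarrow> nat set"
  assumes h: "1 \<le> h" and dag: "S_T_DAG D S T"
    and L: "disjoint_family_on L {1..h+1}" "(\<Union>i\<in>{1..h+1}. L i) = pverts D" "L 1 = S" "L (h+1) = T"
      "\<forall>(u, v) \<in> parcs D. \<exists>i\<in>{1..h+1}. \<exists>j\<in>{1..h+1}. i < j \<and> u \<in> L i \<and> v \<in> L j"
    and flow_fh: "S_T_flow D U S T fh" and supp: "parcs D = flow_supp D fh" and num: "numbering D \<nu> \<alpha>"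
begin

abbreviation "n \<equiv> card (pverts D)"
abbreviation "N \<equiv> card (parcs D)"
abbreviation "start \<equiv> input D \<nu> \<alpha> S T h fh"

definition rank :: "nat \<Rightarrow> nat" where
  "rank v = (THE i. i \<in> {1..h+1} \<and> v \<in> L i)"

definition vert :: "nat \<Rightarrow> nat" where
  "vert = inv_into (pverts D) \<nu>"

lemma fin: "finite (pverts D)" "finite (parcs D)"
  and arc_verts: "e \<in> parcs D \<Longrightarrow> fst e \<in> pverts D \<and> snd e \<in> pverts D"
proof -
  interpret pair_fin_digraph D using dag by (simp add: S_T_DAG_def)
  show "finite (pverts D)" "finite (parcs D)" by (rule pair_finite_verts, rule pair_finite_arcs)
  show "e \<in> parcs D \<Longrightarrow> fst e \<in> pverts D \<and> snd e \<in> pverts D"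
    using arc_fst_in_verts arc_snd_in_verts by blast
qed

lemma nu: "inj_on \<nu> (pverts D)" "v \<in> pverts D \<Longrightarrow> \<nu> v < n" "v \<in> pverts D \<Longrightarrow> vert (\<nu> v) = v"
  using num by (auto simp: numbering_def vert_def bij_betw_def)

lemma alpha: "inj_on \<alpha> {..<N}" "a < N \<Longrightarrow> \<alpha> a \<in> parcs D" "e \<in> parcs D \<Longrightarrow> \<exists>a<N. \<alpha> a = e"
proof -
  have b: "bij_betw \<alpha> {..<N} (parcs D)" using num by (simp add: numbering_def)
  show "inj_on \<alpha> {..<N}" by (rule bij_betw_imp_inj_on[OF b])
  show "a < N \<Longrightarrow> \<alpha> a \<in> parcs D" using bij_betwE[OF b] by simp
  show "\<exists>a<N. \<alpha> a = e" if "e \<in> parcs D"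
  proof -
    have "e \<in> \<alpha> ` {..<N}" using that bij_betw_imp_surj_on[OF b] by (simp only:)
    then show ?thesis by (metis imageE lessThan_iff)
  qed
qed

lemma rank_eq: "i \<in> {1..h+1} \<Longrightarrow> v \<in> L i \<Longrightarrow> rank v = i"
  unfolding rank_def using L(1) unfolding disjoint_family_on_def by (intro the_equality) blast+

lemma rank_arc:
  assumes "e \<in> parcs D"
  shows "1 \<le> rank (fst e)" "rank (fst e) < rank (snd e)" "rank (snd e) \<le> h + 1"
proof -
  obtain i j where ij: "i \<in> {1..h+1}" "j \<in> {1..h+1}" "i < j" "fst e \<in> L i" "snd e \<in> L j"
    using L(5) assms by (cases e) force
  then show "1 \<le> rank (fst e)" "rank (fst e) < rank (snd e)" "rank (snd e) \<le> h + 1"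
    using rank_eq[OF ij(1,4)] rank_eq[OF ij(2,5)] by auto
qed

lemma sources: "v \<in> pverts D \<Longrightarrow> v \<in> S \<longleftrightarrow> (\<forall>e\<in>parcs D. snd e \<noteq> v)"
  and sinks: "v \<in> pverts D \<Longrightarrow> v \<in> T \<longleftrightarrow> (\<forall>e\<in>parcs D. fst e \<noteq> v)"
  using dag by (auto simp: S_T_DAG_def in_arcs_def out_arcs_def)

lemma fh_pos: "e \<in> parcs D \<Longrightarrow> 0 < fh e"
  using supp unfolding flow_supp_def by blast

lemma start_mem:
  "a < N \<Longrightarrow> mem start (0, a) = \<nu> (fst (\<alpha> a))" "a < N \<Longrightarrow> mem start (Suc 0, a) = \<nu> (snd (\<alpha> a))"
  "a < N \<Longrightarrow> rmem start (0, a) = fh (\<alpha> a)" "mem start (4, i) = 0" "mem start (5, i) = 0"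
  by (simp_all add: input_def)

lemma sum_filter: "(\<Sum>c | c < N \<and> P (\<alpha> c). fh (\<alpha> c)) = (\<Sum>e | e \<in> parcs D \<and> P e. fh e)"
proof (rule sum.reindex_bij_betw)
  show "bij_betw \<alpha> {c. c < N \<and> P (\<alpha> c)} {e. e \<in> parcs D \<and> P e}"
    unfolding bij_betw_def
  proof (intro conjI equalityI subsetI)
    show "inj_on \<alpha> {c. c < N \<and> P (\<alpha> c)}" by (rule inj_on_subset[OF alpha(1)]) auto
    show "e \<in> {e. e \<in> parcs D \<and> P e}" if "e \<in> \<alpha> ` {c. c < N \<and> P (\<alpha> c)}" for e
      using that alpha(2) by blast
    show "e \<in> \<alpha> ` {c. c < N \<and> P (\<alpha> c)}" if "e \<in> {e. e \<in> parcs D \<and> P e}" for e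
      using that alpha(3)[of e] by blast
  qed
qed

lemma sum_arcs:
  assumes "v \<in> pverts D"
  shows "(\<Sum>c | c < N \<and> mem start (0, c) = \<nu> v. rmem start (0, c)) = (\<Sum>e\<in>out_arcs D v. fh e)"
    "(\<Sum>c | c < N \<and> mem start (Suc 0, c) = \<nu> v. rmem start (0, c)) = (\<Sum>e\<in>in_arcs D v. fh e)"
proof -
  have eq: "\<nu> w = \<nu> v \<longleftrightarrow> w = v" if "w \<in> pverts D" for w
    using nu(1) assms that by (auto dest: inj_onD)
  have "mem start (0, c) = \<nu> v \<longleftrightarrow> fst (\<alpha> c) = v" "mem start (Suc 0, c) = \<nu> v \<longleftrightarrow> snd (\<alpha> c) = v"
    if "c < N" for c
    using eq arc_verts[OF alpha(2)[OF that]] that by (simp_all add: start_mem)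
  then have sets: "{c. c < N \<and> mem start (0, c) = \<nu> v} = {c. c < N \<and> fst (\<alpha> c) = v}"
    "{c. c < N \<and> mem start (Suc 0, c) = \<nu> v} = {c. c < N \<and> snd (\<alpha> c) = v}" by blast+
  have "(\<Sum>c | c < N \<and> Q c. rmem start (0, c)) = (\<Sum>c | c < N \<and> Q c. fh (\<alpha> c))" for Q
    by (rule sum.cong) (auto simp: start_mem(3))
  then show "(\<Sum>c | c < N \<and> mem start (0, c) = \<nu> v. rmem start (0, c)) = (\<Sum>e\<in>out_arcs D v. fh e)"
    "(\<Sum>c | c < N \<and> mem start (Suc 0, c) = \<nu> v. rmem start (0, c)) = (\<Sum>e\<in>in_arcs D v. fh e)"
    using sum_filter[of "\<lambda>e. fst e = v"] sum_filter[of "\<lambda>e. snd e = v"]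
    unfolding sets by (simp_all add: out_arcs_def in_arcs_def)
qed

text \<open>A vertex with an entering and a leaving arc is neither in \<open>S\<close> nor in
  \<open>T\<close>, so conservation of the given flow applies there.\<close>

lemma layered: "layered_flow N h (\<lambda>a. mem start (0, a)) (\<lambda>a. mem start (Suc 0, a)) (\<lambda>a. rmem start (0, a)) (\<lambda>x. rank (vert x))"
proof
  fix a assume a: "a < N"
  note e = alpha(2)[OF a]
  show "0 < rmem start (0, a)" using fh_pos[OF e] a by (simp add: start_mem)
  have vs: "vert (mem start (0, a)) = fst (\<alpha> a)" "vert (mem start (Suc 0, a)) = snd (\<alpha> a)"
    using nu(3) arc_verts[OF e] a by (auto simp: start_mem)
  show "1 \<le> rank (vert (mem start (0, a)))" "rank (vert (mem start (0, a))) < rank (vert (mem start (Suc 0, a)))"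
    "rank (vert (mem start (Suc 0, a))) \<le> h + 1"
    unfolding vs by (rule rank_arc[OF e])+
  fix b assume b: "b < N" and eq: "mem start (Suc 0, a) = mem start (0, b)"
  have v: "snd (\<alpha> a) \<in> pverts D" using arc_verts[OF e] by simp
  have "snd (\<alpha> a) = fst (\<alpha> b)"
    using eq a b arc_verts[OF e] arc_verts[OF alpha(2)[OF b]] nu(1) by (auto simp: start_mem dest: inj_onD)
  then have "snd (\<alpha> a) \<notin> S \<union> T" using sources[OF v] sinks[OF v] e alpha(2)[OF b] by auto
  then have "(\<Sum>e\<in>in_arcs D (snd (\<alpha> a)). fh e) = (\<Sum>e\<in>out_arcs D (snd (\<alpha> a)). fh e)"
    using flow_fh v by (simp add: S_T_flow_def)
  then show "(\<Sum>c | c < N \<and> mem start (Suc 0, c) = mem start (Suc 0, a). rmem start (0, c)) =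
      (\<Sum>c | c < N \<and> mem start (0, c) = mem start (Suc 0, a). rmem start (0, c))"
    using sum_arcs[OF v] a by (simp add: start_mem(2))
qed

text \<open>Arcs are pairs, hence never parallel. This bounds both the word size and the logarithm
  of the number of arcs in terms of \<open>n\<close>.\<close>

lemma N_le: "N \<le> n * n"
proof -
  have "parcs D \<subseteq> pverts D \<times> pverts D" using arc_verts by (auto simp: mem_Times_iff)
  then have "N \<le> card (pverts D \<times> pverts D)" using fin by (intro card_mono) auto
  then show ?thesis by (simp add: card_cartesian_product)
qed

text \<open>28 = 8 + 1 + 2 + 1 + 16, the coefficients of the sum in \<open>W_large\<close>; each
  quantity there is at most the cube of \<open>n + h\<close>.\<close>

definition W :: nat where "W = 28 * (n + h) ^ 3"

lemma W_large: "8 * N + n + 2 * h + N * h + 16 \<le> W"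
proof -
  let ?s = "n + h"
  have s: "1 \<le> ?s" using h by simp
  have 1: "?s \<le> ?s ^ 3" "1 \<le> ?s ^ 3" using s self_le_power[of ?s 3] by auto
  have "n * n \<le> ?s * ?s" by (intro mult_le_mono) auto
  then have 2: "N \<le> ?s * ?s" using N_le by simp
  have "?s * ?s * 1 \<le> ?s * ?s * ?s" using s by (intro mult_le_mono) auto
  then have 3: "?s * ?s \<le> ?s ^ 3" by (simp add: power3_eq_cube)
  have "N * h \<le> ?s * ?s * ?s" using 2 by (intro mult_le_mono) auto
  then have 4: "N * h \<le> ?s ^ 3" by (simp add: power3_eq_cube)
  show ?thesis unfolding W_def using 1 2 3 4 by linarith
qed

end

text \<open>Without arcs there is no processor; that case is settled in
  \<open>result\<close>.\<close>

locale nonempty_instance = instance_data +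
  assumes arcs: "0 < N"
begin

sublocale traced N n h W "mem start" "rmem start" "\<lambda>x. rank (vert x)"
proof (intro traced.intro traced_axioms.intro pram.intro)
  show "layered_flow N h (\<lambda>a. mem start (0, a)) (\<lambda>a. mem start (Suc 0, a)) (\<lambda>a. rmem start (0, a)) (\<lambda>x. rank (vert x))"
    by (rule layered)
  show "mem start (0, a) < n" "mem start (Suc 0, a) < n" if "a < N" for a
    using that nu(2) arc_verts[OF alpha(2)[OF that]] by (auto simp: start_mem)
qed (use arcs W_large in \<open>auto simp: start_mem\<close>)

lemma start_rep: "rep N W 0 ((\<lambda>_. 0)(1 := n, 2 := N, 3 := h), mem start, rmem start) start"
proof -
  have "mem start x \<le> W" for x
  proof -
    obtain A i where x: "x = (A, i)" by (cases x)
    have "i < N \<Longrightarrow> \<nu> (fst (\<alpha> i)) < n \<and> \<nu> (snd (\<alpha> i)) < n" using nu(2) arc_verts alpha(2) by blast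
    then show ?thesis using W_large by (auto simp: x input_def)
  qed
  then show ?thesis using W_large by (auto simp: fits_word_def input_def)
qed

definition walk :: "nat \<times> real \<Rightarrow> (nat \<times> nat) list" where
  "walk z = map \<alpha> (path z)"

lemma path_less: "z \<in> points \<Longrightarrow> set (path z) \<subseteq> {..<N}"
  using path_nth(1)[of z] by (auto simp: in_set_conv_nth length_path)

text \<open>The first vertex has no entering arc because tracing back rests there, the last no
  leaving arc because the forward search fails; in an \<open>S_T_DAG\<close> this places them in
  \<open>S\<close> and \<open>T\<close>.\<close>

lemma walk_path:
  assumes z: "z \<in> points"
  shows "walk z \<in> S_T_paths D S T h"
proof -
  define V where "V k = vert (fst ((fw ^^ k) z))" for k
  have nth: "fst (walk z ! k) = V k" "snd (walk z ! k) = V (Suc k)" "walk z ! k \<in> parcs D"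
    if k: "k < plen z" for k
  proof -
    have w: "walk z ! k = \<alpha> (path z ! k)" using k by (simp add: walk_def length_path)
    note p = path_nth(1-3)[OF z k]
    have e: "\<alpha> (path z ! k) \<in> parcs D" by (rule alpha(2)[OF p(1)])
    show "fst (walk z ! k) = V k" "snd (walk z ! k) = V (Suc k)" "walk z ! k \<in> parcs D"
      using nu(3) arc_verts[OF e] e p(1) unfolding V_def p(2,3)[symmetric] w by (auto simp: start_mem)
  qed
  have len: "length (walk z) = plen z" by (simp add: walk_def length_path)
  have cas: "pcas (V 0) (walk z) (V (plen z))"
    using pcas_chain[of "walk z" V] nth len by simp
  have sub: "set (walk z) \<subseteq> parcs D" using nth(3) len by (metis in_set_conv_nth subsetI)
  note pl = plen(1,3)[OF z]
  obtain q where q: "plen z = Suc q" using pl(2) by (cases "plen z") auto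
  have V0: "V 0 \<in> pverts D" using nth(1)[OF pl(2)] arc_verts[OF nth(3)[OF pl(2)]] by simp
  have lt: "q < plen z" using q by simp
  have Vl: "V (plen z) \<in> pverts D" using nth(2)[OF lt] arc_verts[OF nth(3)[OF lt]] q by simp
  have nuV: "\<nu> (V 0) = fst z" "\<nu> (V (plen z)) = fst ((fw ^^ plen z) z)"
  proof -
    have e: "\<alpha> (path z ! 0) \<in> parcs D" "\<alpha> (path z ! q) \<in> parcs D"
      using path_nth(1)[OF z, of 0] path_nth(1)[OF z, of q] pl q alpha(2) by auto
    have "fst z = \<nu> (fst (\<alpha> (path z ! 0)))" using path_nth(1,2)[OF z pl(2)] by (simp add: start_mem)
    then show "\<nu> (V 0) = fst z" using nu(3) arc_verts[OF e(1)] by (simp add: V_def)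
    have "fst ((fw ^^ plen z) z) = \<nu> (snd (\<alpha> (path z ! q)))"
      using path_nth(1,3)[OF z, of q] q by (simp add: start_mem)
    then show "\<nu> (V (plen z)) = fst ((fw ^^ plen z) z)" using nu(3) arc_verts[OF e(2)] by (simp add: V_def)
  qed
  have "V 0 \<in> S"
    unfolding sources[OF V0]
  proof
    fix e assume "e \<in> parcs D"
    then obtain a where a: "a < N" "\<alpha> a = e" using alpha(3) by blast
    have "\<nu> (snd e) \<noteq> \<nu> (V 0)" using points(2)[OF z a(1)] a nuV by (simp add: start_mem)
    then show "snd e \<noteq> V 0" by auto
  qed
  moreover have "V (plen z) \<in> T"
    unfolding sinks[OF Vl]
  proof
    fix e assume "e \<in> parcs D"
    then obtain a where a: "a < N" "\<alpha> a = e" using alpha(3) by blast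
    have "\<nu> (fst e) \<noteq> \<nu> (V (plen z))" using path_end[OF z a(1)] a nuV by (simp add: start_mem)
    then show "fst e \<noteq> V (plen z)" by auto
  qed
  moreover have "pre_digraph.apath D (V 0) (walk z) (V (plen z))"
    using distinct_pawalk_verts[OF cas, of rank] rank_arc(2) sub cas V0
    by (auto simp: pre_digraph.apath_def pre_digraph.awalk_def cas_with_proj_eq awalk_verts_with_proj_eq)
  ultimately show ?thesis using pl(1) len by (auto simp: S_T_paths_def)
qed

lemma inj_walk: "inj_on walk points"
proof (rule inj_onI)
  fix y z assume yz: "y \<in> points" "z \<in> points" "walk y = walk z"
  have "path y = path z"
    using map_inj_on[of \<alpha> "path y" "path z"] yz inj_on_subset[OF alpha(1)] path_less by (auto simp: walk_def)
  then show "y = z" using inj_path yz by (auto dest: inj_onD)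
qed

definition f :: "(nat \<times> nat) list \<Rightarrow> real" where
  "f Q = (if Q \<in> walk ` points then amount (inv_into points walk Q) else 0)"

lemma f_walk: "z \<in> points \<Longrightarrow> f (walk z) = amount z"
  using inj_walk by (simp add: f_def)

lemma supp_f: "path_supp f = walk ` points"
proof
  show "walk ` points \<subseteq> path_supp f" using f_walk amount_pos by (auto simp: path_supp_def)
  show "path_supp f \<subseteq> walk ` points" by (auto simp: path_supp_def f_def split: if_splits)
qed

text \<open>\<open>f\<close> vanishes outside the image of \<open>points\<close>, and injectivity of
  \<open>walk\<close> turns the remaining sum into that of \<open>path_sum\<close>.\<close>

lemma arc_flow_f:
  assumes "e \<in> parcs D"
  shows "arc_flow D S T h f e = fh e"
proof -
  obtain a where a: "a < N" "\<alpha> a = e" using alpha(3)[OF assms] by blast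
  have mem: "e \<in> set (walk z) \<longleftrightarrow> a \<in> set (path z)" if "z \<in> points" for z
    using path_less[OF that] alpha(1) a by (auto simp: walk_def dest: inj_onD)
  have "arc_flow D S T h f e = (\<Sum>Q\<in>walk ` {z \<in> points. e \<in> set (walk z)}. f Q)"
    unfolding arc_flow_def
    using finite_S_T_paths[OF fin(2)] walk_path
    by (intro sum.mono_neutral_right) (auto simp: f_def)
  also have "\<dots> = (\<Sum>z | z \<in> points \<and> e \<in> set (walk z). amount z)"
    using inj_on_subset[OF inj_walk] by (subst sum.reindex) (auto simp: f_walk)
  also have "\<dots> = (\<Sum>z | z \<in> points \<and> a \<in> set (path z). amount z)"
    using mem by (intro sum.cong) auto
  also have "\<dots> = rmem start (0, a)" by (rule path_sum[OF a(1)])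
  finally show ?thesis using a by (simp add: start_mem)
qed

lemma length_flow_f: "length_flow h D U S T f"
  unfolding length_flow_def
proof (intro conjI ballI allI impI)
  show "0 \<le> f Q" for Q
  proof (cases "Q \<in> walk ` points")
    case True
    then obtain z where "z \<in> points" "Q = walk z" by blast
    then show ?thesis using f_walk[of z] amount_pos[of z] by simp
  qed (simp add: f_def)
  show "f Q = 0" if "Q \<notin> S_T_paths D S T h" for Q using that walk_path by (auto simp: f_def)
  show "arc_flow D S T h f e \<le> U e" if "e \<in> parcs D" for e
    using arc_flow_f[OF that] flow_fh that by (simp add: S_T_flow_def)
qed

lemma card_f: "card (path_supp f) \<le> N"
  unfolding supp_f using card_image_le[OF finite_points, of walk] card_points by simp

text \<open>Every cost is absorbed into \<open>q = lg * lg\<close>: 366 = 177 + 186 + 3 for a sort,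
  168 = 147 + 21 for a scan, 1584 for one round of each loop, 2329 for the rest, and 4000 exceeds
  the sum of the last two. From \<open>lg < 2 + 2 * log 2 n\<close> and \<open>2 \<le> n\<close>
  follows the bound \<open>4 * log 2 n\<close>, whose square supplies the factor 16.\<close>

lemma time: "real tmain \<le> 64000 * real h * log 2 (real n) ^ 2"
proof -
  obtain e where "e \<in> parcs D" using arcs by (metis card.empty ex_in_conv less_irrefl)
  then have "fst e \<noteq> snd e" "fst e \<in> pverts D" "snd e \<in> pverts D"
    using rank_arc(2)[of e] arc_verts[of e] by auto
  then have "2 \<le> n" using card_mono[OF fin(1), of "{fst e, snd e}"] by simp
  then have log1: "1 \<le> log 2 (real n)" by simp
  have "lg \<noteq> 0" using lg(1) arcs by (intro notI) simp
  then have lg1: "1 \<le> lg" by simp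
  then have "2 ^ (lg - 1) < 2 * N" using lg(2)[of "lg - 1"] by simp
  then have "2 ^ (lg - 1) < 2 * (n * n)" using N_le by simp
  then have "real (2 ^ (lg - 1)) < real (2 * (n * n))" by (simp only: of_nat_less_iff)
  then have "2 powr real (lg - 1) < 2 * (real n * real n)" by (simp add: powr_realpow)
  then have "real (lg - 1) < log 2 (2 * (real n * real n))"
    using \<open>2 \<le> n\<close> by (subst less_log_iff) auto
  also have "\<dots> = 1 + 2 * log 2 (real n)" using \<open>2 \<le> n\<close> by (simp add: log_mult)
  finally have lgle: "real lg \<le> 4 * log 2 (real n)" using lg1 log1 by (simp add: of_nat_diff)
  define q where "q = lg * lg"
  have q: "lg \<le> q" "1 \<le> q" using lg1 by (simp_all add: q_def)
  have "tsort = 177 * q + 186 * lg + 3" by (simp add: tsort_def q_def algebra_simps)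
  then have ts: "tsort \<le> 366 * q" using q by linarith
  have tc: "tscan \<le> 168 * q" using q by (simp add: tscan_def)
  have "2 * tadv + 60 \<le> 1584 * q" using ts tc q by (simp add: tadv_def)
  then have "h * (2 * tadv + 60) \<le> h * (1584 * q)" by (rule mult_le_mono2)
  moreover have "2 * (tsort + tscan + 96) + 37 + tdedup \<le> 2329 * q" using ts tc q by (simp add: tdedup_def)
  moreover have "2329 * q \<le> h * (2329 * q)" using h by simp
  ultimately have "tmain \<le> h * (1584 * q) + h * (2329 * q)" unfolding tmain_def by linarith
  also have "\<dots> \<le> 4000 * (h * q)" by simp
  finally have "real tmain \<le> real (4000 * (h * q))" by (simp only: of_nat_le_iff)
  also have "\<dots> = 4000 * real h * (real lg)\<^sup>2" by (simp add: q_def power2_eq_square)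
  also have "\<dots> \<le> 4000 * real h * (4 * log 2 (real n))\<^sup>2"
    using lgle by (intro mult_left_mono power_mono) auto
  finally show ?thesis by (simp add: power_mult_distrib)
qed

lemma correct:
  "\<exists>t c. real t \<le> 64000 * real h * log 2 (real n) ^ 2 \<and>
     erew_run (compile 0 main_code) N W start t c \<and> outputs \<alpha> h c f"
proof -
  let ?u = "(\<lambda>_ :: nat. 0 :: nat)(1 := n, 2 := N, 3 := h)"
  have u: "?u 1 = n" "?u 2 = N" "?u 3 = h" by auto
  obtain u' M' X' p where run: "runs N W main_code (?u, mem start, rmem start) tmain (u', M', X')"
    and M4: "M' (4, 0) = card points" and p: "bij_betw p {..<card points} points"
    and X1: "\<And>j. j < card points \<Longrightarrow> X' (1, j) = amount (p j) \<and> M' (5, j) = plen (p j)"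
    and M6: "\<And>j k. j < card points \<Longrightarrow> k < plen (p j) \<Longrightarrow> M' (6, j * h + k) = path (p j) ! k"
    by (rule runs_main[OF u]) blast
  have code: "code_at (compile 0 main_code) 0 (compile 0 main_code)" by (simp add: code_at_def)
  obtain t c where t: "t \<le> tmain" and reach: "reach (compile 0 main_code) N W start t c"
    and rep: "rep N W (0 + csize main_code) (u', M', X') c"
    using run code start_rep unfolding runs_def by blast
  have pc: "pc (procs c i) = length (compile 0 main_code)" if "i < N" for i
    using rep that by (simp add: length_compile)
  have M: "mem c = M'" "rmem c = X'" using rep by auto
  have "erew_run (compile 0 main_code) N W start t c"
    using reach pc by (auto simp: erew_run_def reach_def fetch_def)
  moreover have "outputs \<alpha> h c f"
  proof -
    have out: "output_path \<alpha> h c j = walk (p j)" if j: "j < card points" for j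
    proof -
      have "output_path \<alpha> h c j = map (\<lambda>k. \<alpha> (path (p j) ! k)) [0..<plen (p j)]"
        unfolding output_path_def M using X1[OF j] M6[OF j] by simp
      also have "\<dots> = walk (p j)" unfolding walk_def
        by (rule nth_equalityI) (simp_all add: length_path)
      finally show ?thesis .
    qed
    have pj: "p j \<in> points" if "j < card points" for j using bij_betwE[OF p] that by simp
    have "bij_betw (walk \<circ> p) {..<card points} (walk ` points)"
      by (rule bij_betw_trans[OF p]) (simp add: bij_betw_def inj_walk)
    then have "bij_betw (output_path \<alpha> h c) {..<card points} (path_supp f)"
      unfolding supp_f by (rule iffD1[OF bij_betw_cong, rotated]) (simp add: out)
    then show ?thesis using X1 out pj f_walk by (simp add: outputs_def M M4)
  qed
  moreover have "real t \<le> 64000 * real h * log 2 (real n) ^ 2" using time t by linarith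
  ultimately show ?thesis by blast
qed

end

context instance_data
begin

text \<open>Without arcs every vertex would be both source and sink, hence in the first and in the
  last layer, which are disjoint for \<open>1 \<le> h\<close>. So the instance is empty, and a run
  of length 0 without processors will do.\<close>

lemma no_verts:
  assumes "N = 0"
  shows "pverts D = {}" "parcs D = {}"
proof -
  show e: "parcs D = {}" using assms fin(2) by simp
  show "pverts D = {}"
  proof (rule equals0I)
    fix v assume v: "v \<in> pverts D"
    have "v \<in> L 1" "v \<in> L (h + 1)" using sources[OF v] sinks[OF v] L(3,4) e by auto
    then have "(1::nat) = h + 1" using rank_eq[of 1 v] rank_eq[of "h + 1" v] by simp
    then show False using h by simp
  qed
qed

lemma result:
  "\<exists>t c f. real t \<le> real (64000 :: nat) * real h * log 2 (real n) ^ 2 \<and>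
     erew_run (compile 0 main_code) N (28 * (n + h) ^ 3) start t c \<and> outputs \<alpha> h c f \<and>
     length_flow h D U S T f \<and> (\<forall>a \<in> parcs D. arc_flow D S T h f a = fh a) \<and> card (path_supp f) \<le> N"
proof (cases "N = 0")
  case False
  then interpret nonempty_instance D U S T h fh \<nu> \<alpha> L by unfold_locales simp
  show ?thesis using correct length_flow_f arc_flow_f card_f unfolding W_def by force
next
  case True
  note e = no_verts[OF True]
  have S: "S = {}" "T = {}" using dag e by (auto simp: S_T_DAG_def)
  have "mem start x = 0" for x using e S by (cases x) (auto simp: input_def)
  then have "erew_run (compile 0 main_code) N (28 * (n + h) ^ 3) start 0 start"
    using True by (auto simp: erew_run_def fits_word_def)
  moreover have "outputs \<alpha> h start (\<lambda>_. 0)" by (simp add: outputs_def path_supp_def start_mem bij_betw_def)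
  moreover have "length_flow h D U S T (\<lambda>_. 0)" by (simp add: length_flow_def e)
  ultimately show ?thesis using e
    by (intro exI[of _ 0] exI[of _ start] exI[of _ "\<lambda>_. 0"]) (simp add: path_supp_def)
qed

end

theorem theorem10p1:
  shows "\<exists>(\<pi> :: prog) (C :: nat) (k :: nat) (K :: nat) (q :: nat).
    \<forall>(D :: nat pair_pre_digraph) (U :: nat \<times> nat \<Rightarrow> real) (S :: nat set) (T :: nat set) (h :: nat)
      (fh :: nat \<times> nat \<Rightarrow> real) (\<nu> :: nat \<Rightarrow> nat) (\<alpha> :: nat \<Rightarrow> nat \<times> nat).
      h \<ge> 1 \<and> layer_S_T_DAG h D S T \<and> S_T_flow D U S T fh \<and> parcs D = flow_supp D fh \<and>
      numbering D \<nu> \<alpha> \<longrightarrow>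
      (\<exists>(t :: nat) (c :: machine) (f :: (nat \<times> nat) list \<Rightarrow> real).
        real t \<le> real C * real h * log 2 (real (card (pverts D))) ^ k \<and>
        erew_run \<pi> (card (parcs D)) (K * (card (pverts D) + h) ^ q) (input D \<nu> \<alpha> S T h fh) t c \<and>
        outputs \<alpha> h c f \<and>
        length_flow h D U S T f \<and>
        (\<forall>a \<in> parcs D. arc_flow D S T h f a = fh a) \<and>
        card (path_supp f) \<le> card (parcs D))"
\<comment> \<open>One program serves all inputs, as the sizes are read from registers 1 to 3. The
  exponent 2 comes from bitonic sorting, the exponent 3 from the index bound \<open>N * h\<close> of
  the path array with \<open>N \<le> n * n\<close>.\<close>
proof (rule exI[of _ "compile 0 main_code"], rule exI[of _ 64000], rule exI[of _ 2], rule exI[of _ 28],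
    rule exI[of _ 3], intro allI impI)
  fix D :: "nat pair_pre_digraph" and U S T h fh \<nu> \<alpha>
  assume *: "h \<ge> 1 \<and> layer_S_T_DAG h D S T \<and> S_T_flow D U S T fh \<and> parcs D = flow_supp D fh \<and> numbering D \<nu> \<alpha>"
  then obtain L where "disjoint_family_on L {1..h+1}" "(\<Union>i\<in>{1..h+1}. L i) = pverts D" "L 1 = S" "L (h+1) = T"
      "\<forall>(u, v) \<in> parcs D. \<exists>i\<in>{1..h+1}. \<exists>j\<in>{1..h+1}. i < j \<and> u \<in> L i \<and> v \<in> L j" "S_T_DAG D S T"
    unfolding layer_S_T_DAG_def by blast
  then interpret instance_data D U S T h fh \<nu> \<alpha> L using * by unfold_locales auto
  show "\<exists>t c f. real t \<le> real 64000 * real h * log 2 (real (card (pverts D))) ^ 2 \<and>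
     erew_run (compile 0 main_code) (card (parcs D)) (28 * (card (pverts D) + h) ^ 3) (input D \<nu> \<alpha> S T h fh) t c \<and>
     outputs \<alpha> h c f \<and> length_flow h D U S T f \<and> (\<forall>a \<in> parcs D. arc_flow D S T h f a = fh a) \<and>
     card (path_supp f) \<le> card (parcs D)"
    by (rule result)
qed

end
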